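(* (1) Every real function $f\in L_2(S^2)$ has a representation of the form $$f(x,y,z)=\sum_{d=0}^\infty\Big\{\lambda_{d,0}+\sum_{k=1}^d\lambda_{d,k}\prod_{j=1}^k (a_{d,k,j}\,x+b_{d,k,j}\,y+c_{d,k,j}\,z)\Big\}$$ with real $\lambda_{d,k}, a_{d,k,j}, b_{d,k,j}, c_{d,k,j}$, where the series converges in the $L_2$-norm and the mutually orthogonal polynomials in the braces, restricted to $S^2$, are (for each $d$) $d$-th spherical harmonics. This representation is unique up to reordering and rescaling of the linear factors in each of the products. (2) Let $\mathcal F(S^2)$ be the set of real continuous functions $f$ on $S^2$ that admit a representation as a series $$\lambda_0+\sum_{d=1}^\infty \lambda_d\prod_{k=1}^d (a_{d,k}\,x+b_{d,k}\,y+c_{d,k}\,z)$$ with real coefficients that converges uniformly on $S^2$. Then $\mathcal F(S^2)$ is dense in the sup-norm in the space of real continuous functions on $S^2$, and it is $O(3)$-invariant. Each function from $\mathcal F(S^2)$ admits a canonical extension (given by the same series) into the interior of the unit ball $D^3$, where it produces a real analytic function.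
   Context: $S^2=\{x^2+y^2+z^2=1\}\subset\mathbb R^3$ is the unit sphere with its standard rotation-invariant measure; $L_2(S^2)$ is the corresponding space of square-integrable functions. A $d$-th spherical harmonic is an eigenfunction of the Laplace operator on $S^2$ with eigenvalue $-d(d+1)$, i.e. the restriction to $S^2$ of a homogeneous harmonic polynomial of degree $d$. "Rescaling" means redistributing scalar factors among the coefficient $\lambda$ and the linear factors of a given product without changing the product. *)

theory Defs
  imports "HOL-Analysis.Analysis"
begin

abbreviation S2 :: "(real^3) set"
  where "S2 \<equiv> sphere 0 1"

text \<open>
  The surface measure of the unit sphere as a cone measure: \<open>A \<subseteq> S2\<close> gets three times
  the volume of the solid cone \<open>{t a | 0 < t \<le> 1, a \<in> A}\<close>, because
  \<open>dx = r\<^sup>2 dr d\<sigma>\<close> and \<open>\<integral>\<^sub>0\<^sup>1 r\<^sup>2 dr = 1/3\<close>.  Invariance under orthogonal maps and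
  the total mass \<open>4 \<pi>\<close> are checked below.
\<close>
definition S2_measure :: "(real^3) measure"
  where "S2_measure =
    distr (density (restrict_space lborel (cball 0 1 - {0})) (\<lambda>_. 3)) (restrict_space borel S2) sgn"

lemma space_S2_measure [simp]: "space S2_measure = S2"
  and sets_S2_measure [simp, measurable_cong]: "sets S2_measure = sets (restrict_space borel S2)"
  by (simp_all add: S2_measure_def space_restrict_space)

lemma emeasure_S2_measure:
  assumes "A \<in> sets borel" "A \<subseteq> S2"
  shows "emeasure S2_measure A = 3 * emeasure lborel {x \<in> cball 0 1 - {0}. sgn x \<in> A}"
proof -
  let ?B = "cball 0 1 - {0} :: (real^3) set"
  have sgn_borel: "sgn \<in> borel_measurable (borel :: (real^3) measure)"
    unfolding sgn_div_norm[abs_def] by measurable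
  have m: "sgn \<in> measurable (density (restrict_space lborel ?B) (\<lambda>_. 3)) (restrict_space borel S2)"
  proof (rule measurable_restrict_space2)
    show "sgn \<in> space (density (restrict_space lborel ?B) (\<lambda>_. 3)) \<rightarrow> S2"
      by (auto simp: space_restrict_space norm_sgn)
    show "sgn \<in> borel_measurable (density (restrict_space lborel ?B) (\<lambda>_. 3))"
      using sgn_borel by (simp add: measurable_restrict_space1)
  qed
  have A: "A \<in> sets (restrict_space borel S2)"
    using assms by (simp add: sets_restrict_space_iff)
  have eq: "sgn -` A \<inter> space (density (restrict_space lborel ?B) (\<lambda>_. 3)) = {x \<in> ?B. sgn x \<in> A}"
    by (auto simp: space_restrict_space)
  have "sgn -` A \<inter> space (density (restrict_space lborel ?B) (\<lambda>_. 3))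
      \<in> sets (density (restrict_space lborel ?B) (\<lambda>_. 3))"
    using measurable_sets[OF m A] .
  then have "{x \<in> ?B. sgn x \<in> A} \<in> sets (restrict_space lborel ?B)"
    unfolding eq by simp
  then show ?thesis
    unfolding S2_measure_def emeasure_distr[OF m A] eq
    by (subst emeasure_density_const) (simp, subst emeasure_restrict_space, auto)
qed

lemma emeasure_S2: "emeasure S2_measure S2 = ennreal (4 * pi)"
proof -
  have "{x \<in> cball 0 1 - {0 :: real^3}. sgn x \<in> S2} = cball 0 1 - {0}"
    by (auto simp: norm_sgn)
  moreover have "emeasure lborel (cball 0 1 - {0 :: real^3}) = emeasure lborel (cball 0 1 :: (real^3) set)"
    by (rule emeasure_Diff_null_set) (auto simp: null_sets_def)
  moreover have "\<dots> = ennreal (4 / 3 * pi)"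
    by (subst emeasure_cball) (simp_all add: eval_unit_ball_vol)
  ultimately have "emeasure S2_measure S2 = ennreal 3 * ennreal (4 / 3 * pi)"
    by (simp add: emeasure_S2_measure)
  also have "\<dots> = ennreal (4 * pi)"
    by (subst ennreal_mult[symmetric]) auto
  finally show ?thesis .
qed

lemma S2_measure_orthogonal_invariant:
  assumes R: "orthogonal_transformation R" and A: "A \<in> sets borel" "A \<subseteq> S2"
  shows "emeasure S2_measure (R ` A) = emeasure S2_measure A"
proof -
  let ?C = "\<lambda>A. {x \<in> cball 0 1 - {0}. sgn x \<in> A} :: (real^3) set"
  have lin: "linear R" and bijR: "bij R" and nrm: "\<And>x. norm (R x) = norm x"
    using R by (auto simp: orthogonal_transformation_bij orthogonal_transformation_norm
        orthogonal_transformation_linear)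
  have sgnR: "sgn (R x) = R (sgn x)" for x
    by (simp add: sgn_div_norm nrm linear_scale[OF lin])
  have inj: "R x = R y \<longleftrightarrow> x = y" for x y
    using bijR by (auto simp: bij_def inj_def)
  have R0: "R x = 0 \<longleftrightarrow> x = 0" for x
    by (metis norm_eq_zero nrm)
  have img: "?C (R ` A) = R ` ?C A"
  proof (intro equalityI subsetI)
    fix y assume y: "y \<in> ?C (R ` A)"
    obtain x where "y = R x" using bijR by (metis bij_pointE)
    with y show "y \<in> R ` ?C A"
      by (auto simp: nrm sgnR R0 inj)
  qed (auto simp: nrm sgnR R0)
  have Rinv: "orthogonal_transformation (inv R)"
    using R by (rule orthogonal_transformation_inv)
  have RA: "R ` A \<in> sets borel"
  proof -
    have "inv R \<in> borel_measurable borel"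
      using Rinv by (intro borel_measurable_continuous_onI linear_continuous_on)
        (simp add: linear_conv_bounded_linear[symmetric] orthogonal_transformation_linear)
    moreover have "R ` A = inv R -` A"
      using bijR by (rule bij_image_Collect_eq[of R "\<lambda>x. x \<in> A", simplified, folded vimage_def])
    ultimately show ?thesis using measurable_sets[of "inv R" borel borel A] A by simp
  qed
  have RAS: "R ` A \<subseteq> S2" using A by (auto simp: nrm)
  have Cb: "?C B \<in> sets borel" if "B \<in> sets borel" for B
  proof -
    have "sgn \<in> borel_measurable (borel :: (real^3) measure)"
      unfolding sgn_div_norm[abs_def] by measurable
    then have "sgn -` B \<inter> (cball 0 1 - {0}) \<in> sets (borel :: (real^3) measure)"
      using measurable_sets[of sgn borel borel B] that by simp
    moreover have "?C B = sgn -` B \<inter> (cball 0 1 - {0})" by auto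
    ultimately show ?thesis by simp
  qed
  have bdd: "?C B \<in> lmeasurable" if "B \<in> sets borel" for B
  proof (rule bounded_set_imp_lmeasurable)
    show "bounded (?C B)" by (rule bounded_subset[OF bounded_cball[of 0 1]]) auto
    show "?C B \<in> sets lebesgue" using Cb[OF that] by (simp add: sets_completionI_sets)
  qed
  have "measure lebesgue (?C (R ` A)) = measure lebesgue (?C A)"
    unfolding img by (rule measure_orthogonal_image[OF R bdd[OF A(1)]])
  then have "emeasure lebesgue (?C (R ` A)) = emeasure lebesgue (?C A)"
    by (simp only: emeasure_eq_measure2[OF bdd[OF RA]] emeasure_eq_measure2[OF bdd[OF A(1)]])
  then show ?thesis
    using Cb[OF RA] Cb[OF A(1)] A RA RAS
    by (simp add: emeasure_S2_measure)
qed

definition square_integrable_S2 :: "(real^3 \<Rightarrow> real) \<Rightarrow> bool"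
  where "square_integrable_S2 f \<longleftrightarrow>
    f \<in> borel_measurable S2_measure \<and> integrable S2_measure (\<lambda>p. (f p)\<^sup>2)"

definition L2_norm_S2 :: "(real^3 \<Rightarrow> real) \<Rightarrow> real"
  where "L2_norm_S2 f = sqrt (LINT p|S2_measure. (f p)\<^sup>2)"

definition laplacian :: "(real^3 \<Rightarrow> real) \<Rightarrow> real^3 \<Rightarrow> real"
  where "laplacian P p = (\<Sum>i\<in>UNIV. (deriv ^^ 2) (\<lambda>t. P (p + t *\<^sub>R axis i 1)) 0)"

text \<open>The zero function counts as a spherical harmonic of every degree.\<close>
definition spherical_harmonic :: "nat \<Rightarrow> (real^3 \<Rightarrow> real) \<Rightarrow> bool"
  where "spherical_harmonic d g \<longleftrightarrow>
    (\<exists>P. real_polynomial_function P \<and> (\<forall>t p. P (t *\<^sub>R p) = t ^ d * P p) \<and>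
         (\<forall>p. laplacian P p = 0) \<and> (\<forall>p\<in>S2. g p = P p))"

text \<open>
  A vector \<open>v j = (a, b, c)\<close> encodes the linear form \<open>a x + b y + c z = v j \<bullet> (x, y, z)\<close>.
\<close>
definition linear_product :: "nat \<Rightarrow> (nat \<Rightarrow> real^3) \<Rightarrow> real^3 \<Rightarrow> real"
  where "linear_product k v p = (\<Prod>j=1..k. v j \<bullet> p)"

text \<open>
  Equality of \<open>l \<cdot> v\<^sub>1 \<cdots> v\<^sub>k\<close> and \<open>l' \<cdot> v'\<^sub>1 \<cdots> v'\<^sub>k\<close> up to reordering the linear factors and
  moving scalars between them and the coefficient.  In a vanishing product the scalar
  \<open>0\<close> may be moved into any factor, so all vanishing products are identified.
\<close>
definition same_up_to_order_and_scaling ::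
    "nat \<Rightarrow> real \<Rightarrow> (nat \<Rightarrow> real^3) \<Rightarrow> real \<Rightarrow> (nat \<Rightarrow> real^3) \<Rightarrow> bool"
  where "same_up_to_order_and_scaling k l v l' v' \<longleftrightarrow>
    (l = 0 \<or> (\<exists>j\<in>{1..k}. v j = 0)) \<and> (l' = 0 \<or> (\<exists>j\<in>{1..k}. v' j = 0)) \<or>
    (\<exists>\<pi> s. \<pi> permutes {1..k} \<and> (\<forall>j\<in>{1..k}. s j \<noteq> 0 \<and> v' j = s j *\<^sub>R v (\<pi> j)) \<and>
           l = l' * (\<Prod>j=1..k. s j))"

definition multipole_block ::
    "(nat \<Rightarrow> nat \<Rightarrow> real) \<Rightarrow> (nat \<Rightarrow> nat \<Rightarrow> nat \<Rightarrow> real^3) \<Rightarrow> nat \<Rightarrow> real^3 \<Rightarrow> real"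
  where "multipole_block l v d p = l d 0 + (\<Sum>k=1..d. l d k * linear_product k (v d k) p)"

definition multipole_representation ::
    "(real^3 \<Rightarrow> real) \<Rightarrow> (nat \<Rightarrow> nat \<Rightarrow> real) \<Rightarrow> (nat \<Rightarrow> nat \<Rightarrow> nat \<Rightarrow> real^3) \<Rightarrow> bool"
  where "multipole_representation f l v \<longleftrightarrow>
    (\<forall>d. spherical_harmonic d (multipole_block l v d)) \<and>
    (\<lambda>N. L2_norm_S2 (\<lambda>p. f p - (\<Sum>d\<le>N. multipole_block l v d p))) \<longlonglongrightarrow> 0"

definition product_partial_sum ::
    "(nat \<Rightarrow> real) \<Rightarrow> (nat \<Rightarrow> nat \<Rightarrow> real^3) \<Rightarrow> nat \<Rightarrow> real^3 \<Rightarrow> real"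
  where "product_partial_sum l v N p = l 0 + (\<Sum>d=1..N. l d * linear_product d (v d) p)"

text \<open>
  Functions on the sphere are represented by total functions; only their values on the
  sphere are constrained.
\<close>
definition product_series_on_S2 ::
    "(real^3 \<Rightarrow> real) \<Rightarrow> (nat \<Rightarrow> real) \<Rightarrow> (nat \<Rightarrow> nat \<Rightarrow> real^3) \<Rightarrow> bool"
  where "product_series_on_S2 f l v \<longleftrightarrow>
    uniform_limit S2 (product_partial_sum l v) f sequentially"

definition F_S2 :: "(real^3 \<Rightarrow> real) set"
  where "F_S2 = {f. continuous_on S2 f \<and> (\<exists>l v. product_series_on_S2 f l v)}"

text \<open>
  Local expansion in a power series in several variables; \<open>\<alpha>\<close> ranges over all
  multi-indices.
\<close>
definition real_analytic_on :: "(real^'n \<Rightarrow> real) \<Rightarrow> (real^'n) set \<Rightarrow> bool"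
    (infixl \<open>real'_analytic'_on\<close> 50)
  where "g real_analytic_on U \<longleftrightarrow>
    (\<forall>p\<in>U. \<exists>r>0. \<exists>c :: ('n \<Rightarrow> nat) \<Rightarrow> real. \<forall>q\<in>ball p r.
       ((\<lambda>\<alpha>. c \<alpha> * (\<Prod>i\<in>UNIV. (q $ i - p $ i) ^ \<alpha> i)) has_sum g q) UNIV)"

end

theory Submission
  imports Defs "HOL-Complex_Analysis.Conformal_Mappings" "HOL-Computational_Algebra.Fundamental_Theorem_Algebra"
begin

text \<open>
  \<^bold>\<open>Sylvester's theorem.\<close>  Everything rests on the following algebraic fact: a form \<open>P\<close> of degree \<open>d\<close> on
  three-dimensional space is a scalar times a product of \<open>d\<close> real linear forms up to a multiple of \<open>\<bar>p\<bar>\<^sup>2 = p \<bullet> p\<close>.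
  For \<open>d \<ge> 1\<close> the form vanishes at a nonzero complex null point \<open>a + i b\<close>, because the null cone is a rational curve and
  one-variable polynomials have complex roots.  The vectors \<open>a\<close> and \<open>b\<close> can be taken orthonormal; let \<open>n\<close>
  complete them to a frame.  Restricted to the plane \<open>n \<bullet> p = 0\<close>, the form is a real binary form
  that vanishes at \<open>(1, i)\<close>, hence is divisible by the sum of the squares of its two variables.  This splits off the factor \<open>n \<bullet> p\<close>
  (\<open>form_linear_factor_modulo_norm_square\<close>).  On the sphere \<open>\<bar>p\<bar>\<^sup>2 = 1\<close>, so the remainder is a form of
  degree \<open>d - 2\<close>, and every polynomial of degree \<open>n\<close> becomes on the sphere a sum with one
  product of \<open>d\<close> linear forms for each \<open>d \<le> n\<close> (\<open>sum_of_forms_eq_sum_of_linear_products\<close>).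

  \<^bold>\<open>Uniqueness\<close> also comes from the null cone.  If two such sums agree on the sphere, then after separating
  parities and multiplying with powers of \<open>\<bar>p\<bar>\<^sup>2\<close> their top terms agree on the null cone.  There a product of
  linear forms becomes a product of complex polynomials of degree at most two, and a common root of two
  factors makes the real linear forms proportional.  So the factors can be matched one by one, the
  top terms are equal, and the argument descends (\<open>sum_of_linear_products_unique\<close>).

  \<^bold>\<open>Spherical harmonics.\<close>  A form is a harmonic form plus \<open>\<bar>p\<bar>\<^sup>2\<close> times a form of lower degree.  Harmonic forms of
  different degrees are orthogonal on the sphere: the infinitesimal rotations are skew-symmetric by
  rotation invariance, and the sum of their squares has eigenvalue \<open>- d (d + 1)\<close> on harmonic forms of degree
  \<open>d\<close>.  Polynomials are dense in \<open>L\<^sub>2\<close>, so the partial sums of the projections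
  to the harmonic forms converge (\<open>harmonic_expansion_exists\<close>), and Sylvester's theorem rewrites each summand.
  Orthogonality determines the summands, and the uniqueness of products does the rest.

  \<^bold>\<open>Uniform series.\<close>  By Sylvester's theorem all polynomials lie in \<open>F_S2\<close>, so density is the theorem of Stone and
  Weierstrass, and invariance under orthogonal maps holds since composing a linear form with such
  a map gives a linear form.  For the analytic extension, the terms of a uniformly convergent series are bounded on the sphere by a constant \<open>M\<close>.
  A partial derivative of a form of degree \<open>d\<close> is bounded on the sphere by \<open>10 d\<close> times the bound for the form, an inequality of Bernstein's
  type that follows from the maximum principle on complexified circles (\<open>form_pd_bound\<close>).  It implies that
  the Taylor coefficients of the degree \<open>d\<close> term at \<open>p\<close>, weighted with powers of a radius \<open>r\<close>, have absolute
  sum at most \<open>M (\<bar>p\<bar> + 30 r)\<^sup>d\<close>.  For \<open>\<bar>p\<bar> < 1\<close> and small \<open>r\<close> this is a geometric series, and the double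
  series can be rearranged into a power series about \<open>p\<close>.
\<close>

unbundle no fps_syntax

lemma scaled_sphere_point:
  obtains q :: "real^3" where "q \<in> S2" "p = norm p *\<^sub>R q"
proof (cases "p = 0")
  case True
  then show ?thesis using that[of "axis 1 1"] by (simp add: norm_axis_1)
next
  case False
  then show ?thesis using that[of "sgn p"] by (simp add: norm_sgn sgn_div_norm)
qed

lemmas polynomial_linear = real_polynomial_function.intros(1)
  and polynomial_const = real_polynomial_function.intros(2)
  and polynomial_add = real_polynomial_function.intros(3)
  and polynomial_mult = real_polynomial_function.intros(4)

section \<open>Partial derivatives of polynomial functions\<close>

definition pd :: "3 \<Rightarrow> (real^3 \<Rightarrow> real) \<Rightarrow> real^3 \<Rightarrow> real"
  where "pd k P p = deriv (\<lambda>t. P (p + t *\<^sub>R axis k 1)) 0"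

lemma real_polynomial_function_coordinate [intro]:
  "real_polynomial_function (\<lambda>p :: real^3. p $ k)"
  by (intro polynomial_linear bounded_linear_vec_nth)

lemma has_real_derivative_along_axis:
  assumes "(P has_derivative (\<lambda>h. \<Sum>k\<in>UNIV. h $ k * G k)) (at (p + t *\<^sub>R axis i 1))"
  shows "((\<lambda>t. P (p + t *\<^sub>R axis i (1::real) :: real^3)) has_real_derivative G i) (at t)"
proof -
  have "((\<lambda>t. p + t *\<^sub>R axis i 1) has_derivative (\<lambda>s. s *\<^sub>R axis i 1)) (at t)"
    by (auto intro!: derivative_eq_intros)
  from has_derivative_compose[OF this assms]
  have "((\<lambda>t. P (p + t *\<^sub>R axis i 1)) has_derivative
      (\<lambda>s. \<Sum>k\<in>UNIV. (s *\<^sub>R axis i 1) $ k * G k)) (at t)" .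
  moreover have "(\<lambda>s. \<Sum>k\<in>UNIV. (s *\<^sub>R axis i 1) $ k * G k) = (*) (G i)"
    using exhaust_3[of i] by (auto simp: sum_3 axis_def fun_eq_iff)
  ultimately show ?thesis
    by (simp only: has_field_derivative_def)
qed

lemma bounded_linear_coordinates:
  assumes "bounded_linear (f :: real^3 \<Rightarrow> real)"
  shows "f = (\<lambda>p. \<Sum>k\<in>UNIV. p $ k * f (axis k 1))"
proof
  fix p
  have "f p = f (\<Sum>k\<in>UNIV. p $ k *\<^sub>R axis k 1)"
    using basis_expansion[of p] by (simp add: scalar_mult_eq_scaleR)
  then show "f p = (\<Sum>k\<in>UNIV. p $ k * f (axis k 1))"
    using assms by (simp add: linear_sum bounded_linear.linear linear_scale)
qed

lemma polynomial_gradient_exists: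
  assumes "real_polynomial_function (P :: real^3 \<Rightarrow> real)"
  shows "\<exists>G. (\<forall>k. real_polynomial_function (G k)) \<and>
    (\<forall>p. (P has_derivative (\<lambda>h. \<Sum>k\<in>UNIV. h $ k * G k p)) (at p))"
  using assms
proof (induction P rule: real_polynomial_function.induct)
  case (linear f)
  have "(f has_derivative (\<lambda>h. \<Sum>k\<in>UNIV. h $ k * f (axis k 1))) (at p)" for p
    using bounded_linear_imp_has_derivative[OF linear] bounded_linear_coordinates[OF linear] by metis
  then show ?case
    using polynomial_const by (intro exI[of _ "\<lambda>k _. f (axis k 1)"]) blast
next
  case (const c)
  show ?case by (intro exI[of _ "\<lambda>k _. 0"]) auto
next
  case (add f g)
  then obtain F G where "\<forall>k. real_polynomial_function (F k)" "\<forall>k. real_polynomial_function (G k)"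
    and "\<forall>p. (f has_derivative (\<lambda>h. \<Sum>k\<in>UNIV. h $ k * F k p)) (at p)"
        "\<forall>p. (g has_derivative (\<lambda>h. \<Sum>k\<in>UNIV. h $ k * G k p)) (at p)" by blast
  then show ?case
    by (intro exI[of _ "\<lambda>k p. F k p + G k p"])
      (auto intro!: derivative_eq_intros polynomial_add simp: algebra_simps sum.distrib)
next
  case (mult f g)
  then obtain F G where *: "\<forall>k. real_polynomial_function (F k)" "\<forall>k. real_polynomial_function (G k)"
    and **: "\<And>p. (f has_derivative (\<lambda>h. \<Sum>k\<in>UNIV. h $ k * F k p)) (at p)"
        "\<And>p. (g has_derivative (\<lambda>h. \<Sum>k\<in>UNIV. h $ k * G k p)) (at p)" by blast
  have "((\<lambda>x. f x * g x) has_derivative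
      (\<lambda>h. \<Sum>k\<in>UNIV. h $ k * (f p * G k p + F k p * g p))) (at p)" for p
    using has_derivative_mult[OF **[of p]]
    by (simp add: algebra_simps sum.distrib sum_distrib_left sum_distrib_right)
  then show ?case
    using * mult.hyps polynomial_add polynomial_mult
    by (intro exI[of _ "\<lambda>k p. f p * G k p + F k p * g p"]) blast
qed

lemma
  assumes "real_polynomial_function P"
  shows polynomial_pd [intro]: "real_polynomial_function (pd k P)"
    and polynomial_has_derivative: "(P has_derivative (\<lambda>h. \<Sum>k\<in>UNIV. h $ k * pd k P p)) (at p)"
proof -
  obtain G where G: "\<And>k. real_polynomial_function (G k)"
      "\<And>p. (P has_derivative (\<lambda>h. \<Sum>k\<in>UNIV. h $ k * G k p)) (at p)"
    using polynomial_gradient_exists[OF assms] by blast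
  have "pd k P = G k" for k
  proof
    fix p
    have "((\<lambda>t. P (p + t *\<^sub>R axis k 1)) has_real_derivative G k p) (at 0)"
      by (rule has_real_derivative_along_axis) (use G(2)[of p] in simp)
    then show "pd k P p = G k p"
      unfolding pd_def by (simp add: DERIV_imp_deriv)
  qed
  with G show "real_polynomial_function (pd k P)"
    "(P has_derivative (\<lambda>h. \<Sum>k\<in>UNIV. h $ k * pd k P p)) (at p)" by simp_all
qed

lemma polynomial_DERIV_axis:
  assumes "real_polynomial_function P"
  shows "((\<lambda>t. P (p + t *\<^sub>R axis k 1)) has_real_derivative pd k P (p + t *\<^sub>R axis k 1)) (at t)"
proof -
  show ?thesis
    by (rule has_real_derivative_along_axis) (rule polynomial_has_derivative[OF assms])
qed

lemma pd_eqI: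
  assumes "((\<lambda>t. P (p + t *\<^sub>R axis k 1)) has_real_derivative D) (at 0)"
  shows "pd k P p = D"
  using assms unfolding pd_def by (rule DERIV_imp_deriv)

lemma pd_const [simp]: "pd k (\<lambda>_. c) = (\<lambda>_. 0)"
  by (rule ext, rule pd_eqI) simp

lemma pd_coordinate: "pd k (\<lambda>p. p $ i) = (\<lambda>_. if i = k then 1 else 0)"
  by (rule ext, rule pd_eqI) (auto intro!: derivative_eq_intros simp: axis_def)

lemma pd_inner: "pd k (\<lambda>p. v \<bullet> p) = (\<lambda>_. v $ k)"
  by (rule ext, rule pd_eqI) (auto intro!: derivative_eq_intros simp: inner_axis algebra_simps inner_add_right)

context
  fixes P Q :: "real^3 \<Rightarrow> real"
  assumes P: "real_polynomial_function P" and Q: "real_polynomial_function Q"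
begin

lemma pd_add: "pd k (\<lambda>p. P p + Q p) = (\<lambda>p. pd k P p + pd k Q p)"
  using polynomial_DERIV_axis[OF P, where t = 0] polynomial_DERIV_axis[OF Q, where t = 0]
  by (intro ext pd_eqI) (auto intro!: derivative_eq_intros)

lemma pd_diff: "pd k (\<lambda>p. P p - Q p) = (\<lambda>p. pd k P p - pd k Q p)"
  using polynomial_DERIV_axis[OF P, where t = 0] polynomial_DERIV_axis[OF Q, where t = 0]
  by (intro ext pd_eqI) (auto intro!: derivative_eq_intros)

lemma pd_mult: "pd k (\<lambda>p. P p * Q p) = (\<lambda>p. pd k P p * Q p + P p * pd k Q p)"
proof (intro ext pd_eqI)
  fix p
  show "((\<lambda>t. P (p + t *\<^sub>R axis k 1) * Q (p + t *\<^sub>R axis k 1)) has_real_derivative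
      pd k P p * Q p + P p * pd k Q p) (at 0)"
    using DERIV_mult[OF polynomial_DERIV_axis[OF P, of p k 0] polynomial_DERIV_axis[OF Q, of p k 0]]
    by (simp add: mult.commute)
qed

end

lemma pd_cmult:
  assumes "real_polynomial_function P"
  shows "pd k (\<lambda>p. c * P p) = (\<lambda>p. c * pd k P p)"
  by (subst pd_mult[OF polynomial_const assms]) simp

lemma laplacian_eq_pd:
  assumes "real_polynomial_function P"
  shows "laplacian P p = pd 1 (pd 1 P) p + pd 2 (pd 2 P) p + pd 3 (pd 3 P) p"
proof -
  have "(deriv ^^ 2) (\<lambda>t. P (p + t *\<^sub>R axis i 1)) 0 = pd i (pd i P) p" for i
  proof -
    have "deriv (\<lambda>t. P (p + t *\<^sub>R axis i 1)) = (\<lambda>t. pd i P (p + t *\<^sub>R axis i 1))"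
      using polynomial_DERIV_axis[OF assms] by (intro ext DERIV_imp_deriv)
    then show ?thesis by (simp add: numeral_2_eq_2 pd_def)
  qed
  then show ?thesis by (simp add: laplacian_def sum_3)
qed

section \<open>Forms\<close>

text \<open>
  Homogeneous polynomials are generated from constants by multiplication with linear forms and by
  sums.  Degrees are integers, with only the zero form in negative degree, so that a derivative
  or a quotient by \<open>p \<bullet> p\<close> lowers the degree without any case distinction.
\<close>
inductive form :: "int \<Rightarrow> (real^3 \<Rightarrow> real) \<Rightarrow> bool" where
  const: "form 0 (\<lambda>_. c)"
| zero: "form d (\<lambda>_. 0)"
| linear: "form d P \<Longrightarrow> form (d + 1) (\<lambda>p. (v \<bullet> p) * P p)"
| add: "form d P \<Longrightarrow> form d Q \<Longrightarrow> form d (\<lambda>p. P p + Q p)"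

lemma form_negative: "form d P \<Longrightarrow> d < 0 \<Longrightarrow> P = (\<lambda>_. 0)"
  by (induction rule: form.induct) auto

lemma form_degree_0: "form d P \<Longrightarrow> d = 0 \<Longrightarrow> \<exists>c. P = (\<lambda>_. c)"
proof (induction rule: form.induct)
  case (linear d P v)
  then have "P = (\<lambda>_. 0)" using form_negative by simp
  then show ?case by auto
qed auto

lemma form_cmult: "form d P \<Longrightarrow> form d (\<lambda>p. c * P p)"
proof (induction rule: form.induct)
  case (const c')
  show ?case by (rule form.const)
next
  case (zero d)
  show ?case using form.zero by simp
next
  case (linear d P v)
  from form.linear[OF linear.IH, of v] show ?case by (simp add: mult.left_commute)
next
  case (add d P Q)
  from form.add[OF add.IH] show ?case by (simp add: distrib_left)
qed

lemma form_uminus: "form d P \<Longrightarrow> form d (\<lambda>p. - P p)"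
  using form_cmult[of d P "-1"] by simp

lemma form_diff: "form d P \<Longrightarrow> form d Q \<Longrightarrow> form d (\<lambda>p. P p - Q p)"
  using form.add[OF _ form_uminus, of d P Q] by simp

lemma form_sum: "finite I \<Longrightarrow> (\<And>i. i \<in> I \<Longrightarrow> form d (P i)) \<Longrightarrow> form d (\<lambda>p. \<Sum>i\<in>I. P i p)"
  by (induction I rule: finite_induct) (auto intro: form.add form.zero)

lemma form_mult: "form d P \<Longrightarrow> form e Q \<Longrightarrow> form (d + e) (\<lambda>p. P p * Q p)"
proof (induction rule: form.induct)
  case (const c)
  then show ?case by (simp add: form_cmult)
next
  case (zero d)
  show ?case using form.zero by simp
next
  case (linear d P v)
  from form.linear[OF linear.IH, of v] linear.prems show ?case by (simp add: algebra_simps)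
next
  case (add d P Q')
  from form.add[OF add.IH] add.prems show ?case by (simp add: algebra_simps)
qed

lemma form_inner: "form 1 (\<lambda>p. v \<bullet> p)"
  using form.linear[OF form.const[of 1]] by simp

lemma form_coordinate: "form 1 (\<lambda>p. p $ k)"
  using form_inner[of "axis k 1"] by (simp add: inner_axis')

lemma form_norm_square: "form 2 (\<lambda>p. p \<bullet> p)"
proof -
  have "form (1 + 1) (\<lambda>p. \<Sum>k\<in>UNIV. p $ k * p $ k)"
    by (intro form_sum form_mult form_coordinate) auto
  then show ?thesis by (simp add: inner_vec_def)
qed

lemma form_linear_mult: "form (d - 1) P \<Longrightarrow> form d (\<lambda>p. (v \<bullet> p) * P p)"
  using form.linear[of "d - 1" P v] by simp

lemma form_polynomial: "form d P \<Longrightarrow> real_polynomial_function P"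
proof (induction rule: form.induct)
  case (linear d P v)
  have "real_polynomial_function (\<lambda>p. v \<bullet> p)"
    by (intro polynomial_linear bounded_linear_inner_right)
  with linear show ?case by (intro polynomial_mult) auto
qed auto

lemma form_scale: "form d P \<Longrightarrow> P (t *\<^sub>R p) = t ^ nat d * P p"
proof (induction rule: form.induct)
  case (linear d P v)
  show ?case
  proof (cases "d < 0")
    case True
    then have "P = (\<lambda>_. 0)" using form_negative[OF linear.hyps] by simp
    then show ?thesis by simp
  next
    case False
    then have "nat (d + 1) = Suc (nat d)" by simp
    then show ?thesis using linear.IH by simp
  qed
qed (auto simp: distrib_left)

lemma form_linear_product: "form (int k) (linear_product k v)"
proof (induction k)
  case 0
  show ?case unfolding linear_product_def using form.const[of 1] by simp
next
  case (Suc k)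
  have "linear_product (Suc k) v = (\<lambda>p. (v (Suc k) \<bullet> p) * linear_product k v p)"
    by (auto simp: linear_product_def fun_eq_iff)
  with form.linear[OF Suc, of "v (Suc k)"] show ?case by (simp add: add.commute)
qed

lemma form_pd:
  assumes "form d P"
  shows "form (d - 1) (pd k P)"
  using assms
proof (induction rule: form.induct)
  case (linear d P v)
  have 1: "real_polynomial_function (\<lambda>p. v \<bullet> p)" using form_polynomial[OF form_inner] .
  have 2: "real_polynomial_function P" using form_polynomial linear.hyps .
  have "form d (\<lambda>p. (v \<bullet> p) * pd k P p)" using form_linear_mult linear.IH .
  moreover have "form d (\<lambda>p. v $ k * P p)" using form_cmult linear.hyps .
  ultimately show ?case
    unfolding pd_mult[OF 1 2] pd_inner using form.add by simp
next
  case (add d P Q)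
  then show ?case by (simp add: pd_add form_polynomial form.add)
qed (auto intro: form.zero)

lemma Euler_identity:
  assumes "form d P"
  shows "p $ 1 * pd 1 P p + p $ 2 * pd 2 P p + p $ 3 * pd 3 P p = of_int d * P p"
  using assms
proof (induction rule: form.induct)
  case (linear d P v)
  have 1: "real_polynomial_function (\<lambda>p. v \<bullet> p)" using form_polynomial[OF form_inner] .
  have 2: "real_polynomial_function P" using form_polynomial linear.hyps .
  have "p $ 1 * pd 1 (\<lambda>p. v \<bullet> p * P p) p + p $ 2 * pd 2 (\<lambda>p. v \<bullet> p * P p) p
      + p $ 3 * pd 3 (\<lambda>p. v \<bullet> p * P p) p
      = (v $ 1 * p $ 1 + v $ 2 * p $ 2 + v $ 3 * p $ 3) * P p
        + (v \<bullet> p) * (p $ 1 * pd 1 P p + p $ 2 * pd 2 P p + p $ 3 * pd 3 P p)"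
    unfolding pd_mult[OF 1 2] pd_inner by (simp add: algebra_simps)
  also have "\<dots> = (v \<bullet> p) * P p + (v \<bullet> p) * (of_int d * P p)"
    by (simp only: linear.IH) (simp add: inner_vec_def sum_3)
  finally show ?case by (simp add: algebra_simps)
next
  case (add d P Q)
  have "real_polynomial_function P" "real_polynomial_function Q"
    using add.hyps by (auto intro: form_polynomial)
  with add.IH show ?case by (simp add: pd_add algebra_simps)
qed auto

lemma polynomial_sum_of_forms:
  assumes "real_polynomial_function (P :: real^3 \<Rightarrow> real)"
  shows "\<exists>n F. (\<forall>k. form (int k) (F k)) \<and> (\<forall>k>n. F k = (\<lambda>_. 0)) \<and> P = (\<lambda>p. \<Sum>k\<le>n. F k p)"
  using assms
proof (induction P rule: real_polynomial_function.induct)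
  case (linear f)
  let ?F = "\<lambda>k::nat. if k = 1 then f else (\<lambda>_. 0)"
  have "f = (\<lambda>p. (\<chi> k. f (axis k 1)) \<bullet> p)"
    by (subst bounded_linear_coordinates[OF linear], rule ext) (simp add: inner_vec_def mult.commute)
  then have "form 1 f"
    using form_inner by metis
  then have "form (int k) (?F k)" for k
    using form.zero by simp
  then show ?case
    by (intro exI[of _ "1::nat"] exI[of _ ?F]) (auto simp: fun_eq_iff)
next
  case (const c)
  let ?F = "\<lambda>k::nat. if k = 0 then (\<lambda>_. c) else (\<lambda>_. 0)"
  have "form (int k) (?F k)" for k by (auto intro: form.intros)
  then show ?case by (intro exI[of _ "0::nat"] exI[of _ ?F]) auto
next
  case (add f g)
  obtain m F where F: "\<forall>k. form (int k) (F k)" "\<forall>k>m. F k = (\<lambda>_. 0)" "f = (\<lambda>p. \<Sum>k\<le>m. F k p)"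
    using add.IH(1) by blast
  obtain n G where G: "\<forall>k. form (int k) (G k)" "\<forall>k>n. G k = (\<lambda>_. 0)" "g = (\<lambda>p. \<Sum>k\<le>n. G k p)"
    using add.IH(2) by blast
  have "(\<Sum>k\<le>m. F k p) = (\<Sum>k\<le>max m n. F k p)" for p
    using F(2) by (intro sum.mono_neutral_left) auto
  moreover have "(\<Sum>k\<le>n. G k p) = (\<Sum>k\<le>max m n. G k p)" for p
    using G(2) by (intro sum.mono_neutral_left) auto
  ultimately have "(\<lambda>p. f p + g p) = (\<lambda>p. \<Sum>k\<le>max m n. F k p + G k p)"
    by (simp add: F(3) G(3) sum.distrib)
  moreover have "\<forall>k. form (int k) (\<lambda>p. F k p + G k p)"
    using F(1) G(1) form.add by blast
  moreover have "\<forall>k>max m n. (\<lambda>p. F k p + G k p) = (\<lambda>_. 0)"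
    using F(2) G(2) by simp
  ultimately show ?case
    by (intro exI[of _ "max m n"] exI[of _ "\<lambda>k p. F k p + G k p"]) blast
next
  case (mult f g)
  obtain m F where F: "\<forall>k. form (int k) (F k)" "\<forall>k>m. F k = (\<lambda>_. 0)" "f = (\<lambda>p. \<Sum>k\<le>m. F k p)"
    using mult.IH(1) by blast
  obtain n G where G: "\<forall>k. form (int k) (G k)" "\<forall>k>n. G k = (\<lambda>_. 0)" "g = (\<lambda>p. \<Sum>k\<le>n. G k p)"
    using mult.IH(2) by blast
  let ?H = "\<lambda>k p. \<Sum>i\<le>k. F i p * G (k - i) p"
  have H: "form (int k) (?H k)" for k
  proof (intro form_sum)
    fix i assume "i \<in> {..k}"
    then show "form (int k) (\<lambda>p. F i p * G (k - i) p)"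
      using form_mult[OF F(1)[rule_format, of i] G(1)[rule_format, of "k - i"]] by simp
  qed simp
  have H0: "?H k = (\<lambda>_. 0)" if "k > m + n" for k
  proof
    fix p
    have "F i p * G (k - i) p = 0" if "i \<le> k" for i
      using F(2)[rule_format, of i] G(2)[rule_format, of "k - i"] \<open>k > m + n\<close> that by (cases "i > m") auto
    then show "?H k p = 0" by (intro sum.neutral) auto
  qed
  have "(\<lambda>p. f p * g p) = (\<lambda>p. \<Sum>k\<le>m+n. ?H k p)"
  proof
    fix p
    have "(\<Sum>k\<le>m+n. ?H k p) = (\<Sum>(k,i)\<in>(SIGMA k:{..m+n}. {..k}). F i p * G (k - i) p)"
      by (subst sum.Sigma) auto
    also have "\<dots> = (\<Sum>(i,j)\<in>{(i,j). i + j \<le> m + n}. F i p * G j p)"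
      by (rule sum.reindex_bij_witness[of _ "\<lambda>(i,j). (i+j,i)" "\<lambda>(k,i). (i,k-i)"]) auto
    also have "\<dots> = (\<Sum>(i,j)\<in>{..m}\<times>{..n}. F i p * G j p)"
    proof (rule sum.mono_neutral_right)
      show "finite {(i,j). i + j \<le> m + n}"
        by (rule finite_subset[of _ "{..m+n}\<times>{..m+n}"]) auto
      show "\<forall>x\<in>{(i, j). i + j \<le> m + n} - {..m} \<times> {..n}. (case x of (i, j) \<Rightarrow> F i p * G j p) = 0"
        using F(2)[rule_format, THEN fun_cong] G(2)[rule_format, THEN fun_cong] by (fastforce simp: not_le)
    qed auto
    also have "\<dots> = f p * g p"
      by (simp add: F(3) G(3) sum_product sum.cartesian_product)
    finally show "f p * g p = (\<Sum>k\<le>m+n. ?H k p)" by simp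
  qed
  then show ?case
    using H H0 by (intro exI[of _ "m+n"] exI[of _ ?H]) blast
qed

lemma homogeneous_polynomial_form:
  assumes P: "real_polynomial_function (P :: real^3 \<Rightarrow> real)" and hom: "\<And>t p. P (t *\<^sub>R p) = t ^ d * P p"
  shows "form (int d) P"
proof -
  obtain n F where F: "\<forall>k. form (int k) (F k)" "\<forall>k>n. F k = (\<lambda>_. 0)" "P = (\<lambda>p. \<Sum>k\<le>n. F k p)"
    using polynomial_sum_of_forms[OF P] by blast
  have "P p = F d p" for p
  proof -
    let ?m = "max n d"
    have "(\<Sum>k\<le>?m. F k p * t ^ k) = (\<Sum>k\<le>?m. (if k = d then P p else 0) * t ^ k)" for t :: real
    proof -
      have "(\<Sum>k\<le>?m. F k p * t ^ k) = (\<Sum>k\<le>n. F k p * t ^ k)"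
        using F(2) by (intro sum.mono_neutral_right) auto
      also have "\<dots> = P (t *\<^sub>R p)"
        unfolding F(3) using form_scale[OF F(1)[rule_format]] by (intro sum.cong) (auto simp: mult.commute)
      also have "\<dots> = (\<Sum>k\<le>?m. (if k = d then P p else 0) * t ^ k)"
        by (simp add: hom if_distribR if_distrib[of "\<lambda>x. x * _"] mult.commute[of _ "P p"] sum.delta cong: if_cong)
      finally show ?thesis .
    qed
    then have "\<forall>k\<le>?m. F k p = (if k = d then P p else 0)"
      using polyfun_eq_coeffs[of "\<lambda>k. F k p" ?m "\<lambda>k. if k = d then P p else 0"] by blast
    then show ?thesis by simp
  qed
  then have "P = F d" by auto
  then show ?thesis using F(1) by simp
qed

section \<open>Decomposition of forms into harmonic forms\<close>

definition harmonic_form :: "int \<Rightarrow> (real^3 \<Rightarrow> real) \<Rightarrow> bool"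
  where "harmonic_form d P \<longleftrightarrow> form d P \<and> (\<forall>p. laplacian P p = 0)"

lemma laplacian_add:
  assumes "real_polynomial_function P" "real_polynomial_function Q"
  shows "laplacian (\<lambda>p. P p + Q p) p = laplacian P p + laplacian Q p"
  using assms by (simp add: laplacian_eq_pd pd_add polynomial_add polynomial_pd)

lemma laplacian_diff:
  assumes "real_polynomial_function P" "real_polynomial_function Q"
  shows "laplacian (\<lambda>p. P p - Q p) p = laplacian P p - laplacian Q p"
  using assms by (simp add: laplacian_eq_pd pd_diff real_polynomial_function_diff polynomial_pd)

lemma laplacian_cmult:
  assumes "real_polynomial_function P"
  shows "laplacian (\<lambda>p. c * P p) p = c * laplacian P p"
proof -
  have "real_polynomial_function (\<lambda>p. c * P p)"
    using assms by (intro polynomial_const polynomial_mult)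
  then show ?thesis
    using assms by (simp add: laplacian_eq_pd pd_cmult polynomial_pd algebra_simps)
qed

lemma form_laplacian:
  assumes "form d P"
  shows "form (d - 2) (laplacian P)"
proof -
  have "laplacian P = (\<lambda>p. pd 1 (pd 1 P) p + pd 2 (pd 2 P) p + pd 3 (pd 3 P) p)"
    using laplacian_eq_pd[OF form_polynomial[OF assms]] by blast
  moreover have "form (d - 2) (pd k (pd k P))" for k
    using form_pd[OF form_pd[OF assms]] by simp
  ultimately show ?thesis
    by (simp add: form.add)
qed

lemma harmonic_form_of_small_degree:
  assumes "form d P" "d < 2"
  shows "harmonic_form d P"
  using assms form_negative[OF form_laplacian[OF assms(1)]] by (simp add: harmonic_form_def)

lemma pd_norm_square_mult:
  assumes "real_polynomial_function P"
  shows "pd k (\<lambda>p. (p \<bullet> p) * P p) = (\<lambda>p. 2 * (p $ k * P p) + (p \<bullet> p) * pd k P p)"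
proof -
  have *: "real_polynomial_function (\<lambda>p :: real^3. p \<bullet> p)"
    using form_polynomial[OF form_norm_square] .
  have "pd k (\<lambda>p. p \<bullet> p) = (\<lambda>p. 2 * p $ k)"
    by (intro ext pd_eqI)
      (auto intro!: derivative_eq_intros simp: inner_axis inner_axis' algebra_simps inner_add_right inner_add_left)
  then show ?thesis
    by (simp add: pd_mult[OF * assms] fun_eq_iff)
qed

lemma laplacian_norm_square_mult:
  assumes "form d P"
  shows "laplacian (\<lambda>p. (p \<bullet> p) * P p) p = (p \<bullet> p) * laplacian P p + (4 * of_int d + 6) * P p"
proof -
  note P = form_polynomial[OF assms]
  have x: "real_polynomial_function (\<lambda>p. p $ k * P p)" for k
    by (intro polynomial_mult real_polynomial_function_coordinate P)
  then have x2: "real_polynomial_function (\<lambda>p. 2 * (p $ k * P p))" for k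
    by (rule polynomial_mult[OF polynomial_const])
  have y: "real_polynomial_function (\<lambda>p. (p \<bullet> p) * P p)"
    using P form_polynomial[OF form_norm_square] by (intro polynomial_mult)
  have z: "real_polynomial_function (\<lambda>p. (p \<bullet> p) * pd k P p)" for k
    using polynomial_pd[OF P] form_polynomial[OF form_norm_square] by (intro polynomial_mult)
  have *: "pd k (pd k (\<lambda>p. (p \<bullet> p) * P p)) p
      = 2 * P p + 4 * (p $ k * pd k P p) + (p \<bullet> p) * pd k (pd k P) p" for k
    unfolding pd_norm_square_mult[OF P] pd_add[OF x2 z] pd_cmult[OF x]
      pd_mult[OF real_polynomial_function_coordinate P] pd_norm_square_mult[OF polynomial_pd[OF P]] pd_coordinate
    by simp
  show ?thesis
    unfolding laplacian_eq_pd[OF y] laplacian_eq_pd[OF P] *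
    using Euler_identity[OF assms, of p] by (simp add: algebra_simps)
qed

text \<open>
  The Laplacian of \<open>\<bar>p\<bar>\<^sup>2\<^sup>j h\<close> is a positive multiple of \<open>\<bar>p\<bar>\<^sup>2\<^sup>j\<^sup>-\<^sup>2 h\<close> when \<open>h\<close> is harmonic.  So on forms that are
  sums of such terms the map \<open>R \<mapsto> \<Delta> (\<bar>p\<bar>\<^sup>2 R)\<close> acts diagonally, and it can be inverted.
\<close>
lemma laplacian_norm_power_mult_harmonic:
  assumes "harmonic_form (int e) h"
  shows "\<exists>c>0. \<forall>p. laplacian (\<lambda>p. (p \<bullet> p) ^ Suc j * h p) p = c * ((p \<bullet> p) ^ j * h p)"
    and "form (int (e + 2 * j)) (\<lambda>p. (p \<bullet> p) ^ j * h p)"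
proof -
  have form: "form (int (e + 2 * j)) (\<lambda>p. (p \<bullet> p) ^ j * h p)" for j
  proof (induction j)
    case 0
    then show ?case using assms by (simp add: harmonic_form_def)
  next
    case (Suc j)
    from form_mult[OF form_norm_square Suc] show ?case by (simp add: algebra_simps)
  qed
  then show "form (int (e + 2 * j)) (\<lambda>p. (p \<bullet> p) ^ j * h p)" .
  show "\<exists>c>0. \<forall>p. laplacian (\<lambda>p. (p \<bullet> p) ^ Suc j * h p) p = c * ((p \<bullet> p) ^ j * h p)"
  proof (induction j)
    case 0
    have "laplacian (\<lambda>p. (p \<bullet> p) * h p) p = (4 * real e + 6) * h p" for p
      using laplacian_norm_square_mult[of "int e" h p] assms by (simp add: harmonic_form_def)
    then show ?case by (intro exI[of _ "4 * real e + 6"]) auto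
  next
    case (Suc j)
    then obtain c where c: "c > 0"
      "\<And>p. laplacian (\<lambda>p. (p \<bullet> p) ^ Suc j * h p) p = c * ((p \<bullet> p) ^ j * h p)" by blast
    have "laplacian (\<lambda>p. (p \<bullet> p) ^ Suc (Suc j) * h p) p
        = (c + (4 * real (e + 2 * Suc j) + 6)) * ((p \<bullet> p) ^ Suc j * h p)" for p
      using laplacian_norm_square_mult[OF form[of "Suc j"], of p] c(2)[of p]
      by (simp add: algebra_simps)
    then show ?case using c(1) by (intro exI[of _ "c + (4 * real (e + 2 * Suc j) + 6)"]) auto
  qed
qed

inductive harmonic_sum :: "int \<Rightarrow> (real^3 \<Rightarrow> real) \<Rightarrow> bool" where
  single: "harmonic_form (int e) h \<Longrightarrow> harmonic_sum (int (e + 2 * j)) (\<lambda>p. (p \<bullet> p) ^ j * h p)"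
| zero: "harmonic_sum d (\<lambda>_. 0)"
| add: "harmonic_sum d P \<Longrightarrow> harmonic_sum d Q \<Longrightarrow> harmonic_sum d (\<lambda>p. P p + Q p)"

lemma harmonic_sum_form: "harmonic_sum d P \<Longrightarrow> form d P"
  by (induction rule: harmonic_sum.induct)
    (use laplacian_norm_power_mult_harmonic(2) form.zero form.add in \<open>auto simp del: of_nat_add\<close>)

lemma harmonic_sum_cmult: "harmonic_sum d P \<Longrightarrow> harmonic_sum d (\<lambda>p. c * P p)"
proof (induction rule: harmonic_sum.induct)
  case (single e h j)
  then have "real_polynomial_function h"
    using form_polynomial by (auto simp: harmonic_form_def)
  with single have "harmonic_form (int e) (\<lambda>p. c * h p)"
    by (simp add: harmonic_form_def form_cmult laplacian_cmult)
  from harmonic_sum.single[OF this, of j] show ?case by (simp add: mult.left_commute)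
next
  case (add d P Q)
  from harmonic_sum.add[OF add.IH] show ?case by (simp add: distrib_left)
qed (simp add: harmonic_sum.zero)

lemma harmonic_sum_norm_square_mult:
  "harmonic_sum d P \<Longrightarrow> harmonic_sum (d + 2) (\<lambda>p. (p \<bullet> p) * P p)"
proof (induction rule: harmonic_sum.induct)
  case (single e h j)
  from harmonic_sum.single[OF this, of "Suc j"] show ?case by (simp add: algebra_simps)
next
  case (add d P Q)
  from harmonic_sum.add[OF add.IH] show ?case by (simp add: distrib_left)
qed (simp add: harmonic_sum.zero)

lemma laplacian_norm_square_surjective:
  "harmonic_sum d G \<Longrightarrow> \<exists>R. harmonic_sum d R \<and> (\<forall>p. laplacian (\<lambda>p. (p \<bullet> p) * R p) p = G p)"
proof (induction rule: harmonic_sum.induct)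
  case (single e h j)
  let ?G = "\<lambda>p. (p \<bullet> p) ^ j * h p"
  obtain c where c: "c > 0" "\<And>p. laplacian (\<lambda>p. (p \<bullet> p) ^ Suc j * h p) p = c * ?G p"
    using laplacian_norm_power_mult_harmonic(1)[OF single, of j] by blast
  have "real_polynomial_function (\<lambda>p. (p \<bullet> p) ^ Suc j * h p)"
    using form_polynomial[OF laplacian_norm_power_mult_harmonic(2)[OF single]] .
  from laplacian_cmult[OF this, of "1 / c"] c
  have "laplacian (\<lambda>p. (p \<bullet> p) * ((1 / c) * ?G p)) p = ?G p" for p
    by (simp add: algebra_simps)
  moreover have "harmonic_sum (int (e + 2 * j)) (\<lambda>p. (1 / c) * ?G p)"
    using harmonic_sum_cmult[OF harmonic_sum.single[OF single]] .
  ultimately show ?case by blast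
next
  case (zero d)
  show ?case
    by (intro exI[of _ "\<lambda>_. 0"]) (use harmonic_sum.zero laplacian_eq_pd[OF polynomial_const, of 0] in simp)
next
  case (add d P Q)
  then obtain R S where R: "harmonic_sum d R" "\<And>p. laplacian (\<lambda>p. (p \<bullet> p) * R p) p = P p"
    and S: "harmonic_sum d S" "\<And>p. laplacian (\<lambda>p. (p \<bullet> p) * S p) p = Q p" by blast
  have "real_polynomial_function (\<lambda>p. (p \<bullet> p) * T p)" if "harmonic_sum d T" for T
    using form_polynomial[OF harmonic_sum_form[OF harmonic_sum_norm_square_mult[OF that]]] .
  from laplacian_add[OF this[OF R(1)] this[OF S(1)]] R(2) S(2)
  have "laplacian (\<lambda>p. (p \<bullet> p) * (R p + S p)) p = P p + Q p" for p
    by (simp add: distrib_left)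
  with harmonic_sum.add[OF R(1) S(1)] show ?case by blast
qed

text \<open>
  A form \<open>P\<close> becomes harmonic after subtracting \<open>\<bar>p\<bar>\<^sup>2 R\<close>, where \<open>R\<close> solves \<open>\<Delta> (\<bar>p\<bar>\<^sup>2 R) = \<Delta> P\<close>.
  A solution exists because \<open>\<Delta> P\<close> has lower degree and so is already known to be a sum of harmonic terms.
\<close>
lemma form_harmonic_decomposition_aux:
  "form (int n) P \<Longrightarrow> harmonic_sum (int n) P \<and>
    (\<exists>h R. harmonic_form (int n) h \<and> form (int n - 2) R \<and> P = (\<lambda>p. h p + (p \<bullet> p) * R p))"
proof (induction n arbitrary: P rule: less_induct)
  case (less n)
  show ?case
  proof (cases "n < 2")
    case True
    then have "harmonic_form (int n) P"
      using less.prems by (intro harmonic_form_of_small_degree) auto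
    with harmonic_sum.single[OF this, of 0] form.zero[of "int n - 2"] show ?thesis
      by (intro conjI exI[of _ P] exI[of _ "\<lambda>_. 0"]) auto
  next
    case False
    have "harmonic_sum (int (n - 2)) (laplacian P)"
      using less.IH[of "n - 2"] form_laplacian[OF less.prems] False by (simp add: of_nat_diff)
    then obtain R where R: "harmonic_sum (int (n - 2)) R" "\<And>p. laplacian (\<lambda>p. (p \<bullet> p) * R p) p = laplacian P p"
      using laplacian_norm_square_surjective by blast
    let ?h = "\<lambda>p. P p - (p \<bullet> p) * R p"
    have nR: "harmonic_sum (int n) (\<lambda>p. (p \<bullet> p) * R p)"
      using harmonic_sum_norm_square_mult[OF R(1)] False by (simp add: of_nat_diff)
    have "form (int n) ?h"
      using form_diff[OF less.prems harmonic_sum_form[OF nR]] .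
    moreover have "laplacian ?h p = 0" for p
      using laplacian_diff[OF form_polynomial[OF less.prems] form_polynomial[OF harmonic_sum_form[OF nR]]] R(2)
      by simp
    ultimately have h: "harmonic_form (int n) ?h" by (simp add: harmonic_form_def)
    have "harmonic_sum (int n) ?h" using harmonic_sum.single[OF h, of 0] by simp
    from harmonic_sum.add[OF this nR] have "harmonic_sum (int n) P" by simp
    moreover have "form (int n - 2) R"
      using harmonic_sum_form[OF R(1)] False by (simp add: of_nat_diff)
    ultimately show ?thesis
      using h by (intro conjI exI[of _ ?h] exI[of _ R]) auto
  qed
qed

lemmas form_harmonic_decomposition = form_harmonic_decomposition_aux[THEN conjunct2]

unbundle cross3_syntax

section \<open>Complexified forms\<close>

definition cdot :: "real^3 \<Rightarrow> complex^3 \<Rightarrow> complex"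
  where "cdot v z = (\<Sum>k\<in>UNIV. of_real (v $ k) * z $ k)"

definition cpoint :: "real^3 \<Rightarrow> real^3 \<Rightarrow> complex^3"
  where "cpoint a b = (\<chi> k. Complex (a $ k) (b $ k))"

lemma cdot_cpoint: "cdot v (cpoint a b) = Complex (v \<bullet> a) (v \<bullet> b)"
  by (simp add: cdot_def cpoint_def inner_vec_def sum_3 complex_eq_iff)

lemma cpoint_cases: obtains a b where "z = cpoint a b"
proof
  show "z = cpoint (\<chi> k. Re (z $ k)) (\<chi> k. Im (z $ k))"
    by (simp add: cpoint_def vec_eq_iff)
qed

text \<open>
  A form together with its extension to complex points.  The extension is carried along the generation of
  the form, so that compatibility with sums and with linear factors holds by construction.
\<close>
inductive cform :: "int \<Rightarrow> (real^3 \<Rightarrow> real) \<Rightarrow> (complex^3 \<Rightarrow> complex) \<Rightarrow> bool" where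
  const: "cform 0 (\<lambda>_. c) (\<lambda>_. of_real c)"
| zero: "cform d (\<lambda>_. 0) (\<lambda>_. 0)"
| linear: "cform d P Pc \<Longrightarrow> cform (d + 1) (\<lambda>p. (v \<bullet> p) * P p) (\<lambda>z. cdot v z * Pc z)"
| add: "cform d P Pc \<Longrightarrow> cform d Q Qc \<Longrightarrow> cform d (\<lambda>p. P p + Q p) (\<lambda>z. Pc z + Qc z)"

lemma cform_form: "cform d P Pc \<Longrightarrow> form d P"
  by (induction rule: cform.induct) (auto intro: form.intros)

lemma form_complexification: "form d P \<Longrightarrow> \<exists>Pc. cform d P Pc"
  by (induction rule: form.induct) (blast intro: cform.intros)+

lemma cform_negative: "cform d P Pc \<Longrightarrow> d < 0 \<Longrightarrow> P = (\<lambda>_. 0) \<and> Pc = (\<lambda>_. 0)"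
  by (induction rule: cform.induct) auto

lemma cform_degree_0: "cform d P Pc \<Longrightarrow> d = 0 \<Longrightarrow> \<exists>c. P = (\<lambda>_. c) \<and> Pc = (\<lambda>_. of_real c)"
proof (induction rule: cform.induct)
  case (linear d P Pc v)
  then have "P = (\<lambda>_. 0) \<and> Pc = (\<lambda>_. 0)" using cform_negative by simp
  then show ?case by auto
next
  case (add d P Pc Q Qc)
  then obtain c c' where "P = (\<lambda>_. c)" "Pc = (\<lambda>_. of_real c)" "Q = (\<lambda>_. c')" "Qc = (\<lambda>_. of_real c')"
    by blast
  then show ?case by (intro exI[of _ "c + c'"]) simp
qed auto

lemma cform_scale:
  assumes "cform d P Pc"
  shows "Pc (s *s z) = s ^ nat d * Pc z"
  using assms
proof (induction rule: cform.induct)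
  case (linear d P Pc v)
  show ?case
  proof (cases "d < 0")
    case True
    then show ?thesis using cform_negative[OF linear.hyps] by simp
  next
    case False
    then have "nat (d + 1) = Suc (nat d)" by simp
    moreover have "cdot v (s *s z) = s * cdot v z"
      by (simp add: cdot_def sum_distrib_left algebra_simps)
    ultimately show ?thesis using linear.IH by simp
  qed
qed (auto simp: distrib_left)

lemma cform_real: "cform d P Pc \<Longrightarrow> Pc (cpoint p 0) = of_real (P p)"
  by (induction rule: cform.induct) (auto simp: cdot_cpoint Complex_eq)

lemma cform_along_polynomial_curve:
  assumes "cform d P Pc"
  shows "\<exists>q. \<forall>t. poly q t = Pc (\<chi> k. poly (u k) t)"
  using assms
proof (induction rule: cform.induct)
  case (const c)
  show ?case by (intro exI[of _ "[:of_real c:]"]) simp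
next
  case (zero d)
  show ?case by (intro exI[of _ 0]) simp
next
  case (linear d P Pc v)
  then obtain q where "\<And>t. poly q t = Pc (\<chi> k. poly (u k) t)" by blast
  then show ?case
    by (intro exI[of _ "(\<Sum>k\<in>UNIV. smult (of_real (v $ k)) (u k)) * q"]) (simp add: cdot_def poly_sum)
next
  case (add d P Pc Q Qc)
  then obtain q r where "\<And>t. poly q t = Pc (\<chi> k. poly (u k) t)" "\<And>t. poly r t = Qc (\<chi> k. poly (u k) t)"
    by blast
  then show ?case by (intro exI[of _ "q + r"]) simp
qed

text \<open>On the complex line through \<open>a\<close> and \<open>a + b\<close> the extension is a polynomial that vanishes at all real parameters.\<close>
lemma cform_zero:
  assumes "cform d (\<lambda>_. 0) Pc"
  shows "Pc z = 0"
proof -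
  obtain a b where z: "z = cpoint a b" by (rule cpoint_cases)
  obtain q where q: "\<And>t. poly q t = Pc (\<chi> k. poly [:of_real (a $ k), of_real (b $ k):] t)"
    using cform_along_polynomial_curve[OF assms, of "\<lambda>k. [:of_real (a $ k), of_real (b $ k):]"] by blast
  have "poly q (of_real x) = 0" for x
  proof -
    have "(\<chi> k. poly [:of_real (a $ k), of_real (b $ k):] (of_real x)) = cpoint (a + x *\<^sub>R b) 0"
      by (simp add: cpoint_def vec_eq_iff complex_eq_iff)
    then show ?thesis using cform_real[OF assms] by (simp only: q) simp
  qed
  then have "range complex_of_real \<subseteq> {x. poly q x = 0}" by auto
  moreover have "infinite (range complex_of_real)"
    by (subst finite_image_iff) (auto simp: inj_on_def infinite_UNIV_char_0)
  ultimately have "q = 0"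
    using poly_roots_finite[of q] finite_subset by blast
  then have "Pc (\<chi> k. poly [:of_real (a $ k), of_real (b $ k):] \<i>) = 0"
    using q[of \<i>] by simp
  moreover have "(\<chi> k. poly [:of_real (a $ k), of_real (b $ k):] \<i>) = z"
    by (simp add: z cpoint_def vec_eq_iff complex_eq_iff)
  ultimately show ?thesis by simp
qed

lemma cform_cmult:
  assumes "cform d P Pc"
  shows "cform d (\<lambda>p. c * P p) (\<lambda>z. of_real c * Pc z)"
  using assms
proof (induction rule: cform.induct)
  case (const c')
  from cform.const[of "c * c'"] show ?case by simp
next
  case (zero d)
  show ?case using cform.zero by simp
next
  case (linear d P Pc v)
  from cform.linear[OF linear.IH, of v] show ?case by (simp add: mult.left_commute)
next
  case (add d P Pc Q Qc)
  from cform.add[OF add.IH] show ?case by (simp add: distrib_left)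
qed

lemma cform_sum:
  "finite I \<Longrightarrow> (\<And>i. i \<in> I \<Longrightarrow> cform d (P i) (Pc i)) \<Longrightarrow>
    cform d (\<lambda>p. \<Sum>i\<in>I. P i p) (\<lambda>z. \<Sum>i\<in>I. Pc i z)"
  by (induction I rule: finite_induct) (auto intro: cform.add cform.zero)

lemma cform_norm_square_mult:
  assumes "cform d P Pc"
  shows "cform (d + 2) (\<lambda>p. (p \<bullet> p) * P p) (\<lambda>z. (\<Sum>k\<in>UNIV. (z $ k)\<^sup>2) * Pc z)"
proof -
  have "cform (d + 1 + 1) (\<lambda>p. \<Sum>k\<in>UNIV. (axis k 1 \<bullet> p) * ((axis k 1 \<bullet> p) * P p))
      (\<lambda>z. \<Sum>k\<in>UNIV. cdot (axis k 1) z * (cdot (axis k 1) z * Pc z))"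
    by (intro cform_sum cform.linear assms) auto
  moreover have "cdot (axis k 1) z = z $ k" for k z
    by (simp add: cdot_def axis_def if_distrib[of of_real] if_distribR if_distrib[of "\<lambda>x. x * _"] cong: if_cong)
  moreover have "p \<bullet> p = (\<Sum>k\<in>UNIV. p $ k * p $ k)" for p :: "real^3"
    by (simp add: inner_vec_def)
  ultimately show ?thesis
    by (simp add: inner_axis' sum_distrib_right power2_eq_square mult.assoc add.commute)
qed

lemma cform_norm_power_mult:
  assumes "cform d P Pc"
  shows "cform (d + 2 * int m) (\<lambda>p. (p \<bullet> p) ^ m * P p) (\<lambda>z. (\<Sum>k\<in>UNIV. (z $ k)\<^sup>2) ^ m * Pc z)"
proof (induction m)
  case (Suc m)
  from cform_norm_square_mult[OF Suc] show ?case by (simp add: algebra_simps)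
qed (use assms in simp)

lemma cform_linear_product:
  "cform (int k) (linear_product k v) (\<lambda>z. \<Prod>j=1..k. cdot (v j) z)"
proof (induction k)
  case 0
  show ?case unfolding linear_product_def using cform.const[of 1] by simp
next
  case (Suc k)
  have "linear_product (Suc k) v = (\<lambda>p. (v (Suc k) \<bullet> p) * linear_product k v p)"
    by (auto simp: linear_product_def fun_eq_iff)
  with cform.linear[OF Suc, of "v (Suc k)"] show ?case by (simp add: add.commute mult.commute)
qed

section \<open>Linear factors of forms modulo the quadric\<close>

lemma orthonormal_frame:
  assumes "a \<bullet> a = 1" "b \<bullet> b = 1" "a \<bullet> b = 0"
  shows "u \<bullet> p = (u \<bullet> a) * (p \<bullet> a) + (u \<bullet> b) * (p \<bullet> b) + (u \<bullet> (a \<times> b)) * (p \<bullet> (a \<times> b))"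
proof -
  let ?A = "vector [a, b, a \<times> b] :: real^3^3"
  have n: "(a \<times> b) \<bullet> (a \<times> b) = 1"
    using assms by (simp add: dot_cross)
  have "orthogonal_matrix ?A"
    unfolding orthogonal_matrix_orthonormal_rows
  proof (intro conjI allI impI)
    fix i :: 3
    show "norm (row i ?A) = 1"
      using exhaust_3[of i] assms n by (auto simp: row_def norm_eq_sqrt_inner)
  next
    fix i j :: 3
    assume "i \<noteq> j"
    then show "orthogonal (row i ?A) (row j ?A)"
      using exhaust_3[of i] exhaust_3[of j] assms
      by (auto simp: row_def orthogonal_def dot_cross_self inner_commute)
  qed
  then have "orthogonal_transformation ((*v) ?A)"
    by (simp add: orthogonal_transformation_matrix)
  then have "u \<bullet> p = (?A *v u) \<bullet> (?A *v p)"
    by (simp add: orthogonal_transformation_def)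
  also have "\<dots> = (u \<bullet> a) * (p \<bullet> a) + (u \<bullet> b) * (p \<bullet> b) + (u \<bullet> (a \<times> b)) * (p \<bullet> (a \<times> b))"
  proof -
    have "(?A *v x) $ 1 = x \<bullet> a" "(?A *v x) $ 2 = x \<bullet> b" "(?A *v x) $ 3 = x \<bullet> (a \<times> b)" for x
      by (simp_all add: matrix_vector_mul_component inner_commute)
    then show ?thesis
      by (simp add: inner_vec_def[of "?A *v u" "?A *v p"] sum_3)
  qed
  finally show ?thesis .
qed

definition null_curve :: "complex \<Rightarrow> complex^3"
  where "null_curve t = vector [1 - t\<^sup>2, \<i> * (1 + t\<^sup>2), 2 * t]"

text \<open>
  The curve \<open>(1 - t\<^sup>2, i (1 + t\<^sup>2), 2 t)\<close> together with its reflection in \<open>t = \<infinity>\<close> parametrizes the null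
  directions of the quadric.  A form of positive degree restricts to a polynomial in \<open>t\<close>, which has a zero
  unless it is constant; the scaling under \<open>t \<mapsto> 1 / t\<close> shows that it cannot be a nonzero constant in
  both charts.
\<close>
lemma cform_null_zero_exists:
  assumes P: "cform d P Pc" and d: "d \<ge> 1"
  shows "\<exists>z. z \<noteq> 0 \<and> (\<Sum>k\<in>UNIV. (z $ k)\<^sup>2) = 0 \<and> Pc z = 0"
proof -
  define N where "N = (\<lambda>s. vector [s\<^sup>2 - 1, \<i> * (1 + s\<^sup>2), 2 * s] :: complex^3)"
  obtain q where q: "\<And>t. poly q t = Pc (null_curve t)"
  proof -
    have "null_curve t = (\<chi> k. poly (vector [[:1, 0, -1:], [:\<i>, 0, \<i>:], [:0, 2:]] $ k) t)" for t
      by (simp add: null_curve_def vec_eq_iff forall_3 power2_eq_square algebra_simps)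
    then show ?thesis using cform_along_polynomial_curve[OF P] that by metis
  qed
  obtain r where r: "\<And>t. poly r t = Pc (N t)"
  proof -
    have "N t = (\<chi> k. poly (vector [[:-1, 0, 1:], [:\<i>, 0, \<i>:], [:0, 2:]] $ k) t)" for t
      by (simp add: N_def vec_eq_iff forall_3 power2_eq_square algebra_simps)
    then show ?thesis using cform_along_polynomial_curve[OF P] that by metis
  qed
  have null: "(\<Sum>k\<in>UNIV. (null_curve t $ k)\<^sup>2) = 0" "(\<Sum>k\<in>UNIV. (N t $ k)\<^sup>2) = 0"
    and nonzero: "null_curve t \<noteq> 0" "N t \<noteq> 0" for t
  proof -
    show "(\<Sum>k\<in>UNIV. (null_curve t $ k)\<^sup>2) = 0" "(\<Sum>k\<in>UNIV. (N t $ k)\<^sup>2) = 0"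
      by (simp_all add: null_curve_def N_def sum_3 power_mult_distrib) (simp_all add: power2_eq_square algebra_simps)
    show "null_curve t \<noteq> 0" "N t \<noteq> 0"
      by (auto simp: null_curve_def N_def vec_eq_iff forall_3)
  qed
  have "\<exists>t. poly q t = 0 \<or> poly r t = 0"
  proof (rule ccontr)
    assume *: "\<not> ?thesis"
    then have "constant (poly q)" "constant (poly r)"
      using Fundamental_Theorem_Algebra.fundamental_theorem_of_algebra by blast+
    then have "poly q (1/2) = poly q 1" "poly r 2 = poly r 1"
      by (simp_all add: constant_def)
    \<comment> \<open>Comparing the two charts at \<open>t = 1\<close> and \<open>t = 1/2\<close>, where the scaling factors are \<open>1\<close> and \<open>4\<close>.\<close>
    moreover have "N 1 = null_curve 1" "N 2 = 4 *s null_curve (1/2)"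
      by (simp_all add: N_def null_curve_def vec_eq_iff forall_3 power2_eq_square)
    ultimately have "4 ^ nat d * poly q 1 = poly q 1"
      using cform_scale[OF P, of 4 "null_curve (1/2)"] by (simp add: q r)
    then have "(4::complex) ^ nat d = 1"
      using * by simp
    then have "(4::real) ^ nat d = 1"
      by (metis norm_numeral norm_one norm_power)
    then show False using d one_less_power[of "4::real" "nat d"] by simp
  qed
  then show ?thesis using q r null nonzero by metis
qed

lemma null_vector_normalization:
  assumes z: "z \<noteq> 0" "(\<Sum>k\<in>UNIV. (z $ k)\<^sup>2) = 0"
  obtains s a b where "a \<bullet> a = 1" "b \<bullet> b = 1" "a \<bullet> b = 0" "cpoint a b = of_real s *s z"
proof -
  obtain a b where ab: "z = cpoint a b" by (rule cpoint_cases)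
  have "a \<bullet> a = b \<bullet> b" "a \<bullet> b = 0"
    using z(2) by (auto simp: ab cpoint_def complex_eq_iff inner_vec_def sum_3 power2_eq_square algebra_simps)
  have "a \<noteq> 0"
  proof
    assume "a = 0"
    with \<open>a \<bullet> a = b \<bullet> b\<close> have "b = 0" by simp
    with \<open>a = 0\<close> z(1) show False by (simp add: ab cpoint_def vec_eq_iff complex_eq_iff)
  qed
  define s where "s = 1 / norm a"
  have "s * (s * (a \<bullet> a)) = 1"
    using \<open>a \<noteq> 0\<close> by (simp add: s_def dot_square_norm power2_eq_square)
  with \<open>a \<bullet> a = b \<bullet> b\<close> \<open>a \<bullet> b = 0\<close>
  have "(s *\<^sub>R a) \<bullet> (s *\<^sub>R a) = 1" "(s *\<^sub>R b) \<bullet> (s *\<^sub>R b) = 1" "(s *\<^sub>R a) \<bullet> (s *\<^sub>R b) = 0"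
    by simp_all
  moreover have "cpoint (s *\<^sub>R a) (s *\<^sub>R b) = of_real s *s z"
    by (simp add: ab cpoint_def vec_eq_iff complex_eq_iff)
  ultimately show ?thesis using that by blast
qed

lemma form_Re_power: "form (int m) (\<lambda>p. Re (w * Complex (a \<bullet> p) (b \<bullet> p) ^ m))"
proof (induction m arbitrary: w)
  case 0
  show ?case using form.const by simp
next
  case (Suc m)
  have "form (int m + 1) (\<lambda>p. (a \<bullet> p) * Re (w * Complex (a \<bullet> p) (b \<bullet> p) ^ m)
      + (b \<bullet> p) * Re ((\<i> * w) * Complex (a \<bullet> p) (b \<bullet> p) ^ m))"
    by (intro form.add form.linear Suc)
  moreover have "Re (w * Complex x y ^ Suc m)
      = x * Re (w * Complex x y ^ m) + y * Re ((\<i> * w) * Complex x y ^ m)" for x y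
    by (simp add: algebra_simps)
  ultimately show ?case by (simp only: of_nat_Suc add.commute)
qed

text \<open>
  In the coordinates of an orthonormal frame \<open>(a, b, n)\<close>, setting \<open>n \<bullet> p = 0\<close> turns a form into a
  binary form, and modulo \<open>\<bar>p\<bar>\<^sup>2\<close> only its two harmonic components remain.  Their coefficients are given by the value
  of the form at the null point \<open>a + i b\<close>.  The powers of \<open>1/2\<close> come from \<open>2 Re x Re y = Re (x y) + Re (cnj x y)\<close>:
  from the second linear factor on, each factor contributes one.
\<close>
lemma cform_modulo_frame:
  assumes "cform d P Pc"
    and frame: "\<And>u p. u \<bullet> p = (u \<bullet> a) * (p \<bullet> a) + (u \<bullet> b) * (p \<bullet> b) + (u \<bullet> n) * (p \<bullet> n)"
  shows "\<exists>P1 P2. form (d - 1) P1 \<and> form (d - 2) P2 \<and>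
    (\<forall>p. P p = (n \<bullet> p) * P1 p + (p \<bullet> p) * P2 p
      + Re ((1/2) ^ (nat d - 1) * cnj (Pc (cpoint a b)) * Complex (a \<bullet> p) (b \<bullet> p) ^ nat d))"
  using assms(1)
proof (induction rule: cform.induct)
  case (const c)
  show ?case by (intro exI[of _ "\<lambda>_. 0"]) (auto intro: form.zero)
next
  case (zero d)
  show ?case by (intro exI[of _ "\<lambda>_. 0"]) (auto intro: form.zero)
next
  case (add d P Pc Q Qc)
  then obtain P1 P2 Q1 Q2 where "form (d - 1) P1" "form (d - 2) P2" "form (d - 1) Q1" "form (d - 2) Q2"
    and "\<And>p. P p = (n \<bullet> p) * P1 p + (p \<bullet> p) * P2 p
      + Re ((1/2) ^ (nat d - 1) * cnj (Pc (cpoint a b)) * Complex (a \<bullet> p) (b \<bullet> p) ^ nat d)"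
      "\<And>p. Q p = (n \<bullet> p) * Q1 p + (p \<bullet> p) * Q2 p
      + Re ((1/2) ^ (nat d - 1) * cnj (Qc (cpoint a b)) * Complex (a \<bullet> p) (b \<bullet> p) ^ nat d)" by blast
  then show ?case
    by (intro exI[of _ "\<lambda>p. P1 p + Q1 p"] exI[of _ "\<lambda>p. P2 p + Q2 p"])
      (simp add: form.add algebra_simps)
next
  case (linear d P Pc v)
  define \<eta> where "\<eta> = (\<lambda>p. Complex (a \<bullet> p) (b \<bullet> p))"
  define c where "c = Complex (v \<bullet> a) (v \<bullet> b)"
  have vp: "v \<bullet> p = Re (cnj c * \<eta> p) + (v \<bullet> n) * (n \<bullet> p)" for p
    by (subst frame) (simp add: c_def \<eta>_def inner_commute)
  have eta: "cnj (\<eta> p) * \<eta> p = of_real (p \<bullet> p - (n \<bullet> p)\<^sup>2)" for p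
    by (subst frame) (simp add: \<eta>_def complex_eq_iff inner_commute power2_eq_square)
  consider "d < 0" | "d = 0" | "d \<ge> 1" by linarith
  then show ?case
  proof cases
    case 1
    then have "P = (\<lambda>_. 0) \<and> Pc = (\<lambda>_. 0)" using cform_negative linear.hyps by simp
    then show ?thesis by (intro exI[of _ "\<lambda>_. 0"]) (auto intro: form.zero)
  next
    case 2
    then obtain x where x: "P = (\<lambda>_. x)" "Pc = (\<lambda>_. of_real x)" using cform_degree_0 linear.hyps by metis
    have "form (d + 1 - 1) (\<lambda>_. x * (v \<bullet> n))" "form (d + 1 - 2) (\<lambda>_. 0)"
      using 2 form.const form.zero by simp_all
    moreover have "(v \<bullet> p) * P p = (n \<bullet> p) * (x * (v \<bullet> n)) + (p \<bullet> p) * 0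
        + Re ((1/2) ^ (nat (d + 1) - 1) * cnj (cdot v (cpoint a b) * Pc (cpoint a b)) * \<eta> p ^ nat (d + 1))" for p
      using 2 by (simp add: x vp[of p] cdot_cpoint algebra_simps flip: c_def)
    ultimately show ?thesis unfolding \<eta>_def by blast
  next
    case 3
    define m where "m = nat (d - 1)"
    with 3 have m: "nat d = Suc m" "d = int (Suc m)" by simp_all
    from linear.IH obtain P1 P2 where P12: "form (d - 1) P1" "form (d - 2) P2"
      and P: "\<And>p. P p = (n \<bullet> p) * P1 p + (p \<bullet> p) * P2 p
        + Re ((1/2) ^ m * cnj (Pc (cpoint a b)) * \<eta> p ^ Suc m)"
      unfolding m(1) diff_Suc_1 \<eta>_def by blast
    define w where "w = (1/2) ^ m * cnj (Pc (cpoint a b))"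
    define B where "B = (\<lambda>p. Re (c * w / 2 * \<eta> p ^ m))"
    have fB: "form (d - 1) B"
      unfolding B_def \<eta>_def using form_Re_power[of m "c * w / 2" a b] m(2) by (simp only: of_nat_Suc add_diff_cancel_left')
    have fw: "form d (\<lambda>p. Re (w * \<eta> p ^ Suc m))"
      unfolding \<eta>_def using form_Re_power[of "Suc m" w a b] m(2) by (simp only:)
    let ?P1 = "\<lambda>p. (v \<bullet> p) * P1 p + (v \<bullet> n) * Re (w * \<eta> p ^ Suc m) - (n \<bullet> p) * B p"
    let ?P2 = "\<lambda>p. (v \<bullet> p) * P2 p + B p"
    have "form (d + 1 - 1) ?P1"
      using form_linear_mult[OF P12(1)] form_linear_mult[OF fB] form_cmult[OF fw]
      by (simp add: form.add form_diff)
    moreover have "form (d + 1 - 2) ?P2"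
      using form_linear_mult[of "d - 1" P2 v] P12(2) fB by (simp add: form.add)
    moreover have "(v \<bullet> p) * P p = (n \<bullet> p) * ?P1 p + (p \<bullet> p) * ?P2 p
        + Re ((1/2) ^ (nat (d + 1) - 1) * cnj (cdot v (cpoint a b) * Pc (cpoint a b)) * \<eta> p ^ nat (d + 1))" for p
    proof -
      have "2 * (Re x * Re y) = Re (x * y) + Re (cnj x * y)" for x y
        by simp
      from this[of "cnj c * \<eta> p" "w * \<eta> p ^ Suc m"]
      have "2 * (Re (cnj c * \<eta> p) * Re (w * \<eta> p ^ Suc m))
          = Re (cnj c * w * \<eta> p ^ Suc (Suc m)) + Re ((cnj (\<eta> p) * \<eta> p) * (c * w * \<eta> p ^ m))"
        by (simp only: complex_cnj_mult complex_cnj_cnj power_Suc mult.assoc mult.commute mult.left_commute)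
      also have "Re ((cnj (\<eta> p) * \<eta> p) * (c * w * \<eta> p ^ m)) = (p \<bullet> p - (n \<bullet> p)\<^sup>2) * (2 * B p)"
        unfolding eta B_def by simp
      finally have *: "Re (cnj c * \<eta> p) * Re (w * \<eta> p ^ Suc m)
          = Re (cnj c * w * \<eta> p ^ Suc (Suc m)) / 2 + (p \<bullet> p - (n \<bullet> p)\<^sup>2) * B p" by linarith
      have "nat (d + 1) = Suc (Suc m)" using m(2) by simp
      then have **: "(1/2) ^ (nat (d + 1) - 1) * cnj (cdot v (cpoint a b) * Pc (cpoint a b)) * \<eta> p ^ nat (d + 1)
          = (cnj c * w * \<eta> p ^ Suc (Suc m)) / 2"
        by (simp add: w_def cdot_cpoint flip: c_def)
      have "(v \<bullet> p) * P p = (v \<bullet> p) * ((n \<bullet> p) * P1 p + (p \<bullet> p) * P2 p)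
          + (v \<bullet> n) * (n \<bullet> p) * Re (w * \<eta> p ^ Suc m) + Re (cnj c * \<eta> p) * Re (w * \<eta> p ^ Suc m)"
        unfolding P w_def[symmetric] by (simp only: vp[of p] algebra_simps)
      then show ?thesis
        unfolding * ** Re_divide_numeral by (simp only: algebra_simps power2_eq_square)
    qed
    ultimately show ?thesis unfolding \<eta>_def by blast
  qed
qed

text \<open>
  The frame is chosen so that the form vanishes at \<open>a + i b\<close>; then the remainder in the preceding lemma is zero.
\<close>
lemma form_linear_factor_modulo_norm_square:
  assumes "form d P" "d \<ge> 1"
  obtains n P1 P2 where "form (d - 1) P1" "form (d - 2) P2" "P = (\<lambda>p. (n \<bullet> p) * P1 p + (p \<bullet> p) * P2 p)"
proof -
  obtain Pc where Pc: "cform d P Pc" using form_complexification[OF assms(1)] by blast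
  obtain z where z: "z \<noteq> 0" "(\<Sum>k\<in>UNIV. (z $ k)\<^sup>2) = 0" "Pc z = 0"
    using cform_null_zero_exists[OF Pc assms(2)] by blast
  obtain s a b where ab: "a \<bullet> a = 1" "b \<bullet> b = 1" "a \<bullet> b = 0" and "cpoint a b = of_real s *s z"
    using null_vector_normalization[OF z(1,2)] .
  then have "Pc (cpoint a b) = 0"
    by (simp only: cform_scale[OF Pc] z(3) mult_zero_right)
  with cform_modulo_frame[OF Pc orthonormal_frame[OF ab]] that show ?thesis
    by (auto simp: fun_eq_iff)
qed

text \<open>Splitting off linear factors repeatedly; the multiples of \<open>\<bar>p\<bar>\<^sup>2\<close> are collected in \<open>R\<close>.\<close>
lemma form_eq_linear_product_modulo_norm_square:
  "form (int d) P \<Longrightarrow> \<exists>l v R. form (int d - 2) R \<and> P = (\<lambda>p. l * linear_product d v p + (p \<bullet> p) * R p)"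
proof (induction d arbitrary: P)
  case 0
  then obtain c where "P = (\<lambda>_. c)" using form_degree_0 by auto
  then show ?case
    by (intro exI[of _ c] exI[of _ "\<lambda>_. 0"]) (auto simp: linear_product_def intro: form.zero)
next
  case (Suc d)
  have "int (Suc d) \<ge> 1" and eq: "int (Suc d) - 1 = int d" "int (Suc d) - 2 = int d - 1" by simp_all
  with form_linear_factor_modulo_norm_square[OF Suc.prems]
  obtain n P1 P2 where P: "form (int d) P1" "form (int d - 1) P2" "P = (\<lambda>p. (n \<bullet> p) * P1 p + (p \<bullet> p) * P2 p)"
    unfolding eq by blast
  obtain l v R where R: "form (int d - 2) R" "P1 = (\<lambda>p. l * linear_product d v p + (p \<bullet> p) * R p)"
    using Suc.IH[OF P(1)] by blast
  have "linear_product (Suc d) (v(Suc d := n)) p = linear_product d v p * (n \<bullet> p)" for p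
    by (auto simp: linear_product_def intro!: prod.cong)
  then have "P = (\<lambda>p. l * linear_product (Suc d) (v(Suc d := n)) p + (p \<bullet> p) * ((n \<bullet> p) * R p + P2 p))"
    by (simp add: P(3) R(2) fun_eq_iff algebra_simps)
  moreover have "form (int (Suc d) - 2) (\<lambda>p. (n \<bullet> p) * R p + P2 p)"
    unfolding eq using form_linear_mult[of "int d - 1" R n] R(1) P(2) by (simp add: form.add)
  ultimately show ?case by blast
qed

text \<open>
  On the sphere the factor \<open>p \<bullet> p\<close> disappears.  So splitting off a product from the component of top degree leaves
  a remainder that can be absorbed by the component two degrees lower.
\<close>
lemma sum_of_forms_eq_sum_of_linear_products:
  "(\<And>k. form (int k) (F k)) \<Longrightarrow>
    \<exists>l v. \<forall>p\<in>S2. (\<Sum>k\<le>n. F k p) = (\<Sum>k\<le>n. l k * linear_product k (v k) p)"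
proof (induction n arbitrary: F)
  case 0
  obtain c where "F 0 = (\<lambda>_. c)" using form_degree_0[OF 0[of 0]] by auto
  then show ?case by (intro exI[of _ "\<lambda>_. c"]) (auto simp: linear_product_def)
next
  case (Suc n)
  obtain l v R where R: "form (int (Suc n) - 2) R"
    "F (Suc n) = (\<lambda>p. l * linear_product (Suc n) v p + (p \<bullet> p) * R p)"
    using form_eq_linear_product_modulo_norm_square[OF Suc.prems] by blast
  have top: "F (Suc n) p = l * linear_product (Suc n) v p + R p" if "p \<in> S2" for p
    using that by (simp add: R(2) dot_square_norm)
  obtain G where G: "\<And>k. form (int k) (G k)" "\<And>p. (\<Sum>k\<le>n. G k p) = (\<Sum>k\<le>n. F k p) + R p"
  proof (cases n)
    case 0
    then have "R = (\<lambda>_. 0)" using form_negative[OF R(1)] by simp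
    with that[of F] Suc.prems show ?thesis by simp
  next
    case (Suc m)
    let ?G = "F(m := \<lambda>p. F m p + R p)"
    have "form (int k) (?G k)" for k
      using R(1) Suc Suc.prems form.add[of "int m" "F m" R] by auto
    moreover have "(\<Sum>k\<le>n. ?G k p) = (\<Sum>k\<le>n. F k p) + R p" for p
    proof -
      have "(\<Sum>k\<le>n. ?G k p) = (\<Sum>k\<le>n. F k p + (if k = m then R p else 0))"
        by (intro sum.cong) auto
      then show ?thesis using Suc by (simp add: sum.distrib)
    qed
    ultimately show ?thesis using that by blast
  qed
  obtain l' v' where "\<And>p. p \<in> S2 \<Longrightarrow> (\<Sum>k\<le>n. G k p) = (\<Sum>k\<le>n. l' k * linear_product k (v' k) p)"
    using Suc.IH[OF G(1)] by blast
  then have "(\<Sum>k\<le>Suc n. F k p)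
      = (\<Sum>k\<le>Suc n. (l'(Suc n := l)) k * linear_product k ((v'(Suc n := v)) k) p)" if "p \<in> S2" for p
    using that top[OF that] G(2)[of p] by simp
  then show ?case by blast
qed

section \<open>Uniqueness of the linear factors\<close>

text \<open>The restriction of a linear form to the null curve, as a polynomial in the parameter.\<close>
definition null_poly :: "real^3 \<Rightarrow> complex poly"
  where "null_poly v = [:Complex (v $ 1) (v $ 2), of_real (2 * v $ 3), Complex (- (v $ 1)) (v $ 2):]"

lemma poly_null_poly: "poly (null_poly v) t = cdot v (null_curve t)"
  by (simp add: null_poly_def cdot_def null_curve_def sum_3 Complex_eq power2_eq_square algebra_simps)

lemma null_poly_scaleR: "null_poly (s *\<^sub>R v) = smult (of_real s) (null_poly v)"
  by (simp add: null_poly_def complex_eq_iff)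

lemma null_poly_eq_0_iff [simp]: "null_poly v = 0 \<longleftrightarrow> v = 0"
  by (auto simp: null_poly_def complex_eq_iff vec_eq_iff forall_3)

lemma null_poly_root_exists:
  assumes "v \<noteq> 0"
  shows "\<exists>t. poly (null_poly v) t = 0"
proof -
  have "degree (null_poly v) \<noteq> 0"
    using assms by (auto simp: null_poly_def complex_eq_iff vec_eq_iff forall_3 split: if_splits)
  then have "\<not> constant (poly (null_poly v))"
    by (simp add: constant_degree)
  then show ?thesis by (rule Fundamental_Theorem_Algebra.fundamental_theorem_of_algebra)
qed

text \<open>
  A null point \<open>a + i b\<close> has orthogonal real and imaginary parts of equal nonzero length, so
  the real linear forms that vanish there are the multiples of a single one.
\<close>
lemma parallel_of_common_null_poly_root:
  assumes "poly (null_poly v) t = 0" "poly (null_poly w) t = 0" and v: "v \<noteq> 0" and w: "w \<noteq> 0"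
  shows "\<exists>s. s \<noteq> 0 \<and> w = s *\<^sub>R v"
proof -
  have "(\<Sum>k\<in>UNIV. (null_curve t $ k)\<^sup>2) = 0"
    by (simp add: null_curve_def sum_3 power_mult_distrib) (simp add: power2_eq_square algebra_simps)
  moreover have "null_curve t \<noteq> 0"
    by (auto simp: null_curve_def vec_eq_iff forall_3)
  ultimately obtain s a b where ab: "a \<bullet> a = 1" "b \<bullet> b = 1" "a \<bullet> b = 0"
      "cpoint a b = of_real s *s null_curve t"
    using null_vector_normalization by metis
  have "cdot u (cpoint a b) = of_real s * poly (null_poly u) t" for u
    by (simp add: ab(4) poly_null_poly cdot_def sum_distrib_left mult_ac)
  with assms(1,2) have "v \<bullet> a = 0" "v \<bullet> b = 0" "w \<bullet> a = 0" "w \<bullet> b = 0"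
    by (auto simp: cdot_cpoint complex_eq_iff)
  moreover note frame = orthonormal_frame[OF ab(1-3)]
  define n where "n = a \<times> b"
  ultimately have vn: "v \<bullet> p = (v \<bullet> n) * (p \<bullet> n)" and wn: "w \<bullet> p = (w \<bullet> n) * (p \<bullet> n)" for p
    using frame[of v p] frame[of w p] by simp_all
  have v0: "v \<bullet> n \<noteq> 0" using vn[of v] v by auto
  have w0: "w \<bullet> n \<noteq> 0" using wn[of w] w by auto
  have "w \<bullet> p = (((w \<bullet> n) / (v \<bullet> n)) *\<^sub>R v) \<bullet> p" for p
    using vn[of p] wn[of p] v0 by simp
  then have "w = ((w \<bullet> n) / (v \<bullet> n)) *\<^sub>R v"
    by (metis vector_eq_rdot)
  with v0 w0 show ?thesis
    by (intro exI[of _ "(w \<bullet> n) / (v \<bullet> n)"]) simp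
qed

text \<open>
  A root of the last factor on the right is also a root of some factor on the left.  These two factors are
  proportional, so they can be moved to the same position and cancelled.
\<close>
lemma same_up_to_order_and_scaling_of_nonzero_null_polys:
  fixes k :: nat and l l' :: real
  assumes "smult (of_real l) (\<Prod>j=1..k. null_poly (v j)) = smult (of_real l') (\<Prod>j=1..k. null_poly (v' j))"
    and "\<And>j. j \<in> {1..k} \<Longrightarrow> v j \<noteq> 0" "\<And>j. j \<in> {1..k} \<Longrightarrow> v' j \<noteq> 0" "l \<noteq> 0"
  shows "\<exists>\<pi> s. \<pi> permutes {1..k} \<and> (\<forall>j\<in>{1..k}. s j \<noteq> 0 \<and> v' j = s j *\<^sub>R v (\<pi> j)) \<and>
           l = l' * (\<Prod>j=1..k. s j)"
  using assms
proof (induction k arbitrary: v l')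
  case 0
  then have "l = l'" by simp
  then show ?case by (intro exI[of _ "\<lambda>j. j"] exI[of _ "\<lambda>_. 1"]) (simp add: permutes_def)
next
  case (Suc k)
  let ?K = "Suc k"
  obtain t where t: "poly (null_poly (v' ?K)) t = 0"
    using null_poly_root_exists Suc.prems(3)[of ?K] by auto
  have "poly (smult (of_real l) (\<Prod>j=1..?K. null_poly (v j))) t = 0"
    unfolding Suc.prems(1) using t by (simp add: poly_prod)
  then have "(\<Prod>j=1..?K. poly (null_poly (v j)) t) = 0"
    using Suc.prems(4) by (simp add: poly_prod)
  then obtain i where i: "i \<in> {1..?K}" "poly (null_poly (v i)) t = 0"
    by (subst (asm) prod_zero_iff) auto
  obtain c where c: "c \<noteq> 0" "v' ?K = c *\<^sub>R v i"
    using parallel_of_common_null_poly_root[OF i(2) t] Suc.prems(2)[OF i(1)] Suc.prems(3)[of ?K] by auto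
  define \<tau> where "\<tau> = Transposition.transpose i ?K"
  have \<tau>: "\<tau> permutes {1..?K}"
    unfolding \<tau>_def using i by (intro permutes_swap_id) auto
  define w where "w = v \<circ> \<tau>"
  have wK: "w ?K = v i" by (simp add: w_def \<tau>_def)
  have "(\<Prod>j=1..?K. null_poly (v j)) = (\<Prod>j=1..?K. null_poly (w j))"
    using prod.permute[OF \<tau>, of "\<lambda>j. null_poly (v j)"] by (simp add: w_def o_def)
  then have "smult (of_real l) (\<Prod>j=1..k. null_poly (w j)) * null_poly (v i)
      = smult (of_real (c * l')) (\<Prod>j=1..k. null_poly (v' j)) * null_poly (v i)"
    using Suc.prems(1) by (simp add: wK c(2) null_poly_scaleR mult.commute)
  then have eq: "smult (of_real l) (\<Prod>j=1..k. null_poly (w j)) = smult (of_real (c * l')) (\<Prod>j=1..k. null_poly (v' j))"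
    using Suc.prems(2)[OF i(1)] mult_right_cancel[of "null_poly (v i)"] null_poly_eq_0_iff by blast
  have w0: "w j \<noteq> 0" if "j \<in> {1..k}" for j
    using Suc.prems(2)[of "\<tau> j"] permutes_in_image[OF \<tau>, of j] that by (simp add: w_def)
  have v'0: "v' j \<noteq> 0" if "j \<in> {1..k}" for j
    using Suc.prems(3)[of j] that by simp
  obtain \<pi> s where \<pi>: "\<pi> permutes {1..k}" and s: "\<And>j. j \<in> {1..k} \<Longrightarrow> s j \<noteq> 0 \<and> v' j = s j *\<^sub>R w (\<pi> j)"
    and l: "l = c * l' * (\<Prod>j=1..k. s j)"
    using Suc.IH[OF eq w0 v'0 Suc.prems(4)] by blast
  have \<pi>K: "\<pi> permutes {1..?K}" "\<pi> ?K = ?K"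
    using permutes_subset[OF \<pi>, of "{1..?K}"] permutes_not_in[OF \<pi>, of ?K] by auto
  show ?case
  proof (intro exI conjI ballI)
    show "\<tau> \<circ> \<pi> permutes {1..?K}" using permutes_compose[OF \<pi>K(1) \<tau>] .
    fix j assume j: "j \<in> {1..?K}"
    show "(s(?K := c)) j \<noteq> 0" using j s c by auto
    show "v' j = (s(?K := c)) j *\<^sub>R v ((\<tau> \<circ> \<pi>) j)"
      using j s[of j] c(2) wK \<pi>K(2) by (auto simp: w_def)
  next
    have "(\<Prod>j=1..k. (s(?K := c)) j) = (\<Prod>j=1..k. s j)"
      by (intro prod.cong) auto
    then show "l = l' * (\<Prod>j=1..?K. (s(?K := c)) j)" using l by simp
  qed
qed

lemma same_up_to_order_and_scaling_of_null_polys: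
  assumes eq: "smult (of_real l) (\<Prod>j=1..k. null_poly (v j)) = smult (of_real l') (\<Prod>j=1..k. null_poly (v' j))"
  shows "same_up_to_order_and_scaling k l v l' v'"
proof (cases "l = 0 \<or> (\<exists>j\<in>{1..k}. v j = 0)")
  case True
  then have "smult (of_real l') (\<Prod>j=1..k. null_poly (v' j)) = 0"
    unfolding eq[symmetric] by (auto simp: prod_zero_iff)
  then have "l' = 0 \<or> (\<exists>j\<in>{1..k}. v' j = 0)" by (auto simp: prod_zero_iff)
  with True show ?thesis unfolding same_up_to_order_and_scaling_def by blast
next
  case False
  then have "smult (of_real l') (\<Prod>j=1..k. null_poly (v' j)) \<noteq> 0"
    unfolding eq[symmetric] by (auto simp: prod_zero_iff)
  then have "\<forall>j\<in>{1..k}. v' j \<noteq> 0" by (auto simp: prod_zero_iff)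
  with False same_up_to_order_and_scaling_of_nonzero_null_polys[OF eq] show ?thesis
    unfolding same_up_to_order_and_scaling_def by blast
qed

lemma linear_product_cong_up_to_order_and_scaling:
  assumes "same_up_to_order_and_scaling k l v l' v'"
  shows "l * linear_product k v p = l' * linear_product k v' p"
proof -
  consider (zero) "l = 0 \<or> (\<exists>j\<in>{1..k}. v j = 0)" "l' = 0 \<or> (\<exists>j\<in>{1..k}. v' j = 0)"
    | (nonzero) \<pi> s where "\<pi> permutes {1..k}" "\<forall>j\<in>{1..k}. s j \<noteq> 0 \<and> v' j = s j *\<^sub>R v (\<pi> j)"
        "l = l' * (\<Prod>j=1..k. s j)"
    using assms unfolding same_up_to_order_and_scaling_def by blast
  then show ?thesis
  proof cases
    case nonzero
    note \<pi> = nonzero(1) and s = nonzero(2) and l = nonzero(3)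
    have "linear_product k v' p = (\<Prod>j=1..k. s j * (v (\<pi> j) \<bullet> p))"
      unfolding linear_product_def using s by (intro prod.cong) auto
    also have "\<dots> = (\<Prod>j=1..k. s j) * (\<Prod>j=1..k. v (\<pi> j) \<bullet> p)"
      by (rule prod.distrib)
    also have "(\<Prod>j=1..k. v (\<pi> j) \<bullet> p) = linear_product k v p"
      using prod.permute[OF \<pi>, of "\<lambda>j. v j \<bullet> p"] by (simp add: linear_product_def o_def)
    finally show ?thesis by (simp add: l)
  next
    case zero
    have "linear_product k u p = 0" if "\<exists>j\<in>{1..k}. u j = 0" for u
      using that by (force simp: linear_product_def prod_zero_iff)
    with zero have "l * linear_product k v p = 0" "l' * linear_product k v' p = 0"
      by (metis mult_eq_0_iff)+
    then show ?thesis by (simp only:)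
  qed
qed

text \<open>
  If forms \<open>A k\<close> of degree \<open>k \<le> d\<close> sum to zero on the sphere, then comparing antipodal points leaves only
  the degrees of the parity of \<open>d\<close>.  Multiplying these by powers of \<open>\<bar>p\<bar>\<^sup>2\<close> makes the sum homogeneous, hence
  zero everywhere, and at a null point only the term of degree \<open>d\<close> survives.
\<close>
lemma top_cform_vanishes_on_null_cone:
  assumes A: "\<And>k. cform (int k) (A k) (Ac k)" and sum0: "\<And>p. p \<in> S2 \<Longrightarrow> (\<Sum>k\<le>d. A k p) = 0"
    and null: "(\<Sum>k\<in>UNIV. (z $ k)\<^sup>2) = 0"
  shows "Ac d z = 0"
proof -
  let ?I = "{k. k \<le> d \<and> even (d - k)}"
  have fin: "finite ?I" by (rule finite_subset[of _ "{..d}"]) auto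
  have Ascale: "A k (t *\<^sub>R p) = t ^ k * A k p" for k t p
    using form_scale[OF cform_form[OF A[of k]]] by simp
  have sphere: "(\<Sum>k\<in>?I. A k p) = 0" if p: "p \<in> S2" for p
  proof -
    have "(\<Sum>k\<le>d. A k p) + (-1) ^ d * (\<Sum>k\<le>d. A k (- p)) = 0"
      using sum0[of p] sum0[of "- p"] p by simp
    moreover have "A k p + (-1) ^ d * A k (- p) = (if even (d - k) then 2 * A k p else 0)" if "k \<le> d" for k
    proof -
      have "(-1::real) ^ d * (-1) ^ k = (-1) ^ (d - k)"
        using that by (auto simp: minus_one_power_iff)
      then show ?thesis
        using Ascale[of k "-1" p] by (auto simp: minus_one_power_iff algebra_simps split: if_splits)
    qed
    then have "(\<Sum>k\<le>d. A k p) + (-1) ^ d * (\<Sum>k\<le>d. A k (- p))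
        = (\<Sum>k\<le>d. if even (d - k) then 2 * A k p else 0)"
      unfolding sum_distrib_left sum.distrib[symmetric] by (intro sum.cong) auto
    also have "\<dots> = 2 * (\<Sum>k\<in>?I. A k p)"
      unfolding sum_distrib_left by (rule sum.mono_neutral_cong_right) auto
    ultimately show ?thesis by simp
  qed
  let ?H = "\<lambda>p. \<Sum>k\<in>?I. (p \<bullet> p) ^ ((d - k) div 2) * A k p"
  let ?Hc = "\<lambda>z. \<Sum>k\<in>?I. (\<Sum>i\<in>UNIV. (z $ i)\<^sup>2) ^ ((d - k) div 2) * Ac k z"
  have H: "cform (int d) ?H ?Hc"
  proof (rule cform_sum[OF fin])
    fix k assume "k \<in> ?I"
    then have "even (d - k)" "k \<le> d" by blast+
    then obtain m where "d - k = 2 * m" "k \<le> d" by (metis evenE)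
    then have "int k + 2 * int ((d - k) div 2) = int d" by simp
    with cform_norm_power_mult[OF A[of k], of "(d - k) div 2"]
    show "cform (int d) (\<lambda>p. (p \<bullet> p) ^ ((d - k) div 2) * A k p)
        (\<lambda>z. (\<Sum>i\<in>UNIV. (z $ i)\<^sup>2) ^ ((d - k) div 2) * Ac k z)" by simp
  qed
  have "?H p = 0" for p
  proof -
    obtain q where q: "q \<in> S2" "p = norm p *\<^sub>R q" by (rule scaled_sphere_point)
    have "?H p = norm p ^ d * ?H q"
      using form_scale[OF cform_form[OF H], of "norm p" q] q(2) by simp
    also have "?H q = (\<Sum>k\<in>?I. A k q)"
      using q(1) by (simp add: dot_square_norm)
    finally show ?thesis using sphere[OF q(1)] by simp
  qed
  then have "?H = (\<lambda>_. 0)" by (rule ext)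
  with H have "cform (int d) (\<lambda>_. 0) ?Hc" by (simp only:)
  then have "?Hc z = 0" by (rule cform_zero)
  moreover have "?Hc z = (\<Sum>k\<in>{d}. Ac k z)"
  proof (rule sum.mono_neutral_cong_right[OF fin])
    show "\<forall>k\<in>?I - {d}. (\<Sum>i\<in>UNIV. (z $ i)\<^sup>2) ^ ((d - k) div 2) * Ac k z = 0"
    proof
      fix k assume k: "k \<in> ?I - {d}"
      then have "(d - k) div 2 > 0"
        by (auto simp: div_greater_zero_iff intro!: dvd_imp_le)
      then show "(\<Sum>i\<in>UNIV. (z $ i)\<^sup>2) ^ ((d - k) div 2) * Ac k z = 0"
        by (simp add: null)
    qed
  qed auto
  ultimately show ?thesis by simp
qed

lemma sum_of_linear_products_unique:
  assumes "\<And>p. p \<in> S2 \<Longrightarrow>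
      (\<Sum>k\<le>d. l k * linear_product k (v k) p) = (\<Sum>k\<le>d. l' k * linear_product k (v' k) p)"
    and "k \<le> d"
  shows "same_up_to_order_and_scaling k (l k) (v k) (l' k) (v' k)"
  using assms
proof (induction d)
  case 0
  then have "l 0 = l' 0" using 0(1)[of "axis 1 1"] by (simp add: linear_product_def norm_axis_1)
  then show ?case using 0 by (intro same_up_to_order_and_scaling_of_null_polys) simp
next
  case (Suc d)
  let ?A = "\<lambda>k p. l k * linear_product k (v k) p + (- l' k) * linear_product k (v' k) p"
  let ?Ac = "\<lambda>k z. of_real (l k) * (\<Prod>j=1..k. cdot (v k j) z) + of_real (- l' k) * (\<Prod>j=1..k. cdot (v' k j) z)"
  have A: "cform (int k) (?A k) (?Ac k)" for k
    by (intro cform.add cform_cmult cform_linear_product)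
  have sum0: "(\<Sum>k\<le>Suc d. ?A k p) = 0" if "p \<in> S2" for p
    using Suc.prems(1)[OF that] by (simp only: sum.distrib mult_minus_left sum_negf)
  have "of_real (l (Suc d)) * (\<Prod>j=1..Suc d. cdot (v (Suc d) j) (null_curve t))
      + of_real (- l' (Suc d)) * (\<Prod>j=1..Suc d. cdot (v' (Suc d) j) (null_curve t)) = 0" for t
    using top_cform_vanishes_on_null_cone[where A = ?A and Ac = ?Ac, OF A sum0, of "null_curve t"]
    by (simp add: null_curve_def sum_3 power2_eq_square algebra_simps)
  then have "poly (smult (of_real (l (Suc d))) (\<Prod>j=1..Suc d. null_poly (v (Suc d) j))) t
      = poly (smult (of_real (l' (Suc d))) (\<Prod>j=1..Suc d. null_poly (v' (Suc d) j))) t" for t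
    by (simp add: poly_prod poly_null_poly)
  then have top: "same_up_to_order_and_scaling (Suc d) (l (Suc d)) (v (Suc d)) (l' (Suc d)) (v' (Suc d))"
    by (intro same_up_to_order_and_scaling_of_null_polys) (simp add: poly_eq_poly_eq_iff[symmetric] fun_eq_iff)
  show ?case
  proof (cases "k = Suc d")
    case True
    then show ?thesis using top by simp
  next
    case False
    have "(\<Sum>k\<le>d. l k * linear_product k (v k) p) = (\<Sum>k\<le>d. l' k * linear_product k (v' k) p)" if "p \<in> S2" for p
      using Suc.prems(1)[OF that] linear_product_cong_up_to_order_and_scaling[OF top, of p] by simp
    then show ?thesis using Suc.IH Suc.prems(2) False by simp
  qed
qed

unbundle no cross3_syntax

section \<open>Integration over the sphere\<close>

lemma finite_measure_S2: "finite_measure S2_measure"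
  by (rule finite_measureI) (simp add: emeasure_S2)

interpretation S2: finite_measure S2_measure
  by (rule finite_measure_S2)

lemma continuous_measurable_S2:
  fixes f :: "real^3 \<Rightarrow> real"
  assumes "continuous_on S2 f"
  shows "f \<in> borel_measurable S2_measure"
  using borel_measurable_continuous_on_restrict[OF assms]
  by (simp cong: measurable_cong_sets add: measurable_cong_sets[OF sets_S2_measure refl])

lemma continuous_bounded_S2:
  fixes f :: "real^3 \<Rightarrow> real"
  assumes "continuous_on S2 f"
  obtains B where "\<And>p. p \<in> S2 \<Longrightarrow> \<bar>f p\<bar> \<le> B"
proof -
  have "bounded (f ` S2)"
    by (intro compact_imp_bounded compact_continuous_image assms) simp
  then obtain B where "\<forall>y\<in>f ` S2. norm y \<le> B" by (auto simp: bounded_iff)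
  then show ?thesis by (intro that[of B]) auto
qed

lemma continuous_integrable_S2:
  fixes f :: "real^3 \<Rightarrow> real"
  assumes "continuous_on S2 f"
  shows "integrable S2_measure f"
proof -
  obtain B where "\<And>p. p \<in> S2 \<Longrightarrow> \<bar>f p\<bar> \<le> B" using continuous_bounded_S2[OF assms] by blast
  then show ?thesis
    by (intro S2.integrable_const_bound[of _ B] continuous_measurable_S2 assms) (auto intro!: AE_I2)
qed

lemma integral_S2_orthogonal_invariant:
  fixes f :: "real^3 \<Rightarrow> real"
  assumes R: "orthogonal_transformation R" and f: "f \<in> borel_measurable S2_measure"
  shows "(LINT p|S2_measure. f (R p)) = (LINT p|S2_measure. f p)"
proof -
  have R_borel: "R \<in> borel_measurable borel"
    using R by (intro borel_measurable_continuous_onI linear_continuous_on)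
      (simp add: linear_conv_bounded_linear[symmetric] orthogonal_transformation_linear)
  have R_S2: "R \<in> measurable S2_measure S2_measure"
    unfolding measurable_cong_sets[OF sets_S2_measure sets_S2_measure]
    by (rule measurable_restrict_space2)
      (use R_borel R in \<open>auto simp: orthogonal_transformation_norm space_restrict_space intro: measurable_restrict_space1\<close>)
  have "distr S2_measure S2_measure R = S2_measure"
  proof (rule measure_eqI)
    fix A assume "A \<in> sets (distr S2_measure S2_measure R)"
    then have A: "A \<in> sets S2_measure" by simp
    have "emeasure (distr S2_measure S2_measure R) A = emeasure S2_measure (R -` A \<inter> S2)"
      by (simp add: emeasure_distr[OF R_S2 A])
    also have "\<dots> = emeasure S2_measure (R ` (R -` A \<inter> S2))"
    proof (rule S2_measure_orthogonal_invariant[OF R, symmetric])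
      have "R -` A \<inter> S2 \<in> sets S2_measure"
        using measurable_sets[OF R_S2 A] by simp
      then show "R -` A \<inter> S2 \<in> sets borel"
        by (simp add: sets_restrict_space_iff)
    qed simp
    also have "R ` (R -` A \<inter> S2) = A"
    proof -
      have "A \<subseteq> S2" using A sets.sets_into_space by fastforce
      moreover have "surj R" using R by (rule orthogonal_transformation_surj)
      ultimately show ?thesis
        using R by (fastforce simp: orthogonal_transformation_norm image_iff surj_def)
    qed
    finally show "emeasure (distr S2_measure S2_measure R) A = emeasure S2_measure A" .
  qed simp
  then show ?thesis
    using integral_distr[OF R_S2 f] by simp
qed

text \<open>Cones over relatively open subsets of the sphere have positive volume.\<close>
lemma continuous_nonneg_integral_0_S2:
  fixes f :: "real^3 \<Rightarrow> real"
  assumes f: "continuous_on S2 f" and nonneg: "\<And>p. p \<in> S2 \<Longrightarrow> 0 \<le> f p"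
    and int: "(LINT p|S2_measure. f p) = 0" and p: "p \<in> S2"
  shows "f p = 0"
proof (rule ccontr)
  assume "f p \<noteq> 0"
  define A where "A = {p \<in> S2. f p \<noteq> 0}"
  have "A = S2 \<inter> f -` (- {0})" by (auto simp: A_def)
  moreover have "openin (top_of_set S2) (S2 \<inter> f -` (- {0}))"
    by (rule continuous_openin_preimage_gen[OF f]) auto
  ultimately have "openin (top_of_set S2) A" by (simp only:)
  then obtain U where U: "open U" "A = S2 \<inter> U" by (auto simp: openin_open)
  have A_borel: "A \<in> sets borel" "A \<subseteq> S2" unfolding U(2) using U(1) by (intro sets.Int borel_closed borel_open) auto
  have "AE p in S2_measure. 0 \<le> f p"
    by (rule AE_I2) (use nonneg in simp)
  then have "AE p in S2_measure. f p = 0"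
    using int integral_nonneg_eq_0_iff_AE[OF continuous_integrable_S2[OF f]] by simp
  then have "emeasure S2_measure {p \<in> space S2_measure. \<not> f p = 0} = 0"
    by (rule AE_E2)
  then have 0: "emeasure lborel {x \<in> cball 0 1 - {0}. sgn x \<in> A} = 0"
    using emeasure_S2_measure[OF A_borel] by (simp add: A_def)
  let ?V = "{x \<in> ball 0 1 - {0}. sgn x \<in> U}"
  have "?V = (ball 0 1 - {0}) \<inter> sgn -` U" by auto
  moreover have "continuous_on (ball 0 1 - {0}) (sgn :: real^3 \<Rightarrow> real^3)"
    by (intro continuous_on_sgn continuous_on_id) auto
  ultimately have "open ?V"
    using continuous_open_preimage[OF _ _ U(1), of "ball 0 1 - {0 :: real^3}" sgn] by (simp add: open_delete)
  moreover have "(1/2) *\<^sub>R p \<in> ?V"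
  proof -
    have "sgn ((1/2) *\<^sub>R p) = p" using p by (simp add: sgn_div_norm)
    moreover have "p \<in> U" using U(2) p \<open>f p \<noteq> 0\<close> by (auto simp: A_def)
    ultimately show ?thesis using p by auto
  qed
  ultimately have "\<not> negligible ?V"
    using open_not_negligible by blast
  moreover have "?V \<subseteq> {x \<in> cball 0 1 - {0}. sgn x \<in> A}"
    unfolding U(2) by (auto simp: norm_sgn)
  moreover have "{x \<in> cball 0 1 - {0}. sgn x \<in> A} \<in> null_sets lborel"
  proof (rule null_setsI[OF 0])
    have "sgn \<in> borel_measurable (borel :: (real^3) measure)"
      unfolding sgn_div_norm[abs_def] by measurable
    from measurable_sets[OF this A_borel(1)]
    have "sgn -` A \<inter> (cball 0 1 - {0}) \<in> sets borel" by simp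
    moreover have "{x \<in> cball 0 1 - {0}. sgn x \<in> A} = sgn -` A \<inter> (cball 0 1 - {0})" by auto
    ultimately show "{x \<in> cball 0 1 - {0}. sgn x \<in> A} \<in> sets lborel" by simp
  qed
  then have "negligible {x \<in> cball 0 1 - {0}. sgn x \<in> A}"
    by (simp add: negligible_iff_null_sets null_sets_completionI)
  ultimately show False using negligible_subset by blast
qed

section \<open>Orthogonality of spherical harmonics\<close>

definition plane_rotation :: "3 \<Rightarrow> 3 \<Rightarrow> real \<Rightarrow> real^3 \<Rightarrow> real^3"
  where "plane_rotation i j \<theta> p =
    (\<chi> k. if k = i then cos \<theta> * p $ i - sin \<theta> * p $ j else if k = j then sin \<theta> * p $ i + cos \<theta> * p $ j else p $ k)"

lemma orthogonal_plane_rotation: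
  assumes "i \<noteq> j"
  shows "orthogonal_transformation (plane_rotation i j \<theta>)"
  unfolding orthogonal_transformation_def
proof (intro conjI allI)
  show "linear (plane_rotation i j \<theta>)"
    by (intro linearI) (auto simp: plane_rotation_def vec_eq_iff algebra_simps)
  fix v w :: "real^3"
  have 1: "(cos \<theta> * x - sin \<theta> * y) * (cos \<theta> * x' - sin \<theta> * y') + (sin \<theta> * x + cos \<theta> * y) * (sin \<theta> * x' + cos \<theta> * y')
      = x * x' + y * y'" for x x' y y'
  proof -
    have "(cos \<theta> * x - sin \<theta> * y) * (cos \<theta> * x' - sin \<theta> * y') + (sin \<theta> * x + cos \<theta> * y) * (sin \<theta> * x' + cos \<theta> * y')
      = ((sin \<theta>)\<^sup>2 + (cos \<theta>)\<^sup>2) * (x * x' + y * y')"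
      by (simp only: power2_eq_square algebra_simps)
    then show ?thesis by simp
  qed
  show "plane_rotation i j \<theta> v \<bullet> plane_rotation i j \<theta> w = v \<bullet> w"
    using exhaust_3[of i] exhaust_3[of j] assms
      1[of "v $ i" "v $ j" "w $ i" "w $ j"]
    by (auto simp: plane_rotation_def inner_vec_def sum_3)
qed

text \<open>The infinitesimal rotation \<open>x\<^sub>i \<partial>\<^sub>j - x\<^sub>j \<partial>\<^sub>i\<close>.\<close>
definition angular :: "3 \<Rightarrow> 3 \<Rightarrow> (real^3 \<Rightarrow> real) \<Rightarrow> real^3 \<Rightarrow> real"
  where "angular i j P p = p $ i * pd j P p - p $ j * pd i P p"

lemma polynomial_angular:
  assumes "real_polynomial_function P"
  shows "real_polynomial_function (angular i j P)"
proof -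
  have "real_polynomial_function (\<lambda>p. p $ i * pd j P p - p $ j * pd i P p)"
    by (intro real_polynomial_function_diff polynomial_mult
        real_polynomial_function_coordinate polynomial_pd assms)
  then show ?thesis by (simp add: angular_def[abs_def])
qed

lemma polynomial_continuous_on: "real_polynomial_function P \<Longrightarrow> continuous_on A (P :: real^3 \<Rightarrow> real)"
  by (simp add: real_polynomial_function_eq continuous_on_polymonial_function)

text \<open>
  Differentiating the integral of \<open>G \<circ> R\<^sub>\<theta>\<close>, which does not depend on \<open>\<theta>\<close>, under the integral sign.  The
  difference quotients are bounded uniformly on the sphere by the mean value theorem.
\<close>
lemma integral_angular_S2:
  assumes G: "real_polynomial_function G" and ij: "i \<noteq> j"
  shows "(LINT p|S2_measure. angular i j G p) = 0"
proof -
  define R where "R = plane_rotation i j"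
  have R: "orthogonal_transformation (R \<theta>)" for \<theta>
    unfolding R_def by (rule orthogonal_plane_rotation[OF ij])
  have R0: "R 0 p = p" for p by (simp add: R_def plane_rotation_def vec_eq_iff)
  have RS2: "R \<theta> p \<in> S2" if "p \<in> S2" for \<theta> p
    using that R by (simp add: orthogonal_transformation_norm)
  have deriv: "((\<lambda>\<theta>. G (R \<theta> p)) has_real_derivative angular i j G (R \<theta> p)) (at \<theta>)" for \<theta> p
  proof -
    let ?D = "\<lambda>h. h *\<^sub>R (R \<theta> p $ i *\<^sub>R axis j 1 - R \<theta> p $ j *\<^sub>R axis i 1)"
    have "((\<lambda>\<theta>. R \<theta> p) has_derivative ?D) (at \<theta>)"
      unfolding has_derivative_componentwise_within[where f = "\<lambda>\<theta>. R \<theta> p"]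
    proof
      fix b :: "real^3" assume "b \<in> Basis"
      then obtain k where b: "b = axis k 1" by (auto simp: Basis_vec_def)
      show "((\<lambda>\<theta>. R \<theta> p \<bullet> b) has_derivative (\<lambda>h. ?D h \<bullet> b)) (at \<theta>)"
        unfolding b inner_axis using ij
        by (auto simp: R_def plane_rotation_def axis_def fun_eq_iff algebra_simps intro!: derivative_eq_intros)
    qed
    from has_derivative_compose[OF this polynomial_has_derivative[OF G]]
    have "((\<lambda>\<theta>. G (R \<theta> p)) has_derivative (\<lambda>h. \<Sum>k\<in>UNIV. ?D h $ k * pd k G (R \<theta> p))) (at \<theta>)" .
    moreover have "(\<Sum>k\<in>UNIV. ?D h $ k * pd k G (R \<theta> p)) = angular i j G (R \<theta> p) * h" for h
      using exhaust_3[of i] exhaust_3[of j] ij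
      by (auto simp: sum_3 axis_def angular_def algebra_simps)
    ultimately show ?thesis by (simp add: has_field_derivative_def)
  qed
  have cont: "continuous_on S2 (angular i j G)" "continuous_on S2 G"
    by (intro polynomial_continuous_on polynomial_angular G)+
  obtain B where B: "\<And>p. p \<in> S2 \<Longrightarrow> \<bar>angular i j G p\<bar> \<le> B"
    using continuous_bounded_S2[OF cont(1)] by blast
  define q where "q = (\<lambda>n p. (G (R (1 / real (Suc n)) p) - G p) * real (Suc n))"
  have contR: "continuous_on S2 (\<lambda>p. G (R \<theta> p))" for \<theta>
  proof (rule continuous_on_compose2[OF polynomial_continuous_on[OF G, of UNIV]])
    show "continuous_on S2 (R \<theta>)"
      using R[of \<theta>] by (intro linear_continuous_on)
        (simp add: linear_conv_bounded_linear[symmetric] orthogonal_transformation_linear)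
  qed simp
  have contq: "continuous_on S2 (q n)" for n
    unfolding q_def using contR cont by (intro continuous_intros)
  have "(LINT p|S2_measure. q n p) = 0" for n
  proof -
    have "(LINT p|S2_measure. G (R (1 / real (Suc n)) p)) = (LINT p|S2_measure. G p)"
      by (rule integral_S2_orthogonal_invariant[OF R continuous_measurable_S2[OF cont(2)]])
    then show ?thesis
      unfolding q_def using continuous_integrable_S2[OF contR] continuous_integrable_S2[OF cont(2)]
      by simp
  qed
  moreover have "(\<lambda>n. LINT p|S2_measure. q n p) \<longlonglongrightarrow> (LINT p|S2_measure. angular i j G p)"
  proof (rule integral_dominated_convergence)
    show "integrable S2_measure (\<lambda>_. B)" by simp
    show "AE p in S2_measure. (\<lambda>n. q n p) \<longlonglongrightarrow> angular i j G p"
    proof (rule AE_I2)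
      fix p :: "real^3"
      have "((\<lambda>h. (G (R h p) - G p) / h) \<longlongrightarrow> angular i j G p) (at 0)"
        using deriv[of p 0] by (simp add: DERIV_def R0)
      moreover have "filterlim (\<lambda>n. 1 / real (Suc n)) (at 0) sequentially"
        unfolding filterlim_at using LIMSEQ_inverse_real_of_nat
        by (auto simp: inverse_eq_divide simp del: of_nat_Suc)
      ultimately have "(\<lambda>n. (G (R (1 / real (Suc n)) p) - G p) / (1 / real (Suc n))) \<longlonglongrightarrow> angular i j G p"
        by (rule filterlim_compose)
      then show "(\<lambda>n. q n p) \<longlonglongrightarrow> angular i j G p" by (simp add: q_def del: of_nat_Suc)
    qed
    show "AE p in S2_measure. norm (q n p) \<le> B" for n
    proof (rule AE_I2)
      fix p assume "p \<in> space S2_measure"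
      then have p: "p \<in> S2" by simp
      let ?t = "1 / real (Suc n)"
      have "?t > 0" by simp
      from MVT2[OF this, of "\<lambda>\<theta>. G (R \<theta> p)" "\<lambda>\<theta>. angular i j G (R \<theta> p)"] deriv
      obtain z where "G (R ?t p) - G (R 0 p) = (?t - 0) * angular i j G (R z p)" by blast
      then have "q n p = angular i j G (R z p)"
        by (simp add: q_def R0 del: of_nat_Suc)
      then show "norm (q n p) \<le> B" using B[OF RS2[OF p]] by simp
    qed
  qed (intro continuous_measurable_S2 cont contq)+
  ultimately show ?thesis by (simp add: LIMSEQ_const_iff)
qed

text \<open>The Laplacian in polar coordinates: the sum of the squared infinitesimal rotations is its angular part.\<close>
lemma sum_of_squared_angular:
  assumes P: "form d P"
  shows "angular 1 2 (angular 1 2 P) p + angular 1 3 (angular 1 3 P) p + angular 2 3 (angular 2 3 P) p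
    = (p \<bullet> p) * laplacian P p - of_int (d * (d + 1)) * P p"
proof -
  note pP = form_polynomial[OF P]
  have x: "real_polynomial_function (\<lambda>p. p $ i * pd j P p)" for i j
    by (intro polynomial_mult real_polynomial_function_coordinate polynomial_pd pP)
  have pd: "pd k (angular i j P) p = ((if i = k then 1 else 0) * pd j P p + p $ i * pd k (pd j P) p)
      - ((if j = k then 1 else 0) * pd i P p + p $ j * pd k (pd i P) p)" for i j k
    unfolding angular_def[abs_def] pd_diff[OF x x]
    by (simp only: pd_mult[OF real_polynomial_function_coordinate polynomial_pd[OF pP]] pd_coordinate)
  have E: "p $ 1 * pd 1 P p + p $ 2 * pd 2 P p + p $ 3 * pd 3 P p = of_int d * P p"
    by (rule Euler_identity[OF P])
  have E': "p $ 1 * pd 1 (pd k P) p + p $ 2 * pd 2 (pd k P) p + p $ 3 * pd 3 (pd k P) p = of_int (d - 1) * pd k P p" for k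
    by (rule Euler_identity[OF form_pd[OF P]])
  have "angular 1 2 (angular 1 2 P) p + angular 1 3 (angular 1 3 P) p + angular 2 3 (angular 2 3 P) p
    = (p \<bullet> p) * laplacian P p
      - (p $ 1 * (p $ 1 * pd 1 (pd 1 P) p + p $ 2 * pd 2 (pd 1 P) p + p $ 3 * pd 3 (pd 1 P) p)
       + p $ 2 * (p $ 1 * pd 1 (pd 2 P) p + p $ 2 * pd 2 (pd 2 P) p + p $ 3 * pd 3 (pd 2 P) p)
       + p $ 3 * (p $ 1 * pd 1 (pd 3 P) p + p $ 2 * pd 2 (pd 3 P) p + p $ 3 * pd 3 (pd 3 P) p))
      - 2 * (p $ 1 * pd 1 P p + p $ 2 * pd 2 P p + p $ 3 * pd 3 P p)"
    unfolding angular_def[of _ _ "angular _ _ P"] pd laplacian_eq_pd[OF pP] inner_vec_def sum_3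
    by (simp add: algebra_simps)
  also have "\<dots> = (p \<bullet> p) * laplacian P p
      - of_int (d - 1) * (p $ 1 * pd 1 P p + p $ 2 * pd 2 P p + p $ 3 * pd 3 P p)
      - 2 * (p $ 1 * pd 1 P p + p $ 2 * pd 2 P p + p $ 3 * pd 3 P p)"
    unfolding E' by (simp add: algebra_simps)
  also have "\<dots> = (p \<bullet> p) * laplacian P p - of_int (d * (d + 1)) * P p"
    unfolding E by (simp add: algebra_simps)
  finally show ?thesis .
qed

text \<open>
  Harmonic forms of different degrees are eigenfunctions, for different eigenvalues \<open>- d (d + 1)\<close>, of a
  sum of squares of skew-symmetric operators.
\<close>
lemma harmonic_forms_orthogonal:
  assumes P: "harmonic_form (int d) P" and Q: "harmonic_form (int e) Q" and de: "d \<noteq> e"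
  shows "(LINT p|S2_measure. P p * Q p) = 0"
proof -
  have fP: "form (int d) P" and fQ: "form (int e) Q" using P Q by (auto simp: harmonic_form_def)
  note pP = form_polynomial[OF fP] and pQ = form_polynomial[OF fQ]
  have a: "real_polynomial_function (\<lambda>p. P p * angular i j Q p)"
    and b: "real_polynomial_function (\<lambda>p. Q p * angular i j P p)" for i j
    by (intro polynomial_mult pP pQ polynomial_angular)+
  define G where "G = (\<lambda>i j p. P p * angular i j Q p - Q p * angular i j P p)"
  have pG: "real_polynomial_function (G i j)" for i j
    unfolding G_def using a b by (rule real_polynomial_function_diff)
  have angG: "angular i j (G i j) p = P p * angular i j (angular i j Q) p - Q p * angular i j (angular i j P) p" for i j p
  proof -
    have "pd k (G i j) p = (pd k P p * angular i j Q p + P p * pd k (angular i j Q) p)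
        - (pd k Q p * angular i j P p + Q p * pd k (angular i j P) p)" for k
      unfolding G_def pd_diff[OF a b] pd_mult[OF pP polynomial_angular[OF pQ]] pd_mult[OF pQ polynomial_angular[OF pP]] ..
    then show ?thesis
      by (simp add: angular_def[of _ _ "G i j"]) (simp add: angular_def algebra_simps)
  qed
  let ?c = "real d * (real d + 1) - real e * (real e + 1)"
  have "angular 1 2 (G 1 2) p + angular 1 3 (G 1 3) p + angular 2 3 (G 2 3) p = ?c * (P p * Q p)" for p
  proof -
    have "angular 1 2 (G 1 2) p + angular 1 3 (G 1 3) p + angular 2 3 (G 2 3) p
      = P p * (angular 1 2 (angular 1 2 Q) p + angular 1 3 (angular 1 3 Q) p + angular 2 3 (angular 2 3 Q) p)
      - Q p * (angular 1 2 (angular 1 2 P) p + angular 1 3 (angular 1 3 P) p + angular 2 3 (angular 2 3 P) p)"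
      unfolding angG by (simp add: algebra_simps)
    then show ?thesis
      unfolding sum_of_squared_angular[OF fP] sum_of_squared_angular[OF fQ]
      using P Q by (simp add: harmonic_form_def algebra_simps)
  qed
  then have "?c * (LINT p|S2_measure. P p * Q p)
      = (LINT p|S2_measure. angular 1 2 (G 1 2) p + angular 1 3 (G 1 3) p + angular 2 3 (G 2 3) p)"
    by simp
  also have "\<dots> = 0"
    using integral_angular_S2[OF pG] continuous_integrable_S2[OF polynomial_continuous_on[OF polynomial_angular[OF pG]]]
    by simp
  finally have "?c * (LINT p|S2_measure. P p * Q p) = 0" .
  moreover have "?c = (real d - real e) * (real d + real e + 1)" by (simp add: algebra_simps)
  then have "?c \<noteq> 0" using de by (auto simp: add_eq_0_iff)
  ultimately show ?thesis by simp
qed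

section \<open>Square-integrable functions on the sphere\<close>

definition S2_inner :: "(real^3 \<Rightarrow> real) \<Rightarrow> (real^3 \<Rightarrow> real) \<Rightarrow> real"
  where "S2_inner f g = (LINT p|S2_measure. f p * g p)"

lemma S2_inner_cong:
  assumes "\<And>p. p \<in> S2 \<Longrightarrow> f p = f' p" "\<And>p. p \<in> S2 \<Longrightarrow> g p = g' p"
  shows "S2_inner f g = S2_inner f' g'"
  unfolding S2_inner_def using assms by (intro Bochner_Integration.integral_cong) auto

lemma S2_inner_commute: "S2_inner f g = S2_inner g f"
  by (simp add: S2_inner_def mult.commute)

lemma S2_inner_self_nonneg: "S2_inner f f \<ge> 0"
  by (simp add: S2_inner_def)

lemma L2_norm_S2_square: "(L2_norm_S2 f)\<^sup>2 = S2_inner f f"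
  using S2_inner_self_nonneg[of f] by (simp add: L2_norm_S2_def S2_inner_def power2_eq_square)

lemma L2_norm_S2_eq: "L2_norm_S2 f = sqrt (S2_inner f f)"
  by (simp add: L2_norm_S2_def S2_inner_def power2_eq_square)

lemma square_integrable_continuous:
  assumes "continuous_on S2 f"
  shows "square_integrable_S2 f"
  using assms unfolding square_integrable_S2_def
  by (intro conjI continuous_measurable_S2 continuous_integrable_S2 continuous_intros)

lemma square_integrable_polynomial: "real_polynomial_function q \<Longrightarrow> square_integrable_S2 q"
  by (intro square_integrable_continuous polynomial_continuous_on)

lemma square_integrable_form: "form d q \<Longrightarrow> square_integrable_S2 q"
  by (intro square_integrable_polynomial form_polynomial)

lemma square_integrable_cong:
  assumes "\<And>p. p \<in> S2 \<Longrightarrow> f p = g p" and "square_integrable_S2 f"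
  shows "square_integrable_S2 g"
proof -
  have "f \<in> borel_measurable S2_measure \<longleftrightarrow> g \<in> borel_measurable S2_measure"
    using assms(1) by (intro measurable_cong) simp
  moreover have "integrable S2_measure (\<lambda>p. (f p)\<^sup>2) \<longleftrightarrow> integrable S2_measure (\<lambda>p. (g p)\<^sup>2)"
    using assms(1) by (intro Bochner_Integration.integrable_cong) simp_all
  ultimately show ?thesis using assms(2) by (simp add: square_integrable_S2_def)
qed

lemma square_integrable_mult:
  assumes "square_integrable_S2 f" "square_integrable_S2 g"
  shows "integrable S2_measure (\<lambda>p. f p * g p)"
proof (rule Bochner_Integration.integrable_bound)
  show "integrable S2_measure (\<lambda>p. (f p)\<^sup>2 + (g p)\<^sup>2)"
    using assms by (simp add: square_integrable_S2_def)
  show "(\<lambda>p. f p * g p) \<in> borel_measurable S2_measure"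
    using assms unfolding square_integrable_S2_def by (intro borel_measurable_times) blast+
  have "\<bar>x * y\<bar> \<le> x\<^sup>2 + y\<^sup>2" for x y :: real
  proof -
    have "0 \<le> (\<bar>x\<bar> - \<bar>y\<bar>)\<^sup>2" by simp
    then have "2 * \<bar>x * y\<bar> \<le> x\<^sup>2 + y\<^sup>2" by (simp add: power2_diff abs_mult)
    then show ?thesis using abs_ge_zero[of "x * y"] by linarith
  qed
  then show "AE p in S2_measure. norm (f p * g p) \<le> norm ((f p)\<^sup>2 + (g p)\<^sup>2)" by simp
qed

lemma square_integrable_cmult:
  "square_integrable_S2 f \<Longrightarrow> square_integrable_S2 (\<lambda>p. c * f p)"
  unfolding square_integrable_S2_def power_mult_distrib
  by (intro conjI borel_measurable_times borel_measurable_const Bochner_Integration.integrable_mult_right) blast+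

lemma square_integrable_add:
  assumes "square_integrable_S2 f" "square_integrable_S2 g"
  shows "square_integrable_S2 (\<lambda>p. f p + g p)"
proof -
  have "(\<lambda>p. (f p + g p)\<^sup>2) = (\<lambda>p. (f p)\<^sup>2 + 2 * (f p * g p) + (g p)\<^sup>2)"
    by (simp add: power2_sum fun_eq_iff)
  moreover have "integrable S2_measure (\<lambda>p. (f p)\<^sup>2 + 2 * (f p * g p) + (g p)\<^sup>2)"
    using assms square_integrable_mult[OF assms]
    by (intro Bochner_Integration.integrable_add Bochner_Integration.integrable_mult_right)
      (simp_all add: square_integrable_S2_def)
  moreover have "(\<lambda>p. f p + g p) \<in> borel_measurable S2_measure"
    using assms unfolding square_integrable_S2_def by (intro borel_measurable_add) blast+
  ultimately show ?thesis
    by (simp only: square_integrable_S2_def)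
qed

lemma square_integrable_diff:
  assumes "square_integrable_S2 f" "square_integrable_S2 g"
  shows "square_integrable_S2 (\<lambda>p. f p - g p)"
  using square_integrable_add[OF assms(1) square_integrable_cmult[OF assms(2), of "-1"]] by simp

lemma square_integrable_sum:
  assumes "finite I" "\<And>i. i \<in> I \<Longrightarrow> square_integrable_S2 (f i)"
  shows "square_integrable_S2 (\<lambda>p. \<Sum>i\<in>I. f i p)"
  using assms
  by (induction I rule: finite_induct)
    (auto intro: square_integrable_add square_integrable_continuous)

lemma S2_inner_add:
  assumes "square_integrable_S2 f" "square_integrable_S2 g" "square_integrable_S2 h"
  shows "S2_inner (\<lambda>p. f p + g p) h = S2_inner f h + S2_inner g h"
    and "S2_inner h (\<lambda>p. f p + g p) = S2_inner h f + S2_inner h g"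
  using assms by (simp_all add: S2_inner_def distrib_left distrib_right square_integrable_mult)

lemma S2_inner_diff:
  assumes "square_integrable_S2 f" "square_integrable_S2 g" "square_integrable_S2 h"
  shows "S2_inner (\<lambda>p. f p - g p) h = S2_inner f h - S2_inner g h"
    and "S2_inner h (\<lambda>p. f p - g p) = S2_inner h f - S2_inner h g"
  using assms by (simp_all add: S2_inner_def left_diff_distrib right_diff_distrib square_integrable_mult)

lemma S2_inner_cmult:
  "S2_inner (\<lambda>p. c * f p) h = c * S2_inner f h" "S2_inner h (\<lambda>p. c * f p) = c * S2_inner h f"
  by (simp_all add: S2_inner_def mult.left_commute mult.assoc)

lemma S2_inner_sum:
  assumes "finite I" "\<And>i. i \<in> I \<Longrightarrow> square_integrable_S2 (f i)" "square_integrable_S2 h"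
  shows "S2_inner (\<lambda>p. \<Sum>i\<in>I. f i p) h = (\<Sum>i\<in>I. S2_inner (f i) h)"
    and "S2_inner h (\<lambda>p. \<Sum>i\<in>I. f i p) = (\<Sum>i\<in>I. S2_inner h (f i))"
  using assms by (simp_all add: S2_inner_def sum_distrib_left sum_distrib_right square_integrable_mult)

lemma S2_inner_self_add_le:
  assumes "square_integrable_S2 f" "square_integrable_S2 g"
  shows "S2_inner (\<lambda>p. f p + g p) (\<lambda>p. f p + g p) \<le> 2 * S2_inner f f + 2 * S2_inner g g"
proof -
  have "0 \<le> S2_inner (\<lambda>p. f p - g p) (\<lambda>p. f p - g p)" by (rule S2_inner_self_nonneg)
  then show ?thesis
    using assms by (simp add: S2_inner_add S2_inner_diff square_integrable_add square_integrable_diff S2_inner_commute[of g f])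
qed

text \<open>Functions of norm zero vanish almost everywhere.\<close>
lemma S2_inner_eq_0_of_null:
  assumes "square_integrable_S2 f" "square_integrable_S2 g" "S2_inner g g = 0"
  shows "S2_inner f g = 0"
proof -
  have "integrable S2_measure (\<lambda>p. g p * g p)" using square_integrable_mult assms(2) by blast
  then have "AE p in S2_measure. g p * g p = 0"
    using assms(3) by (subst integral_nonneg_eq_0_iff_AE[symmetric]) (simp_all add: S2_inner_def)
  then have "AE p in S2_measure. f p * g p = 0" by eventually_elim simp
  then show ?thesis
    unfolding S2_inner_def by (rule integral_eq_zero_AE)
qed

text \<open>
  Gram-Schmidt step: the new function is first made orthogonal to the old ones.  If
  nothing of positive norm is left, it imposes no new condition.
\<close>
lemma orthogonal_projection_exists:
  assumes "finite I" and r: "\<And>i. i \<in> I \<Longrightarrow> square_integrable_S2 (r i)" and "square_integrable_S2 f"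
  shows "\<exists>a. \<forall>j\<in>I. S2_inner (\<lambda>p. f p - (\<Sum>i\<in>I. a i * r i p)) (r j) = 0"
  using assms
proof (induction I arbitrary: f rule: finite_induct)
  case empty
  show ?case by simp
next
  case (insert k I)
  have rI: "square_integrable_S2 (\<lambda>p. \<Sum>i\<in>I. a i * r i p)" for a
    using insert.hyps insert.prems by (intro square_integrable_sum square_integrable_cmult) auto
  have rk: "square_integrable_S2 (r k)" using insert.prems by simp
  obtain a where a: "\<And>j. j \<in> I \<Longrightarrow> S2_inner (\<lambda>p. f p - (\<Sum>i\<in>I. a i * r i p)) (r j) = 0"
    using insert.IH[of f] insert.prems by auto
  obtain b where b: "\<And>j. j \<in> I \<Longrightarrow> S2_inner (\<lambda>p. r k p - (\<Sum>i\<in>I. b i * r i p)) (r j) = 0"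
    using insert.IH[of "r k"] insert.prems by auto
  define w where "w = (\<lambda>p. f p - (\<Sum>i\<in>I. a i * r i p))"
  define s where "s = (\<lambda>p. r k p - (\<Sum>i\<in>I. b i * r i p))"
  have w: "square_integrable_S2 w" and s: "square_integrable_S2 s"
    unfolding w_def s_def by (intro square_integrable_diff rI rk insert.prems)+
  define c where "c = S2_inner w s / S2_inner s s"
  define a' where "a' = (\<lambda>i. if i = k then c else a i - c * b i)"
  have "(\<Sum>i\<in>insert k I. a' i * r i p) = c * r k p + (\<Sum>i\<in>I. a i * r i p) - c * (\<Sum>i\<in>I. b i * r i p)" for p
  proof -
    have "(\<Sum>i\<in>I. a' i * r i p) = (\<Sum>i\<in>I. a i * r i p - c * (b i * r i p))"
      using insert.hyps by (intro sum.cong) (auto simp: a'_def algebra_simps)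
    then show ?thesis
      using insert.hyps by (simp add: a'_def sum_subtractf sum_distrib_left)
  qed
  then have eq: "(\<lambda>p. f p - (\<Sum>i\<in>insert k I. a' i * r i p)) = (\<lambda>p. w p - c * s p)"
    by (simp add: w_def s_def fun_eq_iff algebra_simps)
  have ws: "square_integrable_S2 (\<lambda>p. w p - c * s p)"
    by (intro square_integrable_diff square_integrable_cmult w s)
  have I: "S2_inner (\<lambda>p. w p - c * s p) (r j) = 0" if "j \<in> I" for j
    using a[OF that] b[OF that] insert.prems that w s
    by (simp add: S2_inner_diff square_integrable_cmult S2_inner_cmult flip: w_def s_def)
  have "S2_inner w s - c * S2_inner s s = 0"
    using S2_inner_eq_0_of_null[OF w s] by (cases "S2_inner s s = 0") (auto simp: c_def)
  then have "S2_inner (\<lambda>p. w p - c * s p) s = 0"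
    by (simp add: S2_inner_diff square_integrable_cmult S2_inner_cmult w s)
  moreover have "r k = (\<lambda>p. s p + (\<Sum>i\<in>I. b i * r i p))"
    by (simp add: s_def fun_eq_iff)
  then have "S2_inner (\<lambda>p. w p - c * s p) (r k)
      = S2_inner (\<lambda>p. w p - c * s p) s + (\<Sum>i\<in>I. b i * S2_inner (\<lambda>p. w p - c * s p) (r i))"
    using S2_inner_add(2)[OF s rI ws] insert.hyps insert.prems ws
    by (simp add: S2_inner_sum square_integrable_cmult S2_inner_cmult)
  ultimately have "S2_inner (\<lambda>p. w p - c * s p) (r k) = 0" using I by simp
  with I show ?case unfolding eq[symmetric] by blast
qed

section \<open>Density of polynomials\<close>

definition polynomially_approximable :: "(real^3 \<Rightarrow> real) \<Rightarrow> bool"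
  where "polynomially_approximable f \<longleftrightarrow> square_integrable_S2 f \<and>
    (\<forall>e>0. \<exists>q. real_polynomial_function q \<and> S2_inner (\<lambda>p. f p - q p) (\<lambda>p. f p - q p) < e)"

lemma polynomially_approximable_limit:
  assumes f: "square_integrable_S2 f"
    and g: "\<And>e. e > 0 \<Longrightarrow> \<exists>g. polynomially_approximable g \<and> S2_inner (\<lambda>p. f p - g p) (\<lambda>p. f p - g p) < e"
  shows "polynomially_approximable f"
  unfolding polynomially_approximable_def
proof (intro conjI allI impI f)
  fix e :: real assume e: "e > 0"
  then obtain g where g: "polynomially_approximable g" "S2_inner (\<lambda>p. f p - g p) (\<lambda>p. f p - g p) < e / 4"
    using g[of "e / 4"] by auto
  obtain q where q: "real_polynomial_function q" "S2_inner (\<lambda>p. g p - q p) (\<lambda>p. g p - q p) < e / 4"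
    using g(1) e unfolding polynomially_approximable_def by (meson divide_pos_pos zero_less_numeral)
  have "S2_inner (\<lambda>p. (f p - g p) + (g p - q p)) (\<lambda>p. (f p - g p) + (g p - q p)) < e"
    using S2_inner_self_add_le[of "\<lambda>p. f p - g p" "\<lambda>p. g p - q p"] f g q
    by (auto simp: polynomially_approximable_def square_integrable_diff square_integrable_polynomial)
  with q(1) show "\<exists>q. real_polynomial_function q \<and> S2_inner (\<lambda>p. f p - q p) (\<lambda>p. f p - q p) < e" by auto
qed

lemma polynomially_approximable_add:
  assumes f: "polynomially_approximable f" and g: "polynomially_approximable g"
  shows "polynomially_approximable (\<lambda>p. f p + g p)"
  unfolding polynomially_approximable_def
proof (intro conjI allI impI)
  show "square_integrable_S2 (\<lambda>p. f p + g p)"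
    using f g by (simp add: polynomially_approximable_def square_integrable_add)
  fix e :: real assume "e > 0"
  then have "e / 4 > 0" by simp
  then obtain q where q: "real_polynomial_function q" "S2_inner (\<lambda>p. f p - q p) (\<lambda>p. f p - q p) < e / 4"
    using f unfolding polynomially_approximable_def by blast
  obtain r where r: "real_polynomial_function r" "S2_inner (\<lambda>p. g p - r p) (\<lambda>p. g p - r p) < e / 4"
    using g \<open>e / 4 > 0\<close> unfolding polynomially_approximable_def by blast
  note qr = q r
  have "S2_inner (\<lambda>p. (f p - q p) + (g p - r p)) (\<lambda>p. (f p - q p) + (g p - r p)) < e"
    using S2_inner_self_add_le[of "\<lambda>p. f p - q p" "\<lambda>p. g p - r p"] f g qr
    by (auto simp: polynomially_approximable_def square_integrable_diff square_integrable_polynomial)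
  moreover have "(\<lambda>p. (f p - q p) + (g p - r p)) = (\<lambda>p. f p + g p - (q p + r p))" by auto
  ultimately show "\<exists>q. real_polynomial_function q \<and> S2_inner (\<lambda>p. f p + g p - q p) (\<lambda>p. f p + g p - q p) < e"
    using polynomial_add[OF qr(1,3)] by (intro exI[of _ "\<lambda>p. q p + r p"]) simp
qed

lemma polynomially_approximable_cmult:
  assumes f: "polynomially_approximable f"
  shows "polynomially_approximable (\<lambda>p. c * f p)"
  unfolding polynomially_approximable_def
proof (intro conjI allI impI)
  show "square_integrable_S2 (\<lambda>p. c * f p)"
    using f by (simp add: polynomially_approximable_def square_integrable_cmult)
  fix e :: real assume "e > 0"
  have pos: "c\<^sup>2 + 1 > 0" using zero_le_power2[of c] by linarith
  with \<open>e > 0\<close> have "e / (c\<^sup>2 + 1) > 0" by simp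
  then obtain q where q: "real_polynomial_function q" "S2_inner (\<lambda>p. f p - q p) (\<lambda>p. f p - q p) < e / (c\<^sup>2 + 1)"
    using f unfolding polynomially_approximable_def by blast
  have "S2_inner (\<lambda>p. c * f p - c * q p) (\<lambda>p. c * f p - c * q p) = c\<^sup>2 * S2_inner (\<lambda>p. f p - q p) (\<lambda>p. f p - q p)"
    by (simp only: right_diff_distrib[symmetric] S2_inner_cmult) (simp add: power2_eq_square)
  also have "\<dots> \<le> (c\<^sup>2 + 1) * S2_inner (\<lambda>p. f p - q p) (\<lambda>p. f p - q p)"
    by (intro mult_right_mono S2_inner_self_nonneg) simp
  also have "\<dots> < e" using q(2) pos by (simp add: field_simps)
  finally show "\<exists>q. real_polynomial_function q \<and> S2_inner (\<lambda>p. c * f p - q p) (\<lambda>p. c * f p - q p) < e"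
    using polynomial_mult[OF polynomial_const q(1), of c] by blast
qed

lemma polynomially_approximable_continuous:
  assumes f: "continuous_on S2 f"
  shows "polynomially_approximable f"
  unfolding polynomially_approximable_def
proof (intro conjI allI impI square_integrable_continuous f)
  fix e :: real assume e: "e > 0"
  obtain q where q: "real_polynomial_function q" "\<And>p. p \<in> S2 \<Longrightarrow> \<bar>f p - q p\<bar> < sqrt (e / 16)"
    using Stone_Weierstrass_real_polynomial_function[of S2 f "sqrt (e / 16)"] f e by auto
  have cont: "continuous_on S2 (\<lambda>p. f p - q p)"
    by (intro continuous_intros f polynomial_continuous_on q)
  have "S2_inner (\<lambda>p. f p - q p) (\<lambda>p. f p - q p) \<le> (LINT p|S2_measure. e / 16)"
    unfolding S2_inner_def
  proof (rule integral_mono)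
    show "integrable S2_measure (\<lambda>p. (f p - q p) * (f p - q p))"
      by (intro continuous_integrable_S2 continuous_intros cont)
    fix p assume "p \<in> space S2_measure"
    then have "\<bar>f p - q p\<bar> \<le> sqrt (e / 16)" using q(2)[of p] by simp
    then have "\<bar>f p - q p\<bar>\<^sup>2 \<le> (sqrt (e / 16))\<^sup>2" by (intro power_mono) auto
    then show "(f p - q p) * (f p - q p) \<le> e / 16" using e by (simp add: power2_eq_square)
  qed simp
  also have "\<dots> = e / 16 * (4 * pi)"
    using emeasure_S2 by (simp add: measure_def)
  also have "\<dots> < e" using e pi_less_4 by simp
  finally show "\<exists>q. real_polynomial_function q \<and> S2_inner (\<lambda>p. f p - q p) (\<lambda>p. f p - q p) < e"
    using q(1) by blast
qed

lemma polynomially_approximable_sum: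
  assumes "finite I" "\<And>i. i \<in> I \<Longrightarrow> polynomially_approximable (f i)"
  shows "polynomially_approximable (\<lambda>p. \<Sum>i\<in>I. f i p)"
  using assms
  by (induction I rule: finite_induct)
    (auto intro: polynomially_approximable_add polynomially_approximable_continuous)

text \<open>
  By regularity, a Borel set and its complement contain compact sets that leave out only little of the
  sphere.  A Urysohn function for the two compact sets is then close to the indicator.
\<close>
lemma polynomially_approximable_indicator:
  assumes A: "A \<in> sets S2_measure"
  shows "polynomially_approximable (indicator A)"
proof (rule polynomially_approximable_limit)
  show "square_integrable_S2 (indicator A)"
  proof -
    have "(\<lambda>p. (indicator A p :: real)\<^sup>2) = indicator A" by (auto simp: indicator_def)
    then show ?thesis using A by (simp add: square_integrable_S2_def less_top[symmetric])
  qed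
  fix e :: real assume e: "e > 0"
  define \<mu> where "\<mu> = distr S2_measure borel (\<lambda>p. p)"
  have id: "(\<lambda>p. p) \<in> measurable S2_measure borel"
    using measurable_restrict_space1[of "\<lambda>p. p" "borel :: (real^3) measure" borel S2]
    by (simp add: measurable_cong_sets[OF sets_S2_measure refl])
  interpret \<mu>: finite_measure \<mu>
    unfolding \<mu>_def by (rule S2.finite_measure_distr[OF id])
  have \<mu>: "emeasure \<mu> B = emeasure S2_measure (B \<inter> S2)" if "B \<in> sets borel" for B
    using that by (simp add: \<mu>_def emeasure_distr[OF id])
  have inner: "\<exists>K. K \<subseteq> B \<and> compact K \<and> measure \<mu> B - measure \<mu> K < e / 2" if B: "B \<in> sets borel" for B
  proof (cases "measure \<mu> B < e / 2")
    case True
    then show ?thesis by (intro exI[of _ "{}"]) simp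
  next
    case False
    have "ennreal (measure \<mu> B - e / 2) < emeasure \<mu> B"
      using e False by (simp add: \<mu>.emeasure_eq_measure ennreal_less_iff)
    also have "\<dots> = (SUP K\<in>{K. K \<subseteq> B \<and> compact K}. emeasure \<mu> K)"
      by (rule inner_regular[OF _ _ B]) (simp_all add: \<mu>_def emeasure_distr[OF id] emeasure_S2)
    finally obtain K where "K \<subseteq> B" "compact K" "ennreal (measure \<mu> B - e / 2) < emeasure \<mu> K"
      by (auto simp: less_SUP_iff)
    with False show ?thesis
      by (intro exI[of _ K]) (simp add: \<mu>.emeasure_eq_measure ennreal_less_iff)
  qed
  have A': "A \<in> sets borel" "A \<subseteq> S2" using A by (auto simp: sets_restrict_space_iff)
  obtain K where K: "K \<subseteq> A" "compact K" "measure \<mu> A - measure \<mu> K < e / 2" using inner[OF A'(1)] by blast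
  obtain K' where K': "K' \<subseteq> - A" "compact K'" "measure \<mu> (- A) - measure \<mu> K' < e / 2"
    using inner[of "- A"] A' by (auto simp: borel_comp)
  have Kb: "K \<in> sets borel" "K' \<in> sets borel" using K K' by (auto intro: borel_compact)
  obtain g :: "real^3 \<Rightarrow> real" where g: "continuous_on UNIV g" "\<And>p. g p \<in> closed_segment 1 0"
    "\<And>p. p \<in> K \<Longrightarrow> g p = 1" "\<And>p. p \<in> K' \<Longrightarrow> g p = 0"
    using Urysohn[of K K' "1::real" 0] K K' compact_imp_closed by blast
  have gS: "continuous_on S2 g" using g(1) continuous_on_subset by blast
  let ?D = "(- K - K') \<inter> S2"
  have D: "?D \<in> sets S2_measure"
    using Kb by (simp add: sets_restrict_space_iff sets.Diff borel_comp)
  have D_less: "measure S2_measure ?D < e"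
  proof -
    have "measure \<mu> UNIV = measure \<mu> A + measure \<mu> (- A)"
      using \<mu>.finite_measure_Union[of A "- A"] A' by (simp add: \<mu>_def borel_comp)
    moreover have "measure \<mu> UNIV = measure \<mu> K + measure \<mu> K' + measure \<mu> (- K - K')"
    proof -
      have "measure \<mu> UNIV = measure \<mu> (K \<union> K') + measure \<mu> (- K - K')"
      proof -
        have "K \<union> K' \<union> (- K - K') = UNIV" "(K \<union> K') \<inter> (- K - K') = {}" by auto
        with \<mu>.finite_measure_Union[of "K \<union> K'" "- K - K'"] show ?thesis
          using Kb by (simp add: \<mu>_def borel_comp sets.Diff)
      qed
      then show ?thesis
        using \<mu>.finite_measure_Union[of K K'] Kb K K' by (auto simp: \<mu>_def)
    qed
    ultimately have "measure \<mu> (- K - K') < e" using K(3) K'(3) by simp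
    moreover have "measure \<mu> (- K - K') = measure S2_measure ?D"
      using \<mu>[of "- K - K'"] Kb by (simp add: measure_def borel_comp sets.Diff)
    ultimately show ?thesis by simp
  qed
  have "S2_inner (\<lambda>p. indicator A p - g p) (\<lambda>p. indicator A p - g p) \<le> (LINT p|S2_measure. indicator ?D p)"
    unfolding S2_inner_def
  proof (rule integral_mono)
    have "square_integrable_S2 (\<lambda>p. indicator A p - g p)"
      using \<open>square_integrable_S2 (indicator A)\<close> square_integrable_continuous[OF gS] by (rule square_integrable_diff)
    then show "integrable S2_measure (\<lambda>p. (indicator A p - g p) * (indicator A p - g p))"
      using square_integrable_mult by blast
    show "integrable S2_measure (indicator ?D :: _ \<Rightarrow> real)"
      using D by (simp add: less_top[symmetric])
    fix p assume "p \<in> space S2_measure"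
    then have p: "p \<in> S2" by simp
    have "0 \<le> g p" "g p \<le> 1" using g(2)[of p] by (auto simp: closed_segment_eq_real_ivl)
    then have "\<bar>indicator A p - g p\<bar> \<le> 1" by (auto simp: indicator_def)
    then have "(indicator A p - g p) * (indicator A p - g p) \<le> 1"
      by (metis abs_le_square_iff abs_one power2_eq_square power_one)
    moreover have "indicator A p - g p = 0" if "p \<notin> ?D"
      using that p g(3,4) K(1) K'(1) by (auto simp: indicator_def)
    ultimately show "(indicator A p - g p) * (indicator A p - g p) \<le> indicator ?D p"
      by (auto simp: indicator_def)
  qed
  also have "\<dots> = measure S2_measure ?D" using D by simp
  also note D_less
  finally show "\<exists>g. polynomially_approximable g \<and>
      S2_inner (\<lambda>p. indicator A p - g p) (\<lambda>p. indicator A p - g p) < e"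
    using polynomially_approximable_continuous[OF gS] by blast
qed

text \<open>
  Simple functions converge to \<open>f\<close> pointwise with absolute values at most \<open>2 \<bar>f\<bar>\<close>, so the squared errors are
  dominated by \<open>9 f\<^sup>2\<close>.
\<close>
lemma square_integrable_polynomially_approximable:
  assumes f: "square_integrable_S2 f"
  shows "polynomially_approximable f"
proof (rule polynomially_approximable_limit[OF f])
  fix e :: real assume e: "e > 0"
  have fm: "f \<in> borel_measurable S2_measure" and f2: "integrable S2_measure (\<lambda>p. (f p)\<^sup>2)"
    using f by (auto simp: square_integrable_S2_def)
  obtain F where F': "\<forall>i. simple_function S2_measure (F i)" "\<forall>p\<in>space S2_measure. (\<lambda>i. F i p) \<longlonglongrightarrow> f p"
    "\<forall>i. \<forall>p\<in>space S2_measure. dist (F i p) 0 \<le> 2 * dist (f p) 0"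
    using borel_measurable_implies_sequence_metric[OF fm, of 0] by blast
  have F: "simple_function S2_measure (F i)" "p \<in> S2 \<Longrightarrow> (\<lambda>i. F i p) \<longlonglongrightarrow> f p"
    "p \<in> S2 \<Longrightarrow> \<bar>F i p\<bar> \<le> 2 * \<bar>f p\<bar>" for i p
    using F' by (simp_all add: dist_real_def)
  have approx: "polynomially_approximable (F i)" for i
  proof -
    have fin: "finite (F i ` S2)" and sets: "\<And>y. F i -` {y} \<inter> S2 \<in> sets S2_measure"
      using simple_functionD[OF F(1)[of i]] by simp_all
    have "polynomially_approximable (\<lambda>p. \<Sum>y\<in>F i ` S2. y * indicator (F i -` {y} \<inter> S2) p)"
      by (intro polynomially_approximable_sum polynomially_approximable_cmult polynomially_approximable_indicator fin sets)
    moreover have "(\<Sum>y\<in>F i ` S2. y * indicator (F i -` {y} \<inter> S2) p) = F i p" if "p \<in> S2" for p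
    proof -
      have "(\<Sum>y\<in>F i ` S2. y * indicator (F i -` {y} \<inter> S2) p) = (\<Sum>y\<in>F i ` S2. if y = F i p then F i p else 0)"
        using that by (intro sum.cong) (auto simp: indicator_def)
      then show ?thesis using that fin by simp
    qed
    ultimately show ?thesis
      unfolding polynomially_approximable_def
      by (smt (verit) S2_inner_cong square_integrable_cong)
  qed
  have "(\<lambda>i. LINT p|S2_measure. (f p - F i p)\<^sup>2) \<longlonglongrightarrow> (LINT p|S2_measure. 0)"
  proof (rule integral_dominated_convergence)
    show "integrable S2_measure (\<lambda>p. 9 * (f p)\<^sup>2)" using f2 by simp
    show "(\<lambda>p. (f p - F i p)\<^sup>2) \<in> borel_measurable S2_measure" for i
      using fm borel_measurable_simple_function[OF F(1)[of i]] by simp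
    show "AE p in S2_measure. (\<lambda>i. (f p - F i p)\<^sup>2) \<longlonglongrightarrow> 0"
    proof (rule AE_I2)
      fix p assume "p \<in> space S2_measure"
      then have "(\<lambda>i. (f p - F i p)\<^sup>2) \<longlonglongrightarrow> (f p - f p)\<^sup>2"
        using F(2) by (intro tendsto_intros) auto
      then show "(\<lambda>i. (f p - F i p)\<^sup>2) \<longlonglongrightarrow> 0" by simp
    qed
    show "AE p in S2_measure. norm ((f p - F i p)\<^sup>2) \<le> 9 * (f p)\<^sup>2" for i
    proof (rule AE_I2)
      fix p assume "p \<in> space S2_measure"
      then have "\<bar>f p - F i p\<bar> \<le> \<bar>3 * f p\<bar>" using F(3)[of p i] by simp
      then have "(f p - F i p)\<^sup>2 \<le> (3 * f p)\<^sup>2" by (simp only: abs_le_square_iff)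
      then show "norm ((f p - F i p)\<^sup>2) \<le> 9 * (f p)\<^sup>2" by (simp add: power_mult_distrib)
    qed
  qed simp
  then have "(\<lambda>i. S2_inner (\<lambda>p. f p - F i p) (\<lambda>p. f p - F i p)) \<longlonglongrightarrow> 0"
    by (simp add: S2_inner_def power2_eq_square)
  then have "\<exists>i. S2_inner (\<lambda>p. f p - F i p) (\<lambda>p. f p - F i p) < e"
    using e by (metis (no_types, lifting) eventually_sequentially order_refl order_tendstoD(2))
  then show "\<exists>g. polynomially_approximable g \<and> S2_inner (\<lambda>p. f p - g p) (\<lambda>p. f p - g p) < e"
    using approx by blast
qed

section \<open>Expansion in spherical harmonics\<close>

definition coordinate_monomial :: "3 list \<Rightarrow> real^3 \<Rightarrow> real"
  where "coordinate_monomial ks p = (\<Prod>k\<leftarrow>ks. p $ k)"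

lemma form_coordinate_monomial: "form (int (length ks)) (coordinate_monomial ks)"
proof (induction ks)
  case Nil
  show ?case using form.const[of 1] by (simp add: coordinate_monomial_def[abs_def])
next
  case (Cons k ks)
  from form_mult[OF form_coordinate[of k] Cons.IH] show ?case
    by (simp add: coordinate_monomial_def[abs_def])
qed

lemma finite_lists_of_length: "finite {ks :: 3 list. length ks = n}"
  using finite_lists_length_eq[of "UNIV :: 3 set" n] by simp

lemma form_eq_sum_of_monomials:
  "form d P \<Longrightarrow> d = int n \<Longrightarrow> \<exists>a. P = (\<lambda>p. \<Sum>ks | length ks = n. a ks * coordinate_monomial ks p)"
proof (induction arbitrary: n rule: form.induct)
  case (const c)
  have "{ks :: 3 list. length ks = 0} = {[]}" by auto
  then show ?case using const by (intro exI[of _ "\<lambda>_. c"]) (simp add: coordinate_monomial_def)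
next
  case (zero d)
  show ?case by (intro exI[of _ "\<lambda>_. 0"]) simp
next
  case (linear d P v)
  show ?case
  proof (cases n)
    case 0
    then have "P = (\<lambda>_. 0)" using linear form_negative by simp
    then show ?thesis by (intro exI[of _ "\<lambda>_. 0"]) simp
  next
    case (Suc m)
    then obtain a where a: "P = (\<lambda>p. \<Sum>ks | length ks = m. a ks * coordinate_monomial ks p)"
      using linear.IH[of m] linear.prems by auto
    let ?a = "\<lambda>ks. v $ hd ks * a (tl ks)"
    have "(v \<bullet> p) * P p = (\<Sum>ks | length ks = n. ?a ks * coordinate_monomial ks p)" for p
    proof -
      have "(v \<bullet> p) * P p = (\<Sum>(k, ks)\<in>UNIV \<times> {ks. length ks = m}. (v $ k * p $ k) * (a ks * coordinate_monomial ks p))"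
        by (simp add: a inner_vec_def sum_product sum.cartesian_product)
      also have "\<dots> = (\<Sum>ks | length ks = n. ?a ks * coordinate_monomial ks p)"
        by (rule sum.reindex_bij_witness[of _ "\<lambda>ks. (hd ks, tl ks)" "\<lambda>(k, ks). k # ks"])
          (auto simp: Suc length_Suc_conv coordinate_monomial_def)
      finally show ?thesis .
    qed
    then show ?thesis by (intro exI[of _ ?a]) auto
  qed
next
  case (add d P Q)
  then obtain a b where "P = (\<lambda>p. \<Sum>ks | length ks = n. a ks * coordinate_monomial ks p)"
    "Q = (\<lambda>p. \<Sum>ks | length ks = n. b ks * coordinate_monomial ks p)" by blast
  then show ?case
    by (intro exI[of _ "\<lambda>ks. a ks + b ks"]) (simp add: distrib_right sum.distrib)
qed

text \<open>On the sphere a form is a sum of harmonic forms whose degrees do not exceed its own.\<close>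
lemma S2_inner_form_eq_0:
  assumes u: "square_integrable_S2 u"
    and harmonic: "\<And>k h. k \<le> n \<Longrightarrow> harmonic_form (int k) h \<Longrightarrow> S2_inner u h = 0"
  shows "form (int k) R \<Longrightarrow> k \<le> n \<Longrightarrow> S2_inner u R = 0"
proof (induction k arbitrary: R rule: less_induct)
  case (less k)
  obtain h R' where R: "harmonic_form (int k) h" "form (int k - 2) R'" "R = (\<lambda>p. h p + (p \<bullet> p) * R' p)"
    using form_harmonic_decomposition[OF less.prems(1)] by blast
  have sq: "square_integrable_S2 h" "square_integrable_S2 R'"
    using R by (auto simp: harmonic_form_def intro: square_integrable_form)
  have "S2_inner u R = S2_inner u (\<lambda>p. h p + R' p)"
    by (rule S2_inner_cong) (auto simp: R(3) dot_square_norm)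
  also have "\<dots> = S2_inner u h + S2_inner u R'"
    using u sq by (simp add: S2_inner_add)
  also have "S2_inner u R' = 0"
  proof (cases "k < 2")
    case True
    then have "R' = (\<lambda>_. 0)" using form_negative[OF R(2)] by simp
    then show ?thesis by (simp add: S2_inner_def)
  next
    case False
    then show ?thesis
      using less.IH[of "k - 2" R'] less.prems R(2) by (simp add: of_nat_diff)
  qed
  finally show ?case using harmonic[OF less.prems(2) R(1)] by simp
qed

lemma harmonic_form_orthogonal_lower_form:
  assumes g: "harmonic_form (int n) g" and R: "form (int k) R" "k < n"
  shows "S2_inner g R = 0"
proof (rule S2_inner_form_eq_0[OF _ _ R(1) order_refl])
  show "square_integrable_S2 g"
    using g by (auto simp: harmonic_form_def intro: square_integrable_form)
  show "S2_inner g h = 0" if "j \<le> k" "harmonic_form (int j) h" for j h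
    using harmonic_forms_orthogonal[OF g that(2)] that(1) R(2) by (simp add: S2_inner_def)
qed

text \<open>
  The projection to all forms of degree \<open>n\<close> differs from its harmonic component by \<open>\<bar>p\<bar>\<^sup>2\<close> times a form of lower
  degree, which on the sphere is orthogonal to the harmonic forms of degree \<open>n\<close>.
\<close>
lemma harmonic_projection_exists:
  assumes f: "square_integrable_S2 f"
  shows "\<exists>g. harmonic_form (int n) g \<and> (\<forall>h. harmonic_form (int n) h \<longrightarrow> S2_inner f h = S2_inner g h)"
proof -
  let ?I = "{ks :: 3 list. length ks = n}"
  have sq: "square_integrable_S2 (coordinate_monomial ks)" for ks
    by (rule square_integrable_form[OF form_coordinate_monomial])
  obtain a where a: "\<And>ks. ks \<in> ?I \<Longrightarrow>
      S2_inner (\<lambda>p. f p - (\<Sum>ks\<in>?I. a ks * coordinate_monomial ks p)) (coordinate_monomial ks) = 0"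
    using orthogonal_projection_exists[of ?I coordinate_monomial f, OF finite_lists_of_length sq f] by blast
  define q where "q = (\<lambda>p. \<Sum>ks\<in>?I. a ks * coordinate_monomial ks p)"
  have q: "form (int n) q"
    unfolding q_def using form_coordinate_monomial finite_lists_of_length
    by (intro form_sum form_cmult) auto
  have fq: "square_integrable_S2 (\<lambda>p. f p - q p)"
    by (intro square_integrable_diff f square_integrable_form[OF q])
  obtain g R where g: "harmonic_form (int n) g" "form (int n - 2) R" "q = (\<lambda>p. g p + (p \<bullet> p) * R p)"
    using form_harmonic_decomposition[OF q] by blast
  have "S2_inner f h = S2_inner g h" if h: "harmonic_form (int n) h" for h
  proof -
    have sqs: "square_integrable_S2 q" "square_integrable_S2 g" "square_integrable_S2 R" "square_integrable_S2 h"
      using q g h by (auto simp: harmonic_form_def intro: square_integrable_form)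
    obtain b where b: "h = (\<lambda>p. \<Sum>ks\<in>?I. b ks * coordinate_monomial ks p)"
      using form_eq_sum_of_monomials[of "int n" h n] h by (auto simp: harmonic_form_def)
    have "S2_inner (\<lambda>p. f p - q p) h = (\<Sum>ks\<in>?I. b ks * S2_inner (\<lambda>p. f p - q p) (coordinate_monomial ks))"
      unfolding b using finite_lists_of_length fq sq
      by (simp add: S2_inner_sum square_integrable_cmult S2_inner_cmult)
    also have "\<dots> = 0" using a by (simp add: q_def)
    finally have "S2_inner f h = S2_inner q h" using f sqs by (simp add: S2_inner_diff)
    also have "\<dots> = S2_inner (\<lambda>p. g p + R p) h"
      by (rule S2_inner_cong) (auto simp: g(3) dot_square_norm)
    also have "\<dots> = S2_inner g h + S2_inner R h" using sqs by (simp add: S2_inner_add)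
    also have "S2_inner R h = 0"
    proof (cases "n < 2")
      case True
      then have "R = (\<lambda>_. 0)" using form_negative[OF g(2)] by simp
      then show ?thesis by (simp add: S2_inner_def)
    next
      case False
      then show ?thesis
        using harmonic_form_orthogonal_lower_form[OF h, of "n - 2" R] g(2)
        by (simp add: of_nat_diff S2_inner_commute)
    qed
    finally show ?thesis by simp
  qed
  with g(1) show ?thesis by blast
qed

text \<open>
  The partial sums of the projections are the best approximations by polynomials of bounded degree, so
  they converge because polynomials are dense.
\<close>
lemma harmonic_expansion_exists:
  assumes f: "square_integrable_S2 f"
  shows "\<exists>g. (\<forall>d. harmonic_form (int d) (g d)) \<and> (\<lambda>N. L2_norm_S2 (\<lambda>p. f p - (\<Sum>d\<le>N. g d p))) \<longlonglongrightarrow> 0"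
proof -
  have "\<forall>d. \<exists>g. harmonic_form (int d) g \<and> (\<forall>h. harmonic_form (int d) h \<longrightarrow> S2_inner f h = S2_inner g h)"
    using harmonic_projection_exists[OF f] by blast
  then obtain g where g: "\<And>d. harmonic_form (int d) (g d)"
    "\<And>d h. harmonic_form (int d) h \<Longrightarrow> S2_inner f h = S2_inner (g d) h" by metis
  have sqg: "square_integrable_S2 (g d)" for d
    using g(1)[of d] by (auto simp: harmonic_form_def intro: square_integrable_form)
  define r where "r = (\<lambda>N p. f p - (\<Sum>d\<le>N. g d p))"
  have sqS: "square_integrable_S2 (\<lambda>p. \<Sum>d\<le>N. g d p)" for N
    by (intro square_integrable_sum sqg) simp
  have sqr: "square_integrable_S2 (r N)" for N
    unfolding r_def by (intro square_integrable_diff f sqS)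
  have orth_harmonic: "S2_inner (r N) h = 0" if h: "harmonic_form (int e) h" and e: "e \<le> N" for e h N
  proof -
    have sqh: "square_integrable_S2 h" using h by (auto simp: harmonic_form_def intro: square_integrable_form)
    have "S2_inner (r N) h = S2_inner f h - (\<Sum>d\<le>N. S2_inner (g d) h)"
      unfolding r_def using f sqg sqS sqh by (simp add: S2_inner_diff S2_inner_sum)
    also have "(\<Sum>d\<le>N. S2_inner (g d) h) = (\<Sum>d\<le>N. if d = e then S2_inner (g e) h else 0)"
      using harmonic_forms_orthogonal[OF g(1) h] by (intro sum.cong) (auto simp: S2_inner_def)
    also have "\<dots> = S2_inner f h" using e g(2)[OF h] by simp
    finally show ?thesis by simp
  qed
  have orth_form: "S2_inner (r N) R = 0" if "form (int e) R" "e \<le> N" for e R N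
    by (rule S2_inner_form_eq_0[OF sqr _ that]) (rule orth_harmonic)
  have best: "S2_inner (r N) (r N) \<le> S2_inner (\<lambda>p. f p - q p) (\<lambda>p. f p - q p)"
    if q: "\<And>k. form (int k) (F k)" "q = (\<lambda>p. \<Sum>k\<le>n. F k p)" and N: "N \<ge> n" for q F n N
  proof -
    define s where "s = (\<lambda>p. (\<Sum>d\<le>N. g d p) - q p)"
    have sqF: "square_integrable_S2 (F k)" for k using square_integrable_form[OF q(1)] .
    have sqq: "square_integrable_S2 q" unfolding q(2) by (intro square_integrable_sum sqF) simp
    have sqs: "square_integrable_S2 s" unfolding s_def by (intro square_integrable_diff sqS sqq)
    have "S2_inner (r N) q = 0"
      unfolding q(2) using sqr sqF orth_form[OF q(1)] N by (simp add: S2_inner_sum)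
    moreover have "S2_inner (r N) (\<lambda>p. \<Sum>d\<le>N. g d p) = 0"
      using sqr sqg orth_harmonic[OF g(1)] by (simp add: S2_inner_sum)
    ultimately have 0: "S2_inner (r N) s = 0"
      unfolding s_def using sqr sqS sqq by (simp add: S2_inner_diff)
    have "(\<lambda>p. f p - q p) = (\<lambda>p. r N p + s p)" by (simp add: r_def s_def fun_eq_iff)
    then have "S2_inner (\<lambda>p. f p - q p) (\<lambda>p. f p - q p) = S2_inner (r N) (r N) + S2_inner s s"
      using sqr sqs 0 by (simp add: S2_inner_add square_integrable_add S2_inner_commute[of s "r N"])
    then show ?thesis using S2_inner_self_nonneg[of s] by simp
  qed
  have "(\<lambda>N. S2_inner (r N) (r N)) \<longlonglongrightarrow> 0"
  proof (rule LIMSEQ_I)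
    fix e :: real assume e: "e > 0"
    then obtain q where q: "real_polynomial_function q" "S2_inner (\<lambda>p. f p - q p) (\<lambda>p. f p - q p) < e"
      using square_integrable_polynomially_approximable[OF f] by (auto simp: polynomially_approximable_def)
    obtain n F where F: "\<forall>k. form (int k) (F k)" "q = (\<lambda>p. \<Sum>k\<le>n. F k p)"
      using polynomial_sum_of_forms[OF q(1)] by blast
    have "norm (S2_inner (r N) (r N) - 0) < e" if "N \<ge> n" for N
      using best[OF F(1)[rule_format] F(2) that] q(2) S2_inner_self_nonneg[of "r N"] by simp
    then show "\<exists>n. \<forall>N\<ge>n. norm (S2_inner (r N) (r N) - 0) < e" by blast
  qed
  then have "(\<lambda>N. L2_norm_S2 (r N)) \<longlonglongrightarrow> 0"
    unfolding L2_norm_S2_eq using tendsto_real_sqrt by fastforce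
  with g(1) show ?thesis unfolding r_def by blast
qed

section \<open>Multipole representations\<close>

lemma multipole_block_eq: "multipole_block l v d p = (\<Sum>k\<le>d. l d k * linear_product k (v d k) p)"
proof -
  have "{..d} = insert 0 {1..d}" by auto
  then show ?thesis by (simp add: multipole_block_def linear_product_def)
qed

lemma spherical_harmonic_iff:
  "spherical_harmonic d g \<longleftrightarrow> (\<exists>P. harmonic_form (int d) P \<and> (\<forall>p\<in>S2. g p = P p))"
proof
  assume "spherical_harmonic d g"
  then show "\<exists>P. harmonic_form (int d) P \<and> (\<forall>p\<in>S2. g p = P p)"
    unfolding spherical_harmonic_def harmonic_form_def by (blast intro: homogeneous_polynomial_form)
next
  assume "\<exists>P. harmonic_form (int d) P \<and> (\<forall>p\<in>S2. g p = P p)"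
  then obtain P where P: "form (int d) P" "\<forall>p. laplacian P p = 0" "\<forall>p\<in>S2. g p = P p"
    by (auto simp: harmonic_form_def)
  moreover have "\<forall>t p. P (t *\<^sub>R p) = t ^ d * P p" using form_scale[OF P(1)] by simp
  ultimately show "spherical_harmonic d g"
    unfolding spherical_harmonic_def using form_polynomial[OF P(1)] by (intro exI[of _ P] conjI)
qed

lemma multipole_representation_exists:
  assumes "square_integrable_S2 f"
  shows "\<exists>l v. multipole_representation f l v"
proof -
  obtain g where g: "\<And>d. harmonic_form (int d) (g d)" "(\<lambda>N. L2_norm_S2 (\<lambda>p. f p - (\<Sum>d\<le>N. g d p))) \<longlonglongrightarrow> 0"
    using harmonic_expansion_exists[OF assms] by blast
  have "\<exists>l v. \<forall>p\<in>S2. g d p = (\<Sum>k\<le>d. l k * linear_product k (v k) p)" for d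
  proof -
    have "form (int k) (if k = d then g d else (\<lambda>_. 0))" for k
      using g(1)[of d] form.zero by (auto simp: harmonic_form_def)
    from sum_of_forms_eq_sum_of_linear_products[OF this, of d] show ?thesis
      by (simp add: if_distribR cong: if_cong)
  qed
  then obtain l v where lv: "\<And>d p. p \<in> S2 \<Longrightarrow> g d p = (\<Sum>k\<le>d. l d k * linear_product k (v d k) p)"
    by metis
  then have block: "multipole_block l v d p = g d p" if "p \<in> S2" for d p
    using that by (simp add: multipole_block_eq)
  have "L2_norm_S2 (\<lambda>p. f p - (\<Sum>d\<le>N. multipole_block l v d p)) = L2_norm_S2 (\<lambda>p. f p - (\<Sum>d\<le>N. g d p))" for N
    unfolding L2_norm_S2_eq by (intro arg_cong[of _ _ sqrt] S2_inner_cong) (auto simp: block)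
  then have "multipole_representation f l v"
    unfolding multipole_representation_def spherical_harmonic_iff using g block by auto
  then show ?thesis by blast
qed

lemma spherical_harmonics_orthogonal:
  assumes "spherical_harmonic d g" "spherical_harmonic e h" "d \<noteq> e"
  shows "S2_inner g h = 0"
proof -
  obtain P Q where "harmonic_form (int d) P" "\<forall>p\<in>S2. g p = P p" "harmonic_form (int e) Q" "\<forall>p\<in>S2. h p = Q p"
    using assms by (auto simp: spherical_harmonic_iff)
  then show ?thesis
    using harmonic_forms_orthogonal[of d P e Q] assms(3) S2_inner_cong[of g P h Q] by (simp add: S2_inner_def)
qed

lemma spherical_harmonic_continuous: "spherical_harmonic d g \<Longrightarrow> continuous_on S2 g"
proof -
  assume "spherical_harmonic d g"
  then obtain P where P: "form (int d) P" "\<forall>p\<in>S2. g p = P p"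
    by (auto simp: spherical_harmonic_iff harmonic_form_def)
  then show ?thesis
    using continuous_on_eq[OF polynomial_continuous_on[OF form_polynomial[OF P(1)]], of S2 g] by simp
qed

lemma spherical_harmonic_diff:
  assumes "spherical_harmonic d g" "spherical_harmonic d h"
  shows "spherical_harmonic d (\<lambda>p. g p - h p)"
proof -
  obtain P Q where P: "harmonic_form (int d) P" "\<forall>p\<in>S2. g p = P p"
    and Q: "harmonic_form (int d) Q" "\<forall>p\<in>S2. h p = Q p"
    using assms by (auto simp: spherical_harmonic_iff)
  then have "real_polynomial_function P" "real_polynomial_function Q"
    by (auto simp: harmonic_form_def intro: form_polynomial)
  with P(1) Q(1) have "harmonic_form (int d) (\<lambda>p. P p - Q p)"
    by (simp add: harmonic_form_def form_diff laplacian_diff)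
  with P(2) Q(2) show ?thesis unfolding spherical_harmonic_iff by auto
qed

text \<open>
  The differences of corresponding blocks are again spherical harmonics, and their partial sums tend
  to zero in norm.  By orthogonality the squared norm of such a partial sum is at least that
  of each summand, so every summand has norm zero.
\<close>
lemma multipole_blocks_unique:
  assumes f: "square_integrable_S2 f"
    and rep: "multipole_representation f l v" "multipole_representation f l' v'" and p: "p \<in> S2"
  shows "multipole_block l v d p = multipole_block l' v' d p"
proof -
  let ?B = "multipole_block l v" and ?B' = "multipole_block l' v'"
  define D where "D = (\<lambda>d p. ?B d p - ?B' d p)"
  have sh: "spherical_harmonic d (?B d)" "spherical_harmonic d (?B' d)" for d
    using rep by (auto simp: multipole_representation_def)
  have D: "spherical_harmonic d (D d)" for d
    unfolding D_def by (rule spherical_harmonic_diff[OF sh])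
  have sq: "square_integrable_S2 (D d)" "square_integrable_S2 (?B d)" "square_integrable_S2 (?B' d)" for d
    by (intro square_integrable_continuous spherical_harmonic_continuous[OF D]
        spherical_harmonic_continuous[OF sh(1)] spherical_harmonic_continuous[OF sh(2)])+
  define r where "r = (\<lambda>N p. f p - (\<Sum>d\<le>N. ?B d p))"
  define r' where "r' = (\<lambda>N p. f p - (\<Sum>d\<le>N. ?B' d p))"
  have sqr: "square_integrable_S2 (r N)" "square_integrable_S2 (r' N)" for N
    unfolding r_def r'_def by (intro square_integrable_diff square_integrable_sum f sq; simp)+
  have "S2_inner (D d) (D d) \<le> 2 * S2_inner (r' N) (r' N) + 2 * S2_inner (r N) (r N)" if "d \<le> N" for N
  proof -
    have "S2_inner (\<lambda>p. \<Sum>d\<le>N. D d p) (\<lambda>p. \<Sum>d\<le>N. D d p) = (\<Sum>d\<le>N. \<Sum>e\<le>N. S2_inner (D d) (D e))"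
      using sq by (simp add: S2_inner_sum square_integrable_sum)
    also have "\<dots> = (\<Sum>d\<le>N. S2_inner (D d) (D d))"
    proof (rule sum.cong[OF refl])
      fix d assume d: "d \<in> {..N}"
      have "(\<Sum>e\<le>N. S2_inner (D d) (D e)) = (\<Sum>e\<le>N. if e = d then S2_inner (D d) (D d) else 0)"
        using spherical_harmonics_orthogonal[OF D D] by (intro sum.cong) auto
      then show "(\<Sum>e\<le>N. S2_inner (D d) (D e)) = S2_inner (D d) (D d)" using d by simp
    qed
    finally have "S2_inner (D d) (D d) \<le> S2_inner (\<lambda>p. \<Sum>d\<le>N. D d p) (\<lambda>p. \<Sum>d\<le>N. D d p)"
      using member_le_sum[of d "{..N}" "\<lambda>d. S2_inner (D d) (D d)"] that S2_inner_self_nonneg by simp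
    also have "(\<lambda>p. \<Sum>d\<le>N. D d p) = (\<lambda>p. r' N p + (- 1) * r N p)"
      by (simp add: D_def r_def r'_def sum_subtractf fun_eq_iff)
    also have "S2_inner \<dots> \<dots> \<le> 2 * S2_inner (r' N) (r' N) + 2 * S2_inner (\<lambda>p. (- 1) * r N p) (\<lambda>p. (- 1) * r N p)"
      by (intro S2_inner_self_add_le square_integrable_cmult sqr)
    also have "S2_inner (\<lambda>p. (- 1) * r N p) (\<lambda>p. (- 1) * r N p) = S2_inner (r N) (r N)"
      by (simp add: S2_inner_def)
    finally show ?thesis .
  qed
  moreover have "(\<lambda>N. 2 * (L2_norm_S2 (r' N))\<^sup>2 + 2 * (L2_norm_S2 (r N))\<^sup>2) \<longlonglongrightarrow> 2 * 0\<^sup>2 + 2 * 0\<^sup>2"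
    using rep unfolding multipole_representation_def r_def r'_def by (intro tendsto_intros) blast+
  then have "(\<lambda>N. 2 * S2_inner (r' N) (r' N) + 2 * S2_inner (r N) (r N)) \<longlonglongrightarrow> 0"
    by (simp add: L2_norm_S2_square)
  ultimately have "S2_inner (D d) (D d) \<le> 0"
    by (intro tendsto_lowerbound[of _ 0 sequentially]) (auto simp: eventually_sequentially)
  then have "S2_inner (D d) (D d) = 0"
    using S2_inner_self_nonneg[of "D d"] by simp
  then have "(LINT p|S2_measure. D d p * D d p) = 0"
    by (simp only: S2_inner_def)
  moreover have "continuous_on S2 (\<lambda>p. D d p * D d p)"
    by (intro continuous_intros spherical_harmonic_continuous[OF D])
  ultimately have "D d p * D d p = 0"
    using continuous_nonneg_integral_0_S2[of "\<lambda>p. D d p * D d p" p] p by simp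
  then show ?thesis by (simp add: D_def)
qed

lemma multipole_representation_unique:
  assumes "square_integrable_S2 f" "multipole_representation f l v" "multipole_representation f l' v'" "k \<le> d"
  shows "same_up_to_order_and_scaling k (l d k) (v d k) (l' d k) (v' d k)"
  using multipole_blocks_unique[OF assms(1-3)] assms(4)
  by (intro sum_of_linear_products_unique[where d = d]) (simp_all add: multipole_block_eq)

section \<open>Uniformly convergent series of products\<close>

lemma product_partial_sum_eq: "product_partial_sum l v N p = (\<Sum>d\<le>N. l d * linear_product d (v d) p)"
proof -
  have "{..N} = insert 0 {1..N}" by auto
  then show ?thesis by (simp add: product_partial_sum_def linear_product_def)
qed

lemma polynomial_in_F_S2:
  assumes q: "real_polynomial_function q"
  shows "q \<in> F_S2"
proof -
  obtain n F where F: "\<forall>k. form (int k) (F k)" "q = (\<lambda>p. \<Sum>k\<le>n. F k p)"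
    using polynomial_sum_of_forms[OF q] by blast
  obtain l v where lv: "\<And>p. p \<in> S2 \<Longrightarrow> q p = (\<Sum>k\<le>n. l k * linear_product k (v k) p)"
    using sum_of_forms_eq_sum_of_linear_products[OF F(1)[rule_format], of n] by (auto simp: F(2))
  let ?l = "\<lambda>k. if k \<le> n then l k else 0"
  have "product_partial_sum ?l v N p = q p" if "N \<ge> n" "p \<in> S2" for N p
  proof -
    have "product_partial_sum ?l v N p = (\<Sum>k\<le>n. l k * linear_product k (v k) p)"
      unfolding product_partial_sum_eq using that by (intro sum.mono_neutral_cong_right) auto
    then show ?thesis using lv that by simp
  qed
  then have "\<forall>\<^sub>F N in sequentially. \<forall>p\<in>S2. product_partial_sum ?l v N p = q p"
    unfolding eventually_sequentially by (intro exI[of _ n]) blast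
  then have "product_series_on_S2 q ?l v"
    unfolding product_series_on_S2_def by (auto intro!: uniform_limitI elim: eventually_mono)
  then show ?thesis
    unfolding F_S2_def using polynomial_continuous_on[OF q] by blast
qed

lemma F_S2_dense:
  assumes "continuous_on S2 g" "e > 0"
  shows "\<exists>f\<in>F_S2. \<forall>p\<in>S2. \<bar>f p - g p\<bar> < e"
proof -
  obtain q where "real_polynomial_function q" "\<And>p. p \<in> S2 \<Longrightarrow> \<bar>g p - q p\<bar> < e"
    using Stone_Weierstrass_real_polynomial_function[of S2 g e] assms by auto
  then show ?thesis
    using polynomial_in_F_S2 by (intro bexI[of _ q]) (auto simp: abs_minus_commute)
qed

lemma F_S2_orthogonal_invariant:
  assumes R: "orthogonal_transformation R" and f: "f \<in> F_S2"
  shows "f \<circ> R \<in> F_S2"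
proof -
  have lin: "linear R" and RS2: "R ` S2 \<subseteq> S2"
    using R by (auto simp: orthogonal_transformation_linear orthogonal_transformation_norm)
  obtain l v where cont: "continuous_on S2 f" and lv: "uniform_limit S2 (product_partial_sum l v) f sequentially"
    using f by (auto simp: F_S2_def product_series_on_S2_def)
  have "continuous_on S2 R"
    using lin by (simp add: linear_continuous_on linear_conv_bounded_linear)
  then have "continuous_on S2 (f \<circ> R)"
    using continuous_on_compose continuous_on_subset[OF cont RS2] by blast
  moreover have "product_partial_sum l (\<lambda>d j. adjoint R (v d j)) = (\<lambda>N p. product_partial_sum l v N (R p))"
    by (simp add: product_partial_sum_def linear_product_def adjoint_works[OF lin] inner_commute fun_eq_iff)
  then have "product_series_on_S2 (f \<circ> R) l (\<lambda>d j. adjoint R (v d j))"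
    using uniform_limit_compose'[OF lv, of R S2] RS2 by (auto simp: product_series_on_S2_def o_def)
  ultimately show ?thesis unfolding F_S2_def by blast
qed

section \<open>A Bernstein inequality for forms\<close>

text \<open>
  For \<open>z = exp (i \<theta>)\<close> this is \<open>z (a cos \<theta> + b sin \<theta>)\<close>, so the curve extends the unit circle in the plane of
  \<open>a\<close> and \<open>b\<close>, up to a phase, to a polynomial curve in complex space.
\<close>
definition circle_curve :: "real^3 \<Rightarrow> real^3 \<Rightarrow> complex \<Rightarrow> complex^3"
  where "circle_curve a b z = (\<chi> k. poly [:Complex (a $ k / 2) (b $ k / 2), 0, Complex (a $ k / 2) (- (b $ k / 2)):] z)"

lemma circle_curve_cis:
  "circle_curve a b (cis \<theta>) = cis \<theta> *s cpoint (cos \<theta> *\<^sub>R a + sin \<theta> *\<^sub>R b) 0"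
proof -
  have "Complex (x / 2) (y / 2) + cis \<theta> * (cis \<theta> * Complex (x / 2) (- (y / 2)))
      = cis \<theta> * Complex (cos \<theta> * x + sin \<theta> * y) 0" for x y
  proof -
    have 1: "1 = cis \<theta> * cis (- \<theta>)" by (simp add: cis_mult)
    have "Complex (x / 2) (y / 2) + cis \<theta> * (cis \<theta> * Complex (x / 2) (- (y / 2)))
        = cis \<theta> * (cis (- \<theta>) * Complex (x / 2) (y / 2) + cis \<theta> * Complex (x / 2) (- (y / 2)))"
      using 1 by (simp add: distrib_left mult.assoc[symmetric])
    also have "cis (- \<theta>) * Complex (x / 2) (y / 2) + cis \<theta> * Complex (x / 2) (- (y / 2))
        = Complex (cos \<theta> * x + sin \<theta> * y) 0"
      by (simp add: complex_eq_iff)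
    finally show ?thesis .
  qed
  then show ?thesis
    by (simp add: circle_curve_def cpoint_def vec_eq_iff)
qed

lemma circle_curve_inverse:
  assumes "z \<noteq> 0"
  shows "circle_curve a b z = z\<^sup>2 *s circle_curve a (- b) (1 / z)"
proof -
  have "z\<^sup>2 * (y + 1 / z * (1 / z * x)) = x + z * (z * y)" for x y
    using assms by (simp add: power2_eq_square distrib_left)
  then show ?thesis by (simp add: circle_curve_def vec_eq_iff)
qed

lemma norm_unit_circle:
  assumes "a \<bullet> a = 1" "b \<bullet> b = 1" "a \<bullet> b = 0"
  shows "cos \<theta> *\<^sub>R a + sin \<theta> *\<^sub>R b \<in> S2"
proof -
  have "(cos \<theta> *\<^sub>R a + sin \<theta> *\<^sub>R b) \<bullet> (cos \<theta> *\<^sub>R a + sin \<theta> *\<^sub>R b) = cos \<theta> * cos \<theta> + sin \<theta> * sin \<theta>"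
    using assms by (simp add: inner_add_left inner_add_right inner_commute[of b a])
  also have "\<dots> = 1" by (simp flip: power2_eq_square)
  finally show ?thesis by (simp add: norm_eq_sqrt_inner)
qed

lemma cform_circle_curve_polynomial:
  assumes "cform d P Pc"
  obtains q where "\<And>z. poly q z = Pc (circle_curve a b z)"
proof -
  obtain q where "\<forall>z. poly q z = Pc (circle_curve a b z)"
    using cform_along_polynomial_curve[OF assms, where
        u = "\<lambda>k. [:Complex (a $ k / 2) (b $ k / 2), 0, Complex (a $ k / 2) (- (b $ k / 2)):]"]
    unfolding circle_curve_def by blast
  then show ?thesis by (intro that[of q]) simp
qed

text \<open>
  The maximum principle gives the bound inside the unit disc, and the reflection \<open>z \<mapsto> 1 / z\<close> transports
  it to the outside.
\<close>
lemma cform_circle_curve_bound: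
  assumes P: "cform (int d) P Pc" and M: "\<And>p. p \<in> S2 \<Longrightarrow> \<bar>P p\<bar> \<le> M"
    and ab: "a \<bullet> a = 1" "b \<bullet> b = 1" "a \<bullet> b = 0"
  shows "norm (Pc (circle_curve a b z)) \<le> M * (max 1 (norm z)) ^ (2 * d)"
proof -
  have M0: "M \<ge> 0" using M[of a] ab(1) by (simp add: norm_eq_sqrt_inner)
  have disc: "norm (Pc (circle_curve a b z)) \<le> M"
    if "norm z \<le> 1" and ab: "a \<bullet> a = 1" "b \<bullet> b = 1" "a \<bullet> b = 0" for z a b
  proof -
    obtain q where q: "\<And>z. poly q z = Pc (circle_curve a b z)"
      using cform_circle_curve_polynomial[OF P] by blast
    have "norm (poly q z) \<le> M"
    proof (rule maximum_modulus_frontier[where S = "cball 0 1" and f = "poly q" and \<xi> = z])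
      fix w assume "w \<in> frontier (cball 0 1 :: complex set)"
      then have "norm w = 1" by simp
      then obtain \<theta> where \<theta>: "w = cis \<theta>" by (metis cis_Arg_unique complex_norm_eq_1_exp_eq cis_conv_exp)
      have "poly q w = cis \<theta> ^ d * of_real (P (cos \<theta> *\<^sub>R a + sin \<theta> *\<^sub>R b))"
        by (simp add: q \<theta> circle_curve_cis cform_scale[OF P] cform_real[OF P])
      then show "norm (poly q w) \<le> M"
        using M[OF norm_unit_circle[OF ab, of \<theta>]] by (simp add: norm_mult norm_power)
    qed (use that in \<open>auto intro!: holomorphic_intros continuous_intros\<close>)
    then show ?thesis by (simp add: q)
  qed
  show ?thesis
  proof (cases "norm z \<le> 1")
    case True
    then show ?thesis using disc[OF True ab] by (simp add: max_def)
  next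
    case False
    then have "z \<noteq> 0" by auto
    have "norm (Pc (circle_curve a b z)) = norm z ^ (2 * d) * norm (Pc (circle_curve a (- b) (1 / z)))"
      by (simp add: circle_curve_inverse[OF \<open>z \<noteq> 0\<close>, of a b] cform_scale[OF P] norm_mult norm_power power_mult)
    also have "\<dots> \<le> norm z ^ (2 * d) * M"
    proof (intro mult_left_mono disc)
      show "norm (1 / z) \<le> 1" using False by (simp add: norm_divide divide_le_eq_1)
    qed (use ab in auto)
    finally show ?thesis using False by (simp add: max_def mult.commute)
  qed
qed

text \<open>
  Cauchy's inequality turns the bound near the unit circle into a bound for the derivative along it, which is
  linear in \<open>d\<close> because the bound changes only by a constant factor at distance \<open>1 / d\<close>.
\<close>
lemma form_tangential_derivative_bound:
  assumes P: "form (int d) P" and M: "\<And>p. p \<in> S2 \<Longrightarrow> \<bar>P p\<bar> \<le> M"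
    and ab: "a \<bullet> a = 1" "b \<bullet> b = 1" "a \<bullet> b = 0" and d: "d > 0"
  shows "\<bar>\<Sum>k\<in>UNIV. b $ k * pd k P a\<bar> \<le> 9 * real d * M"
proof -
  obtain Pc where Pc: "cform (int d) P Pc" using form_complexification[OF P] by blast
  obtain q where q: "\<And>z. poly q z = Pc (circle_curve a b z)"
    using cform_circle_curve_polynomial[OF Pc] by blast
  have M0: "M \<ge> 0" using M[of a] ab(1) by (simp add: norm_eq_sqrt_inner)
  \<comment> \<open>Cauchy's inequality on the circle of radius \<open>1 / d\<close> around \<open>1\<close>, where \<open>\<bar>z\<bar>\<^sup>2\<^sup>d \<le> (1 + 1 / d)\<^sup>2\<^sup>d \<le> exp 2 \<le> 9\<close>.\<close>
  have "norm ((deriv ^^ 1) (poly q) 1) \<le> fact 1 * (9 * M) / (1 / real d) ^ 1"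
  proof (rule Cauchy_inequality)
    fix z :: complex assume "norm (1 - z) = 1 / real d"
    then have "norm z \<le> 1 + 1 / real d"
      using norm_triangle_ineq2[of z 1] by (simp add: norm_minus_commute)
    then have "max 1 (norm z) ^ (2 * d) \<le> (1 + 1 / real d) ^ (2 * d)"
      by (intro power_mono) auto
    also have "\<dots> = ((1 + 1 / real d) ^ d)\<^sup>2" by (simp add: power_mult power2_eq_square power_mult_distrib flip: power_add)
    also have "\<dots> \<le> 3\<^sup>2"
      using exp_ge_one_plus_x_over_n_power_n[of d 1] d exp_le by (intro power_mono) auto
    finally have "max 1 (norm z) ^ (2 * d) \<le> 9" by simp
    then have "M * max 1 (norm z) ^ (2 * d) \<le> M * 9" using M0 by (rule mult_left_mono)
    then show "norm (poly q z) \<le> 9 * M"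
      using cform_circle_curve_bound[OF Pc M ab, of z] by (simp add: q)
  qed (use d in \<open>auto intro!: holomorphic_intros continuous_intros\<close>)
  then have deriv_bound: "norm (poly (pderiv q) 1) \<le> 9 * real d * M"
    by (simp add: DERIV_imp_deriv[OF poly_DERIV] mult_ac)
  let ?T = "\<lambda>\<theta>. P (cos \<theta> *\<^sub>R a + sin \<theta> *\<^sub>R b)"
  have T: "(?T has_real_derivative (\<Sum>k\<in>UNIV. b $ k * pd k P a)) (at 0)"
  proof -
    have "((\<lambda>\<theta>. cos \<theta> *\<^sub>R a + sin \<theta> *\<^sub>R b) has_derivative (\<lambda>h. h *\<^sub>R b)) (at 0)"
      by (auto intro!: derivative_eq_intros)
    moreover have "(P has_derivative (\<lambda>h. \<Sum>k\<in>UNIV. h $ k * pd k P a)) (at (cos 0 *\<^sub>R a + sin 0 *\<^sub>R b))"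
      using polynomial_has_derivative[OF form_polynomial[OF P], of a] by simp
    ultimately have "(?T has_derivative (\<lambda>h. \<Sum>k\<in>UNIV. (h *\<^sub>R b) $ k * pd k P a)) (at 0)"
      by (rule has_derivative_compose)
    moreover have "(\<lambda>h. \<Sum>k\<in>UNIV. (h *\<^sub>R b) $ k * pd k P a) = (*) (\<Sum>k\<in>UNIV. b $ k * pd k P a)"
      by (simp add: fun_eq_iff sum_distrib_left mult_ac)
    ultimately show ?thesis by (simp only: has_field_derivative_def)
  qed
  \<comment> \<open>On the unit circle \<open>q\<close> is the real function \<open>?T\<close> times the phase \<open>cis (d \<theta>)\<close>.  Taking real parts removes the
    derivative of the phase at \<open>\<theta> = 0\<close>, which is imaginary.\<close>
  have "((\<lambda>\<theta>. cos (real d * \<theta>) * ?T \<theta>) has_real_derivative (\<Sum>k\<in>UNIV. b $ k * pd k P a)) (at 0)"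
    using T by (auto intro!: derivative_eq_intros)
  moreover have "Re (cis \<theta> ^ d) = cos (real d * \<theta>)" for \<theta>
    using Complex.DeMoivre[of \<theta> d] by simp
  then have "(\<lambda>\<theta>. cos (real d * \<theta>) * ?T \<theta>) = (\<lambda>\<theta>. Re (poly q (cis \<theta>)))"
  proof (intro ext)
    fix \<theta>
    have "poly q (cis \<theta>) = cis \<theta> ^ d * of_real (?T \<theta>)"
      by (simp add: q circle_curve_cis cform_scale[OF Pc] cform_real[OF Pc])
    then have "Re (poly q (cis \<theta>)) = Re (cis \<theta> ^ d) * ?T \<theta>" by simp
    then show "cos (real d * \<theta>) * ?T \<theta> = Re (poly q (cis \<theta>))"
      by (simp only: \<open>\<And>\<theta>. Re (cis \<theta> ^ d) = cos (real d * \<theta>)\<close>)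
  qed
  moreover have "((\<lambda>\<theta>. Re (poly q (cis \<theta>))) has_real_derivative Re (\<i> * poly (pderiv q) 1)) (at 0)"
  proof -
    have "(cis has_vector_derivative \<i>) (at 0)"
      using DERIV_cos[of 0] DERIV_sin[of 0] by (simp add: has_vector_derivative_complex_iff)
    moreover have "(poly q has_field_derivative poly (pderiv q) 1) (at (cis 0))"
      using poly_DERIV[of q 1] by simp
    ultimately have "(poly q \<circ> cis has_vector_derivative \<i> * poly (pderiv q) 1) (at 0)"
      by (rule field_vector_diff_chain_at)
    then show ?thesis unfolding has_vector_derivative_complex_iff by (simp add: o_def)
  qed
  ultimately have "(\<Sum>k\<in>UNIV. b $ k * pd k P a) = Re (\<i> * poly (pderiv q) 1)"
    using DERIV_unique by metis
  also have "\<bar>\<dots>\<bar> \<le> norm (\<i> * poly (pderiv q) 1)" by (rule abs_Re_le_cmod)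
  also have "\<dots> \<le> 9 * real d * M" using deriv_bound by (simp add: norm_mult)
  finally show ?thesis .
qed

text \<open>The radial part of a partial derivative is controlled by Euler's identity.\<close>
lemma form_pd_bound:
  assumes P: "form (int d) P" and M: "\<And>p. p \<in> S2 \<Longrightarrow> \<bar>P p\<bar> \<le> M" and p: "p \<in> S2"
  shows "\<bar>pd k P p\<bar> \<le> 10 * real d * M"
proof (cases "d = 0")
  case True
  then have "pd k P = (\<lambda>_. 0)" using form_negative[OF form_pd[OF P, of k]] by simp
  then show ?thesis using True by simp
next
  case False
  let ?D = "\<lambda>u. \<Sum>j\<in>UNIV. u $ j * pd j P p"
  have pp: "p \<bullet> p = 1" using p by (simp add: dot_square_norm)
  define w where "w = axis k 1 - (p $ k) *\<^sub>R p"
  have wp: "p \<bullet> w = 0"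
    using pp by (simp add: w_def inner_diff_right inner_axis)
  have "w \<bullet> w = 1 - (p $ k)\<^sup>2"
    using pp by (simp add: w_def inner_diff_right inner_diff_left inner_axis inner_axis' power2_eq_square)
  then have w1: "norm w \<le> 1" by (simp add: norm_eq_sqrt_inner)
  have "\<bar>p $ k\<bar> \<le> 1" using component_le_norm_cart[of p k] p by simp
  have M0: "M \<ge> 0" using M[OF p] by linarith
  have "pd k P p = ?D (axis k 1)"
    using exhaust_3[of k] by (auto simp: sum_3 axis_def)
  also have "\<dots> = ?D ((p $ k) *\<^sub>R p + w)" by (simp add: w_def)
  also have "\<dots> = p $ k * ?D p + ?D w"
    by (simp add: sum.distrib distrib_right sum_distrib_left mult.assoc)
  also have "?D p = real d * P p" using Euler_identity[OF P, of p] by (simp add: sum_3)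
  finally have eq: "pd k P p = p $ k * (real d * P p) + ?D w" .
  have "\<bar>p $ k * (real d * P p)\<bar> \<le> 1 * (real d * M)"
    unfolding abs_mult using \<open>\<bar>p $ k\<bar> \<le> 1\<close> M[OF p] M0 by (intro mult_mono) auto
  moreover have "\<bar>?D w\<bar> \<le> 9 * real d * M"
  proof (cases "w = 0")
    case True
    then show ?thesis using M0 by simp
  next
    case w: False
    define u where "u = (1 / norm w) *\<^sub>R w"
    have "u \<bullet> u = 1" "p \<bullet> u = 0"
      using w wp by (simp_all add: u_def dot_square_norm power2_eq_square)
    from form_tangential_derivative_bound[OF P M pp this] False
    have D: "\<bar>?D u\<bar> \<le> 9 * real d * M" by simp
    have "?D w = norm w * ?D u"
      using w by (simp add: u_def sum_distrib_left)
    then have "\<bar>?D w\<bar> = norm w * \<bar>?D u\<bar>" by (simp add: abs_mult)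
    also have "\<dots> \<le> 1 * (9 * real d * M)"
      using w1 D by (intro mult_mono) auto
    finally show ?thesis by simp
  qed
  ultimately show ?thesis unfolding eq by linarith
qed

section \<open>Taylor coefficients of forms\<close>

definition bounded_form :: "nat \<Rightarrow> (real^3 \<Rightarrow> real) \<Rightarrow> real \<Rightarrow> bool"
  where "bounded_form d P M \<longleftrightarrow> form (int d) P \<and> (\<forall>p. \<bar>P p\<bar> \<le> M * norm p ^ d)"

lemma bounded_formI:
  assumes P: "form (int d) P" and M: "\<And>p. p \<in> S2 \<Longrightarrow> \<bar>P p\<bar> \<le> M"
  shows "bounded_form d P M"
  unfolding bounded_form_def
proof (intro conjI allI P)
  fix p :: "real^3"
  obtain q where q: "q \<in> S2" "p = norm p *\<^sub>R q" by (rule scaled_sphere_point)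
  have "P p = norm p ^ d * P q"
    using form_scale[OF P, of "norm p" q] q(2) by simp
  then have "\<bar>P p\<bar> = norm p ^ d * \<bar>P q\<bar>" by (simp add: abs_mult)
  also have "\<dots> \<le> norm p ^ d * M" by (intro mult_left_mono M q) simp
  finally show "\<bar>P p\<bar> \<le> M * norm p ^ d" by (simp add: mult.commute)
qed

lemma bounded_form_on_sphere: "bounded_form d P M \<Longrightarrow> p \<in> S2 \<Longrightarrow> \<bar>P p\<bar> \<le> M"
proof -
  assume "bounded_form d P M" and p: "p \<in> S2"
  then have "\<bar>P p\<bar> \<le> M * norm p ^ d" unfolding bounded_form_def by blast
  then show ?thesis using p by simp
qed

lemma bounded_form_pd:
  assumes "bounded_form (Suc d) P M"
  shows "bounded_form d (pd k P) (10 * real (Suc d) * M)"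
proof (rule bounded_formI)
  have P: "form (int (Suc d)) P" using assms by (simp add: bounded_form_def)
  then show "form (int d) (pd k P)" using form_pd[OF P, of k] by simp
  fix p assume "p \<in> S2"
  then show "\<bar>pd k P p\<bar> \<le> 10 * real (Suc d) * M"
    using form_pd_bound[OF P bounded_form_on_sphere[OF assms]] by blast
qed

lemma bounded_form_iterated_pd:
  assumes "bounded_form d P M" "m \<le> d"
  shows "bounded_form (d - m) ((pd k ^^ m) P) (M * 10 ^ m * (fact d / fact (d - m)))"
  using assms(2)
proof (induction m)
  case 0
  then show ?case using assms(1) by simp
next
  case (Suc m)
  then have eq: "d - m = Suc (d - Suc m)" by simp
  have "bounded_form (Suc (d - Suc m)) ((pd k ^^ m) P) (M * 10 ^ m * (fact d / fact (d - m)))"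
    using Suc by (simp flip: eq)
  from bounded_form_pd[OF this, of k]
  have "bounded_form (d - Suc m) ((pd k ^^ Suc m) P)
      (10 * real (Suc (d - Suc m)) * (M * 10 ^ m * (fact d / fact (Suc (d - Suc m)))))"
    by (simp only: eq funpow.simps o_apply)
  moreover have "10 * real (Suc n) * (M * 10 ^ m * (fact d / fact (Suc n))) = M * 10 ^ Suc m * (fact d / fact n)" for n
    unfolding fact_Suc by (simp add: field_simps del: of_nat_Suc)
  ultimately show ?case by simp
qed

lemma form_iterated_pd: "form z P \<Longrightarrow> form (z - int m) ((pd k ^^ m) P)"
proof (induction m)
  case (Suc m)
  from form_pd[OF Suc.IH[OF Suc.prems], of k] show ?case by (simp add: algebra_simps)
qed simp

lemma form_Taylor_along_axis:
  assumes P: "form z P" and z: "z \<le> int D"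
  shows "P (p + t *\<^sub>R axis k 1) = (\<Sum>m\<le>D. (pd k ^^ m) P p / fact m * t ^ m)"
proof -
  let ?diff = "\<lambda>m t. (pd k ^^ m) P (p + t *\<^sub>R axis k 1)"
  have "\<forall>m x. (?diff m has_real_derivative ?diff (Suc m) x) (at x)"
    using polynomial_DERIV_axis[OF form_polynomial[OF form_iterated_pd[OF P]]] by simp
  from Maclaurin_all_le[OF _ this, of "\<lambda>t. P (p + t *\<^sub>R axis k 1)" t "Suc D"]
  obtain s where s: "P (p + t *\<^sub>R axis k 1)
      = (\<Sum>m<Suc D. ?diff m 0 / fact m * t ^ m) + ?diff (Suc D) s / fact (Suc D) * t ^ Suc D"
    by auto
  have "(pd k ^^ Suc D) P = (\<lambda>_. 0)"
    by (rule form_negative[OF form_iterated_pd[OF P]]) (use z in simp)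
  then show ?thesis using s by (simp add: lessThan_Suc_atMost del: funpow.simps)
qed

lemma prod_UNIV_3: "(\<Prod>i\<in>UNIV. f i) = f 1 * f 2 * f (3 :: 3)"
  unfolding UNIV_3 by (simp add: ac_simps)

definition Taylor_coeff :: "(real^3 \<Rightarrow> real) \<Rightarrow> real^3 \<Rightarrow> (3 \<Rightarrow> nat) \<Rightarrow> real"
  where "Taylor_coeff P p \<alpha> = (pd 3 ^^ \<alpha> 3) ((pd 2 ^^ \<alpha> 2) ((pd 1 ^^ \<alpha> 1) P)) p
    / (fact (\<alpha> 1) * fact (\<alpha> 2) * fact (\<alpha> 3))"

definition multi_box :: "nat \<Rightarrow> (3 \<Rightarrow> nat) set"
  where "multi_box D = {\<alpha>. \<forall>i. \<alpha> i \<le> D}"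

lemma finite_multi_box: "finite (multi_box D)"
proof -
  have "multi_box D = PiE UNIV (\<lambda>_. {..D})" by (auto simp: multi_box_def PiE_def)
  then show ?thesis by (simp add: finite_PiE)
qed

lemma sum_multi_box:
  "(\<Sum>\<alpha>\<in>multi_box D. f (\<alpha> 1) (\<alpha> 2) (\<alpha> 3)) = (\<Sum>i\<le>D. \<Sum>j\<le>D. \<Sum>k\<le>D. f i j k)"
proof -
  let ?g = "\<lambda>(i, j, k). (\<lambda>n :: 3. if n = 1 then i else if n = 2 then j else k :: nat)"
  have "(\<Sum>\<alpha>\<in>multi_box D. f (\<alpha> 1) (\<alpha> 2) (\<alpha> 3)) = (\<Sum>(i, j, k)\<in>{..D} \<times> {..D} \<times> {..D}. f i j k)"
  proof (rule sum.reindex_bij_witness[of _ ?g "\<lambda>\<alpha>. (\<alpha> 1, \<alpha> 2, \<alpha> 3)"])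
    fix \<alpha> :: "3 \<Rightarrow> nat"
    show "?g (\<alpha> 1, \<alpha> 2, \<alpha> 3) = \<alpha>"
      by (rule ext) (use exhaust_3 in auto)
  qed (auto simp: multi_box_def)
  also have "\<dots> = (\<Sum>i\<le>D. \<Sum>j\<le>D. \<Sum>k\<le>D. f i j k)"
    by (simp add: sum.cartesian_product case_prod_unfold)
  finally show ?thesis .
qed

lemma form_Taylor:
  assumes P: "form z P" and z: "z \<le> int D"
  shows "P q = (\<Sum>\<alpha>\<in>multi_box D. Taylor_coeff P p \<alpha> * (\<Prod>i\<in>UNIV. (q $ i - p $ i) ^ \<alpha> i))"
proof -
  define h where "h = q - p"
  let ?e = "\<lambda>k. h $ k *\<^sub>R axis k (1::real)"
  have q: "q = ((p + ?e 3) + ?e 2) + ?e 1"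
    by (simp add: h_def vec_eq_iff forall_3 axis_def)
  let ?d = "\<lambda>i j k. (pd 3 ^^ k) ((pd 2 ^^ j) ((pd 1 ^^ i) P)) p / (fact i * fact j * fact k)"
  have "P q = (\<Sum>i\<le>D. (pd 1 ^^ i) P ((p + ?e 3) + ?e 2) / fact i * h $ 1 ^ i)"
    unfolding q by (rule form_Taylor_along_axis[OF P z])
  also have "\<dots> = (\<Sum>i\<le>D. (\<Sum>j\<le>D. (pd 2 ^^ j) ((pd 1 ^^ i) P) (p + ?e 3) / fact j * h $ 2 ^ j) / fact i * h $ 1 ^ i)"
  proof (rule sum.cong[OF refl])
    fix i
    have "z - int i \<le> int D" using z by simp
    from form_Taylor_along_axis[OF form_iterated_pd[OF P] this]
    show "(pd 1 ^^ i) P ((p + ?e 3) + ?e 2) / fact i * h $ 1 ^ i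
      = (\<Sum>j\<le>D. (pd 2 ^^ j) ((pd 1 ^^ i) P) (p + ?e 3) / fact j * h $ 2 ^ j) / fact i * h $ 1 ^ i" by simp
  qed
  also have "\<dots> = (\<Sum>i\<le>D. (\<Sum>j\<le>D. (\<Sum>k\<le>D. (pd 3 ^^ k) ((pd 2 ^^ j) ((pd 1 ^^ i) P)) p / fact k * h $ 3 ^ k)
      / fact j * h $ 2 ^ j) / fact i * h $ 1 ^ i)"
  proof (intro sum.cong[OF refl] arg_cong2[where f = "(*)"] arg_cong2[where f = "(/)"] refl)
    fix i j
    have "z - int i - int j \<le> int D" using z by simp
    from form_Taylor_along_axis[OF form_iterated_pd[OF form_iterated_pd[OF P]] this]
    show "(pd 2 ^^ j) ((pd 1 ^^ i) P) (p + ?e 3)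
      = (\<Sum>k\<le>D. (pd 3 ^^ k) ((pd 2 ^^ j) ((pd 1 ^^ i) P)) p / fact k * h $ 3 ^ k)" .
  qed
  also have "\<dots> = (\<Sum>i\<le>D. \<Sum>j\<le>D. \<Sum>k\<le>D. ?d i j k * (h $ 1 ^ i * h $ 2 ^ j * h $ 3 ^ k))"
    by (simp add: sum_distrib_left sum_distrib_right sum_divide_distrib field_simps)
  also have "\<dots> = (\<Sum>\<alpha>\<in>multi_box D. ?d (\<alpha> 1) (\<alpha> 2) (\<alpha> 3) * (h $ 1 ^ \<alpha> 1 * h $ 2 ^ \<alpha> 2 * h $ 3 ^ \<alpha> 3))"
    by (rule sum_multi_box[symmetric])
  also have "\<dots> = (\<Sum>\<alpha>\<in>multi_box D. Taylor_coeff P p \<alpha> * (\<Prod>i\<in>UNIV. (q $ i - p $ i) ^ \<alpha> i))"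
    by (simp add: Taylor_coeff_def h_def prod_UNIV_3)
  finally show ?thesis .
qed

lemma Taylor_coeff_outside_box:
  assumes P: "form z P" and z: "z \<le> int D" and \<alpha>: "\<alpha> \<notin> multi_box D"
  shows "Taylor_coeff P p \<alpha> = 0"
proof -
  obtain i where "\<alpha> i > D" using \<alpha> by (auto simp: multi_box_def not_le)
  then have "D < \<alpha> 1 + \<alpha> 2 + \<alpha> 3" using exhaust_3[of i] by auto
  then have "z - int (\<alpha> 1) - int (\<alpha> 2) - int (\<alpha> 3) < 0" using z by simp
  from form_negative[OF form_iterated_pd[OF form_iterated_pd[OF form_iterated_pd[OF P]]] this]
  show ?thesis by (simp add: Taylor_coeff_def)
qed

text \<open>
  One step of the estimate for the absolute sum of all Taylor coefficients.  If \<open>\<Phi>\<close> is bounded by \<open>N x\<^sup>e\<close> on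
  forms of degree \<open>e\<close> and bound \<open>N\<close>, then adding up the derivatives in one more direction
  replaces \<open>x\<close> by \<open>x + 10 r\<close>: the factors \<open>e! / (e - m)!\<close> in the Bernstein bounds turn the sum into a
  binomial expansion.
\<close>
lemma sum_iterated_pd_bound:
  assumes \<Phi>: "\<And>e Q N. bounded_form e Q N \<Longrightarrow> e \<le> D \<Longrightarrow> \<Phi> Q \<le> N * x ^ e" "\<Phi> (\<lambda>_. 0) = (0::real)"
    and Q: "bounded_form e Q N" and e: "e \<le> D" and r: "r \<ge> 0"
  shows "(\<Sum>m\<le>D. \<Phi> ((pd k ^^ m) Q) * (r ^ m / fact m)) \<le> N * (x + 10 * r) ^ e"
proof -
  have fQ: "form (int e) Q" using Q by (simp add: bounded_form_def)
  have zero: "(pd k ^^ m) Q = (\<lambda>_. 0)" if "m > e" for m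
    by (rule form_negative[OF form_iterated_pd[OF fQ]]) (use that in simp)
  have "(\<Sum>m\<le>D. \<Phi> ((pd k ^^ m) Q) * (r ^ m / fact m)) = (\<Sum>m\<le>e. \<Phi> ((pd k ^^ m) Q) * (r ^ m / fact m))"
    using e zero \<Phi>(2) by (intro sum.mono_neutral_right) auto
  also have "\<dots> \<le> (\<Sum>m\<le>e. N * (of_nat (e choose m) * (10 * r) ^ m * x ^ (e - m)))"
  proof (rule sum_mono)
    fix m assume "m \<in> {..e}"
    then have m: "m \<le> e" by simp
    have "\<Phi> ((pd k ^^ m) Q) * (r ^ m / fact m) \<le> N * 10 ^ m * (fact e / fact (e - m)) * x ^ (e - m) * (r ^ m / fact m)"
      using \<Phi>(1)[OF bounded_form_iterated_pd[OF Q m]] e r by (intro mult_right_mono) auto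
    also have "\<dots> = N * (of_nat (e choose m) * (10 * r) ^ m * x ^ (e - m))"
      by (simp add: binomial_fact[OF m] power_mult_distrib field_simps)
    finally show "\<Phi> ((pd k ^^ m) Q) * (r ^ m / fact m) \<le> N * (of_nat (e choose m) * (10 * r) ^ m * x ^ (e - m))" .
  qed
  also have "\<dots> = N * (10 * r + x) ^ e"
    by (simp only: binomial_ring sum_distrib_left)
  also have "\<dots> = N * (x + 10 * r) ^ e"
    by (simp only: add.commute)
  finally show ?thesis .
qed

lemma Taylor_coeff_sum_bound:
  assumes P: "bounded_form d P M" and r: "r \<ge> 0"
  shows "(\<Sum>\<alpha>\<in>multi_box d. \<bar>Taylor_coeff P p \<alpha>\<bar> * (r ^ \<alpha> 1 * r ^ \<alpha> 2 * r ^ \<alpha> 3)) \<le> M * (norm p + 30 * r) ^ d"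
proof -
  define S where "S = (\<lambda>k \<Phi> Q. \<Sum>m\<le>d. \<Phi> ((pd k ^^ m) Q) * (r ^ m / fact m :: real))"
  have S_eq: "S k \<Phi> Q = (\<Sum>m\<le>d. \<Phi> ((pd k ^^ m) Q) * (r ^ m / fact m))" for k \<Phi> Q
    by (simp add: S_def)
  define \<Phi>0 where "\<Phi>0 = (\<lambda>Q :: real^3 \<Rightarrow> real. \<bar>Q p\<bar>)"
  have pd0: "(pd k ^^ m) (\<lambda>_. 0) = (\<lambda>_. 0)" for k m
    by (induction m) simp_all
  have S0: "S k \<Phi> (\<lambda>_. 0) = 0" if "\<Phi> (\<lambda>_. 0) = 0" for k \<Phi>
    using that by (simp add: S_eq pd0)
  have 0: "\<Phi>0 Q \<le> N * norm p ^ e" if "bounded_form e Q N" "e \<le> d" for e Q N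
    using that by (simp add: \<Phi>0_def bounded_form_def)
  have z0: "\<Phi>0 (\<lambda>_. 0) = 0" by (simp add: \<Phi>0_def)
  have 1: "S 3 \<Phi>0 Q \<le> N * (norm p + 10 * r) ^ e" if "bounded_form e Q N" "e \<le> d" for e Q N
    unfolding S_eq by (rule sum_iterated_pd_bound[where \<Phi> = \<Phi>0, OF 0 z0 that r])
  have 2: "S 2 (S 3 \<Phi>0) Q \<le> N * (norm p + 10 * r + 10 * r) ^ e" if "bounded_form e Q N" "e \<le> d" for e Q N
    unfolding S_eq[of 2] by (rule sum_iterated_pd_bound[where \<Phi> = "S 3 \<Phi>0", OF 1 S0[where \<Phi> = \<Phi>0, OF z0] that r])
  have "S 1 (S 2 (S 3 \<Phi>0)) P \<le> M * (norm p + 10 * r + 10 * r + 10 * r) ^ d"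
    unfolding S_eq[of 1]
    by (rule sum_iterated_pd_bound[where \<Phi> = "S 2 (S 3 \<Phi>0)", OF 2 S0[where \<Phi> = "S 3 \<Phi>0", OF S0[where \<Phi> = \<Phi>0, OF z0]] P order_refl r])
  moreover have "S 1 (S 2 (S 3 \<Phi>0)) P
    = (\<Sum>i\<le>d. \<Sum>j\<le>d. \<Sum>k\<le>d. \<bar>(pd 3 ^^ k) ((pd 2 ^^ j) ((pd 1 ^^ i) P)) p / (fact i * fact j * fact k)\<bar>
        * (r ^ i * r ^ j * r ^ k))"
    by (simp add: S_eq \<Phi>0_def sum_distrib_left sum_distrib_right abs_mult field_simps)
  also have "\<dots> = (\<Sum>\<alpha>\<in>multi_box d. \<bar>Taylor_coeff P p \<alpha>\<bar> * (r ^ \<alpha> 1 * r ^ \<alpha> 2 * r ^ \<alpha> 3))"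
    unfolding Taylor_coeff_def by (rule sum_multi_box[symmetric])
  ultimately show ?thesis by (simp add: algebra_simps)
qed

section \<open>Analyticity inside the ball\<close>

text \<open>
  At a point of norm \<open>x < 1\<close> the absolute Taylor sums of the terms are dominated by the geometric series of
  \<open>x + 30 r\<close>, so for small \<open>r\<close> the double series over degrees and multi-indices can be rearranged into a
  power series.
\<close>
lemma bounded_forms_series_power_expansion:
  assumes T: "\<And>d. bounded_form d (T d) M" and p: "p \<in> ball 0 1"
  shows "\<exists>r>0. r \<le> 1 - norm p \<and> (\<exists>c. \<forall>q\<in>ball p r.
    ((\<lambda>\<alpha>. c \<alpha> * (\<Prod>i\<in>UNIV. (q $ i - p $ i) ^ \<alpha> i)) has_sum (\<Sum>d. T d q)) UNIV)"
proof -
  have p1: "norm p < 1" using p by simp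
  \<comment> \<open>Any radius with \<open>\<bar>p\<bar> + 30 r < 1\<close> would do.\<close>
  define r where "r = (1 - norm p) / 40"
  define \<rho> where "\<rho> = norm p + 30 * r"
  have r: "r > 0" "r \<le> 1 - norm p" using p1 by (simp_all add: r_def field_simps)
  have \<rho>: "0 \<le> \<rho>" "\<rho> < 1" using p1 r(1) by (simp_all add: \<rho>_def) (simp add: r_def field_simps)
  define w where "w = (\<lambda>\<alpha> :: 3 \<Rightarrow> nat. r ^ \<alpha> 1 * r ^ \<alpha> 2 * r ^ \<alpha> 3)"
  have w: "w \<alpha> > 0" for \<alpha> using r(1) by (simp add: w_def)
  define t where "t = (\<lambda>d. Taylor_coeff (T d) p)"
  have fT: "form (int d) (T d)" for d using T by (simp add: bounded_form_def)
  have t0: "t d \<alpha> = 0" if "\<alpha> \<notin> multi_box d" for d \<alpha>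
    unfolding t_def by (rule Taylor_coeff_outside_box[OF fT order_refl that])
  have sum_t: "(\<Sum>\<alpha>\<in>multi_box d. \<bar>t d \<alpha>\<bar> * w \<alpha>) \<le> M * \<rho> ^ d" for d
    unfolding t_def w_def \<rho>_def using r(1) by (intro Taylor_coeff_sum_bound T) simp
  have geometric: "summable (\<lambda>d. M * \<rho> ^ d)"
    using \<rho> by (intro summable_mult summable_geometric) simp
  have summable_t: "(\<lambda>d. t d \<alpha>) summable_on UNIV" for \<alpha>
  proof -
    have "\<bar>t d \<alpha>\<bar> \<le> M * \<rho> ^ d / w \<alpha>" for d
    proof (cases "\<alpha> \<in> multi_box d")
      case True
      have "\<bar>t d \<alpha>\<bar> * w \<alpha> \<le> (\<Sum>\<alpha>\<in>multi_box d. \<bar>t d \<alpha>\<bar> * w \<alpha>)"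
        using True w[THEN less_imp_le] by (intro member_le_sum finite_multi_box mult_nonneg_nonneg) auto
      then have "\<bar>t d \<alpha>\<bar> * w \<alpha> \<le> M * \<rho> ^ d" using sum_t[of d] by linarith
      then show ?thesis using w[of \<alpha>] by (simp add: field_simps)
    next
      case False
      have "0 \<le> (\<Sum>\<alpha>\<in>multi_box d. \<bar>t d \<alpha>\<bar> * w \<alpha>)"
        using w by (intro sum_nonneg) (simp add: less_imp_le)
      then show ?thesis using sum_t[of d] w[of \<alpha>] t0[OF False] by simp
    qed
    then have "summable (\<lambda>d. norm (t d \<alpha>))"
      by (intro summable_comparison_test'[OF summable_divide[OF geometric, of "w \<alpha>"], of 0]) simp
    then show ?thesis by (rule norm_summable_imp_summable_on)
  qed
  define c where "c = (\<lambda>\<alpha>. \<Sum>\<^sub>\<infinity>d. t d \<alpha>)"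
  have "((\<lambda>\<alpha>. c \<alpha> * (\<Prod>i\<in>UNIV. (q $ i - p $ i) ^ \<alpha> i)) has_sum (\<Sum>d. T d q)) UNIV" if q: "q \<in> ball p r" for q
  proof -
    define h where "h = (\<lambda>\<alpha>. \<Prod>i\<in>UNIV. (q $ i - p $ i) ^ \<alpha> i)"
    have hw: "\<bar>h \<alpha>\<bar> \<le> w \<alpha>" for \<alpha>
    proof -
      have "\<bar>q $ i - p $ i\<bar> \<le> r" for i
        using component_le_norm_cart[of "q - p" i] q by (simp add: dist_norm norm_minus_commute)
      then have "\<bar>q $ i - p $ i\<bar> ^ \<alpha> i \<le> r ^ \<alpha> i" for i by (intro power_mono) auto
      then show ?thesis
        unfolding h_def w_def prod_UNIV_3 abs_mult power_abs using r(1) by (intro mult_mono) auto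
    qed
    have inner_T: "((\<lambda>\<alpha>. t d \<alpha> * h \<alpha>) has_sum T d q) UNIV" for d
      unfolding form_Taylor[OF fT order_refl, of d q p]
      by (rule has_sum_finite_neutralI[of "multi_box d"])
        (use finite_multi_box t0 in \<open>auto simp: t_def h_def\<close>)
    have inner_norm: "((\<lambda>\<alpha>. norm (t d \<alpha> * h \<alpha>)) has_sum (\<Sum>\<alpha>\<in>multi_box d. norm (t d \<alpha> * h \<alpha>))) UNIV" for d
      by (rule has_sum_finite_neutralI[of "multi_box d"]) (use finite_multi_box t0 in auto)
    have norm_le: "(\<Sum>\<alpha>\<in>multi_box d. norm (t d \<alpha> * h \<alpha>)) \<le> M * \<rho> ^ d" for d
    proof -
      have "(\<Sum>\<alpha>\<in>multi_box d. norm (t d \<alpha> * h \<alpha>)) \<le> (\<Sum>\<alpha>\<in>multi_box d. \<bar>t d \<alpha>\<bar> * w \<alpha>)"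
        by (intro sum_mono) (simp add: abs_mult hw mult_left_mono)
      then show ?thesis using sum_t[of d] by linarith
    qed
    have "(\<lambda>x. norm (case x of (d, \<alpha>) \<Rightarrow> t d \<alpha> * h \<alpha>)) summable_on (UNIV \<times> UNIV)"
    proof (rule Infinite_Sum.abs_summable_on_Sigma_iff[THEN iffD2], intro conjI ballI)
      fix d :: nat
      show "(\<lambda>\<alpha>. norm (case (d, \<alpha>) of (d, \<alpha>) \<Rightarrow> t d \<alpha> * h \<alpha>)) summable_on UNIV"
        using inner_norm[of d] by (auto simp: summable_on_def)
    next
      have "summable (\<lambda>d. \<Sum>\<alpha>\<in>multi_box d. norm (t d \<alpha> * h \<alpha>))"
        using norm_le by (intro summable_comparison_test'[OF geometric, of 0]) (auto intro: sum_nonneg)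
      then have "(\<lambda>d. \<Sum>\<alpha>\<in>multi_box d. norm (t d \<alpha> * h \<alpha>)) summable_on UNIV"
        by (subst summable_on_UNIV_nonneg_real_iff) (auto intro: sum_nonneg)
      then show "(\<lambda>d. norm (\<Sum>\<^sub>\<infinity>\<alpha>\<in>UNIV. norm (case (d, \<alpha>) of (d, \<alpha>) \<Rightarrow> t d \<alpha> * h \<alpha>))) summable_on UNIV"
        using infsumI[OF inner_norm] by (simp add: sum_nonneg abs_of_nonneg)
    qed
    then obtain S where S: "((\<lambda>(d, \<alpha>). t d \<alpha> * h \<alpha>) has_sum S) (UNIV \<times> UNIV)"
      using abs_summable_summable summable_on_def by blast
    have "((\<lambda>d. T d q) has_sum S) UNIV"
      using has_sum_SigmaD[OF S, of "\<lambda>d. T d q"] inner_T by simp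
    then have "S = (\<Sum>d. T d q)"
      using has_sum_imp_sums sums_unique by blast
    moreover have "((\<lambda>(\<alpha>, d). t d \<alpha> * h \<alpha>) has_sum S) (UNIV \<times> UNIV)"
      using S by (subst has_sum_swap) simp
    then have "((\<lambda>\<alpha>. c \<alpha> * h \<alpha>) has_sum S) UNIV"
    proof (rule has_sum_SigmaD)
      fix \<alpha> :: "3 \<Rightarrow> nat"
      have "((\<lambda>d. t d \<alpha>) has_sum c \<alpha>) UNIV"
        unfolding c_def using summable_t by (rule has_sum_infsum)
      from has_sum_cmult_left[OF this, of "h \<alpha>"]
      show "((\<lambda>d. case (\<alpha>, d) of (\<alpha>, d) \<Rightarrow> t d \<alpha> * h \<alpha>) has_sum c \<alpha> * h \<alpha>) UNIV" by simp
    qed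
    ultimately show ?thesis by (simp add: h_def)
  qed
  with r show ?thesis by blast
qed

text \<open>
  A late term is the difference of two partial sums, both of which are uniformly close to \<open>f\<close>; each of the finitely
  many other terms is bounded by compactness.
\<close>
lemma product_series_terms_bounded:
  assumes "product_series_on_S2 f l v"
  shows "\<exists>M. \<forall>d. bounded_form d (\<lambda>p. l d * linear_product d (v d) p) M"
proof -
  let ?T = "\<lambda>d p. l d * linear_product d (v d) p"
  have form: "form (int d) (?T d)" for d by (rule form_cmult[OF form_linear_product])
  obtain N where N: "\<And>n p. n \<ge> N \<Longrightarrow> p \<in> S2 \<Longrightarrow> dist (product_partial_sum l v n p) (f p) < 1"
    using assms unfolding product_series_on_S2_def uniform_limit_iff eventually_sequentially
    by (metis zero_less_one)
  have large: "\<bar>?T d p\<bar> \<le> 2" if "d > N" "p \<in> S2" for d p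
  proof -
    have "d = Suc (d - 1)" "d - 1 \<ge> N" using that by auto
    then obtain n where n: "d = Suc n" "n \<ge> N" by blast
    have "?T d p = product_partial_sum l v (Suc n) p - product_partial_sum l v n p"
      by (simp add: product_partial_sum_eq n)
    then show ?thesis
      using N[of "Suc n" p] N[of n p] n that by (simp add: dist_real_def abs_if split: if_splits)
  qed
  have "\<exists>B\<ge>0. \<forall>p\<in>S2. \<bar>?T d p\<bar> \<le> B" for d
  proof -
    obtain B where "\<And>p. p \<in> S2 \<Longrightarrow> \<bar>?T d p\<bar> \<le> B"
      using continuous_bounded_S2[OF polynomial_continuous_on[OF form_polynomial[OF form]]] by blast
    then show ?thesis by (intro exI[of _ "max B 0"]) (auto simp: le_max_iff_disj)
  qed
  then obtain B where B: "\<And>d. B d \<ge> 0" "\<And>d p. p \<in> S2 \<Longrightarrow> \<bar>?T d p\<bar> \<le> B d" by metis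
  have "\<bar>?T d p\<bar> \<le> 2 + (\<Sum>d\<le>N. B d)" if "p \<in> S2" for d p
  proof (cases "d \<le> N")
    case True
    then have "B d \<le> (\<Sum>d\<le>N. B d)" using B(1) by (intro member_le_sum) auto
    then show ?thesis using B(2)[OF that, of d] by linarith
  next
    case False
    have "0 \<le> (\<Sum>d\<le>N. B d)" using B(1) by (rule sum_nonneg)
    then show ?thesis using large[of d p] False that by linarith
  qed
  then show ?thesis using bounded_formI[OF form] by blast
qed

lemma product_series_analytic_extension:
  assumes lv: "product_series_on_S2 f l v"
  shows "\<exists>g. (\<forall>p\<in>S2. g p = f p) \<and>
    (\<forall>p\<in>cball 0 1. (\<lambda>N. product_partial_sum l v N p) \<longlonglongrightarrow> g p) \<and> g real_analytic_on ball 0 1"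
proof -
  define T where "T = (\<lambda>d p. l d * linear_product d (v d) p)"
  obtain M where M: "\<And>d. bounded_form d (T d) M"
    using product_series_terms_bounded[OF lv] unfolding T_def by blast
  define g where "g = (\<lambda>p. if p \<in> S2 then f p else (\<Sum>d. T d p))"
  have "(\<lambda>N. product_partial_sum l v N p) \<longlonglongrightarrow> g p" if p: "p \<in> cball 0 1" for p
  proof (cases "p \<in> S2")
    case True
    then show ?thesis
      using tendsto_uniform_limitI[OF lv[unfolded product_series_on_S2_def]] by (simp add: g_def)
  next
    case False
    then have "norm p < 1" using p by auto
    then have "summable (\<lambda>d. M * norm p ^ d)" by (intro summable_mult summable_geometric) simp
    then have "summable (\<lambda>d. T d p)"
      by (rule summable_comparison_test'[of _ 0]) (use M in \<open>simp add: bounded_form_def\<close>)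
    then show ?thesis
      using summable_LIMSEQ'[of "\<lambda>d. T d p"] False by (simp add: product_partial_sum_eq[abs_def] g_def T_def)
  qed
  moreover have "g real_analytic_on ball 0 1"
    unfolding real_analytic_on_def
  proof
    fix p :: "real^3" assume "p \<in> ball 0 1"
    from bounded_forms_series_power_expansion[OF M this]
    obtain r c where r: "r > 0" "r \<le> 1 - norm p"
      and c: "\<forall>q\<in>ball p r. ((\<lambda>\<alpha>. c \<alpha> * (\<Prod>i\<in>UNIV. (q $ i - p $ i) ^ \<alpha> i)) has_sum (\<Sum>d. T d q)) UNIV"
      by blast
    have "g q = (\<Sum>d. T d q)" if "q \<in> ball p r" for q
    proof -
      have "norm q < 1"
        using that r(2) norm_triangle_ineq[of p "q - p"] by (simp add: dist_norm norm_minus_commute)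
      then show ?thesis by (simp add: g_def)
    qed
    with r(1) c show "\<exists>r>0. \<exists>c. \<forall>q\<in>ball p r. ((\<lambda>\<alpha>. c \<alpha> * (\<Prod>i\<in>UNIV. (q $ i - p $ i) ^ \<alpha> i)) has_sum g q) UNIV"
      by (intro exI[of _ r] conjI exI[of _ c]) auto
  qed
  ultimately show ?thesis by (intro exI[of _ g]) (simp add: g_def)
qed

section \<open>The multipole theorem\<close>

theorem theorem3:
  shows "(\<forall>f. square_integrable_S2 f \<longrightarrow>
            (\<exists>l v. multipole_representation f l v) \<and>
            (\<forall>l v. multipole_representation f l v \<longrightarrow>
               (\<forall>d e. d \<noteq> e \<longrightarrow>
                  (LINT p|S2_measure. multipole_block l v d p * multipole_block l v e p) = 0)) \<and>
            (\<forall>l v l' v'. multipole_representation f l v \<longrightarrow> multipole_representation f l' v' \<longrightarrow>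
               (\<forall>d. \<forall>k\<le>d. same_up_to_order_and_scaling k (l d k) (v d k) (l' d k) (v' d k)))) \<and>
         (\<forall>g. continuous_on S2 g \<longrightarrow> (\<forall>e>0. \<exists>f\<in>F_S2. \<forall>p\<in>S2. \<bar>f p - g p\<bar> < e)) \<and>
         (\<forall>R. orthogonal_transformation R \<longrightarrow> (\<forall>f\<in>F_S2. f \<circ> R \<in> F_S2)) \<and>
         (\<forall>f\<in>F_S2. \<forall>l v. product_series_on_S2 f l v \<longrightarrow>
            (\<exists>g. (\<forall>p\<in>S2. g p = f p) \<and>
                 (\<forall>p\<in>cball 0 1. (\<lambda>N. product_partial_sum l v N p) \<longlonglongrightarrow> g p) \<and>
                 g real_analytic_on ball 0 1))"
proof (intro conjI allI impI ballI)
  fix f assume f: "square_integrable_S2 f"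
  show "\<exists>l v. multipole_representation f l v"
    using multipole_representation_exists[OF f] .
  show "(LINT p|S2_measure. multipole_block l v d p * multipole_block l v e p) = 0"
    if "multipole_representation f l v" "d \<noteq> e" for l v d e
    using spherical_harmonics_orthogonal[of d "multipole_block l v d" e "multipole_block l v e"] that
    by (simp add: multipole_representation_def S2_inner_def)
  show "same_up_to_order_and_scaling k (l d k) (v d k) (l' d k) (v' d k)"
    if "multipole_representation f l v" "multipole_representation f l' v'" "k \<le> d" for l v l' v' d k
    using multipole_representation_unique[OF f that] .
next
  fix g :: "real^3 \<Rightarrow> real" and e :: real
  assume "continuous_on S2 g" "e > 0"
  then show "\<exists>f\<in>F_S2. \<forall>p\<in>S2. \<bar>f p - g p\<bar> < e" by (rule F_S2_dense)
next
  fix R :: "real^3 \<Rightarrow> real^3" and f assume "orthogonal_transformation R" "f \<in> F_S2"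
  then show "f \<circ> R \<in> F_S2" by (rule F_S2_orthogonal_invariant)
next
  fix f l v assume "product_series_on_S2 f l v"
  then show "\<exists>g. (\<forall>p\<in>S2. g p = f p) \<and>
      (\<forall>p\<in>cball 0 1. (\<lambda>N. product_partial_sum l v N p) \<longlonglongrightarrow> g p) \<and> g real_analytic_on ball 0 1"
    by (rule product_series_analytic_extension)
qed

end
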